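(* Let $S$ be a numerical semigroup with multiplicity $m$, $k$ a field, $R=k[\![S]\!]$ with maximal ideal $\mathfrak m$. Let $E=\{e_1,\dots,e_r\}+S$ be an ideal of $S$ with $0\notin E$, and let $I=(t^{e_1},\dots,t^{e_r})\subseteq R$. The following statements are equivalent: (1) $\operatorname{gr}_{\mathfrak m}(I)$ is a one-dimensional Cohen-Macaulay $\operatorname{gr}_{\mathfrak m}(R)$-module; (2) $(t^m)^*$ is not a zero-divisor of $\operatorname{gr}_{\mathfrak m}(I)$; (3) $\operatorname{ord}_E(e+m)=\operatorname{ord}_E(e)+1$ for all $e\in E$; (4) $a_i(E)=b_i(E)$ for all $i=0,\dots,m-1$.
   Context: A numerical semigroup is a submonoid $S$ of $(\mathbb N,+)$ with $\mathbb N\setminus S$ finite; its multiplicity $m$ is its smallest nonzero element; $k[\![S]\!]=k[\![t^s\mid s\in S]\!]\subseteq k[\![t]\!]$, with maximal ideal $\mathfrak m=(t^s\mid 0\neq s\in S)$. An ideal of $S$ is a non-empty set $E\subseteq S$ with $E+S\subseteq E$; $\{e_1,\dots,e_r\}+S=\bigcup_i(e_i+S)$. $\operatorname{gr}_{\mathfrak m}(N)=\bigoplus_{i\ge0}\mathfrak m^iN/\mathfrak m^{i+1}N$ for an $R$-module $N$. $(t^m)^*$ is the initial form of $t^m$ in $\operatorname{gr}_{\mathfrak m}(R)$, i.e. its class in $\mathfrak m/\mathfrak m^2$. Let $M=S\setminus\{0\}$, $lM=M+\dots+M$ ($l$ summands), $0M=S$. For sets of integers, $X-Y=\{z\in\mathbb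 Z\mid z+Y\subseteq X\}$. $\operatorname{ord}_E(e)=\max\{l+1\mid e\in lM+E\}$ for $e\in E$. Let $\alpha_i$ be the smallest element of $E$ congruent to $i$ modulo $m$. Let $E'=\bigcup_{l\ge1}\big((E+(l-1)M)-lM\big)$, and let $\alpha_i'$ be the smallest element of $E'$ congruent to $i$ modulo $m$. Then $a_i(E)$ is the unique integer with $\alpha_i'+m\,a_i(E)=\alpha_i$, and $b_i(E)=\operatorname{ord}_E(\alpha_i)$. *)

theory Defs
  imports
    "HOL-Algebra.Ideal"
    "HOL-Algebra.Module"
    "HOL-Computational_Algebra.Formal_Power_Series"
    "HOL-Library.Set_Algebras"
    "HOL-Library.Extended_Nat"
    "HOL-Number_Theory.Cong"
begin

section \<open>Modules over a commutative ring\<close>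

text \<open>The fields \<open>mult\<close> and \<open>one\<close>, which a module record inherits from ring records, play no
  role in the locale \<^locale>\<open>module\<close>; they are left undefined in the quotient, localized and
  graded modules below.\<close>

definition self_module :: "('a, 'm) ring_scheme \<Rightarrow> ('a, 'a) module" where
  "self_module R = \<lparr>carrier = carrier R, monoid.mult = monoid.mult R, one = one R,
     ring.zero = zero R, add = add R, smult = monoid.mult R\<rparr>"

definition ideal_module :: "('a, 'm) ring_scheme \<Rightarrow> 'a set \<Rightarrow> ('a, 'a) module" where
  "ideal_module R I = (self_module R)\<lparr>carrier := I\<rparr>"

text \<open>Conversely, the ring whose product is the action of a module on its own elements.\<close>

definition ring_of_action :: "('a, 'a) module \<Rightarrow> 'a \<Rightarrow> 'a ring" where
  "ring_of_action N u = \<lparr>carrier = carrier N, monoid.mult = (\<lambda>a x. a \<odot>\<^bsub>N\<^esub> x), one = u,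
     ring.zero = zero N, add = add N\<rparr>"

definition submodule_span :: "('a, 'm) ring_scheme \<Rightarrow> ('a, 'b) module \<Rightarrow> 'b set \<Rightarrow> 'b set" where
  "submodule_span R M X = \<Inter> {H. submodule H R M \<and> X \<subseteq> H}"

definition ideal_smult :: "('a, 'm) ring_scheme \<Rightarrow> 'a set \<Rightarrow> ('a, 'b) module \<Rightarrow> 'b set \<Rightarrow> 'b set" where
  "ideal_smult R A M N = submodule_span R M {a \<odot>\<^bsub>M\<^esub> x | a x. a \<in> A \<and> x \<in> N}"

definition quot_module :: "('a, 'b) module \<Rightarrow> 'b set \<Rightarrow> ('a, 'b set) module" where
  "quot_module M N = \<lparr>carrier = a_rcosets\<^bsub>M\<^esub> N, monoid.mult = undefined, one = undefined,
     ring.zero = N, add = set_add M, smult = (\<lambda>a X. \<Union>x\<in>X. N +>\<^bsub>M\<^esub> (a \<odot>\<^bsub>M\<^esub> x))\<rparr>"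

definition annihilator :: "('a, 'm) ring_scheme \<Rightarrow> ('a, 'b) module \<Rightarrow> 'a set" where
  "annihilator R M = {a \<in> carrier R. \<forall>x\<in>carrier M. a \<odot>\<^bsub>M\<^esub> x = \<zero>\<^bsub>M\<^esub>}"

definition zero_divisor_on :: "('a, 'b) module \<Rightarrow> 'a \<Rightarrow> bool" where
  "zero_divisor_on M a \<longleftrightarrow> (\<exists>x\<in>carrier M. x \<noteq> \<zero>\<^bsub>M\<^esub> \<and> a \<odot>\<^bsub>M\<^esub> x = \<zero>\<^bsub>M\<^esub>)"


section \<open>Localization at a prime ideal\<close>

text \<open>The fraction \<open>x / s\<close> is the set of all pairs \<open>(y, t)\<close> with \<open>u (t x - s y) = 0\<close> for some
  \<open>u\<close> outside the prime ideal.\<close>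

definition fraction ::
  "('a, 'm) ring_scheme \<Rightarrow> ('a, 'b) module \<Rightarrow> 'a set \<Rightarrow> 'b \<Rightarrow> 'a \<Rightarrow> ('b \<times> 'a) set" where
  "fraction R M P x s = {(y, t). y \<in> carrier M \<and> t \<in> carrier R - P \<and>
     (\<exists>u\<in>carrier R - P. u \<odot>\<^bsub>M\<^esub> (t \<odot>\<^bsub>M\<^esub> x) = u \<odot>\<^bsub>M\<^esub> (s \<odot>\<^bsub>M\<^esub> y))}"

definition loc_module ::
  "('a, 'm) ring_scheme \<Rightarrow> ('a, 'b) module \<Rightarrow> 'a set \<Rightarrow> (('a \<times> 'a) set, ('b \<times> 'a) set) module" where
  "loc_module R M P = \<lparr>
     carrier = {fraction R M P x s | x s. x \<in> carrier M \<and> s \<in> carrier R - P},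
     monoid.mult = undefined, one = undefined,
     ring.zero = fraction R M P \<zero>\<^bsub>M\<^esub> \<one>\<^bsub>R\<^esub>,
     add = (\<lambda>X Y. \<Union>(x, s)\<in>X. \<Union>(y, t)\<in>Y.
       fraction R M P ((t \<odot>\<^bsub>M\<^esub> x) \<oplus>\<^bsub>M\<^esub> (s \<odot>\<^bsub>M\<^esub> y)) (s \<otimes>\<^bsub>R\<^esub> t)),
     smult = (\<lambda>X Y. \<Union>(a, s)\<in>X. \<Union>(y, t)\<in>Y. fraction R M P (a \<odot>\<^bsub>M\<^esub> y) (s \<otimes>\<^bsub>R\<^esub> t))\<rparr>"

definition loc_ring :: "('a, 'm) ring_scheme \<Rightarrow> 'a set \<Rightarrow> ('a \<times> 'a) set ring" where
  "loc_ring R P = ring_of_action (loc_module R (self_module R) P)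
     (fraction R (self_module R) P \<one>\<^bsub>R\<^esub> \<one>\<^bsub>R\<^esub>)"


section \<open>Dimension, depth and Cohen-Macaulay modules\<close>

text \<open>The notions of this section are meant for finitely generated modules over noetherian
  rings.\<close>

text \<open>The dimension of \<open>M\<close> is the Krull dimension of \<open>R / Ann M\<close>.\<close>

definition module_dim :: "('a, 'm) ring_scheme \<Rightarrow> ('a, 'b) module \<Rightarrow> enat" where
  "module_dim R M = Sup {enat n | n. \<exists>P :: nat \<Rightarrow> 'a set.
     (\<forall>i\<le>n. primeideal (P i) R \<and> annihilator R M \<subseteq> P i) \<and> (\<forall>i<n. P i \<subset> P (Suc i))}"

definition regular_sequence :: "('a, 'm) ring_scheme \<Rightarrow> ('a, 'b) module \<Rightarrow> 'a list \<Rightarrow> bool" where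
  "regular_sequence R M as \<longleftrightarrow> set as \<subseteq> carrier R \<and>
     (\<forall>i<length as. \<not> zero_divisor_on
        (quot_module M (ideal_smult R (set (take i as)) M (carrier M))) (as ! i)) \<and>
     ideal_smult R (set as) M (carrier M) \<noteq> carrier M"

definition depth :: "('a, 'm) ring_scheme \<Rightarrow> 'a set \<Rightarrow> ('a, 'b) module \<Rightarrow> enat" where
  "depth R J M = Sup {enat (length as) | as. set as \<subseteq> J \<and> regular_sequence R M as}"

text \<open>The maximal ideal of a local ring is its set of non-units.\<close>

definition local_cohen_macaulay :: "('a, 'm) ring_scheme \<Rightarrow> ('a, 'b) module \<Rightarrow> bool" where
  "local_cohen_macaulay R M \<longleftrightarrow> depth R (carrier R - Units R) M = module_dim R M"

definition in_support :: "('a, 'm) ring_scheme \<Rightarrow> ('a, 'b) module \<Rightarrow> 'a set \<Rightarrow> bool" where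
  "in_support R M P \<longleftrightarrow> carrier (loc_module R M P) \<noteq> {\<zero>\<^bsub>loc_module R M P\<^esub>}"

definition cohen_macaulay :: "('a, 'm) ring_scheme \<Rightarrow> ('a, 'b) module \<Rightarrow> bool" where
  "cohen_macaulay R M \<longleftrightarrow> (\<forall>P. maximalideal P R \<and> in_support R M P \<longrightarrow>
     local_cohen_macaulay (loc_ring R P) (loc_module R M P))"


section \<open>Associated graded rings and modules\<close>

primrec adic_power :: "('a, 'm) ring_scheme \<Rightarrow> 'a set \<Rightarrow> ('a, 'b) module \<Rightarrow> nat \<Rightarrow> 'b set" where
  "adic_power R J M 0 = carrier M"
| "adic_power R J M (Suc i) = ideal_smult R J M (adic_power R J M i)"

definition gr_component ::
  "('a, 'm) ring_scheme \<Rightarrow> 'a set \<Rightarrow> ('a, 'b) module \<Rightarrow> nat \<Rightarrow> ('a, 'b set) module" where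
  "gr_component R J M i =
     quot_module (M\<lparr>carrier := adic_power R J M i\<rparr>) (adic_power R J M (Suc i))"

text \<open>The product of a homogeneous element of the graded ring and one of the graded module whose
  degrees add up to \<open>n\<close>.\<close>

definition gr_hom_smult ::
  "('a, 'm) ring_scheme \<Rightarrow> 'a set \<Rightarrow> ('a, 'b) module \<Rightarrow> nat \<Rightarrow> 'a set \<Rightarrow> 'b set \<Rightarrow> 'b set" where
  "gr_hom_smult R J M n A B =
     (\<Union>a\<in>A. \<Union>b\<in>B. adic_power R J M (Suc n) +>\<^bsub>M\<^esub> (a \<odot>\<^bsub>M\<^esub> b))"

text \<open>An element of the direct sum is the sequence of its homogeneous components.\<close>

definition gr_module ::
  "('a, 'm) ring_scheme \<Rightarrow> 'a set \<Rightarrow> ('a, 'b) module \<Rightarrow> (nat \<Rightarrow> 'a set, nat \<Rightarrow> 'b set) module" where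
  "gr_module R J M = \<lparr>
     carrier = {f. (\<forall>i. f i \<in> carrier (gr_component R J M i)) \<and>
                   finite {i. f i \<noteq> \<zero>\<^bsub>gr_component R J M i\<^esub>}},
     monoid.mult = undefined, one = undefined,
     ring.zero = (\<lambda>i. \<zero>\<^bsub>gr_component R J M i\<^esub>),
     add = (\<lambda>f g i. f i \<oplus>\<^bsub>gr_component R J M i\<^esub> g i),
     smult = (\<lambda>f g n. finsum (gr_component R J M n)
       (\<lambda>i. gr_hom_smult R J M n (f i) (g (n - i))) {..n})\<rparr>"

definition gr_class :: "('a, 'm) ring_scheme \<Rightarrow> 'a set \<Rightarrow> nat \<Rightarrow> 'a \<Rightarrow> nat \<Rightarrow> 'a set" where
  "gr_class R J i a = (\<lambda>j. if j = i then adic_power R J (self_module R) (Suc i) +>\<^bsub>R\<^esub> a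
     else adic_power R J (self_module R) (Suc j))"

definition gr_ring :: "('a, 'm) ring_scheme \<Rightarrow> 'a set \<Rightarrow> (nat \<Rightarrow> 'a set) ring" where
  "gr_ring R J = ring_of_action (gr_module R J (self_module R)) (gr_class R J 0 \<one>\<^bsub>R\<^esub>)"


section \<open>Numerical semigroups and their ideals\<close>

definition numerical_semigroup :: "nat set \<Rightarrow> bool" where
  "numerical_semigroup S \<longleftrightarrow> 0 \<in> S \<and> (\<forall>x\<in>S. \<forall>y\<in>S. x + y \<in> S) \<and> finite (- S)"

definition sg_multiplicity :: "nat set \<Rightarrow> nat" where
  "sg_multiplicity S = (LEAST s. s \<in> S \<and> s \<noteq> 0)"

definition sg_ideal :: "nat set \<Rightarrow> nat set \<Rightarrow> bool" where
  "sg_ideal S E \<longleftrightarrow> E \<noteq> {} \<and> E \<subseteq> S \<and> E + S \<subseteq> E"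

text \<open>The \<open>l\<close>-fold sumset of \<open>S - {0}\<close>, where the \<open>0\<close>-fold one is \<open>S\<close> by convention.\<close>

definition sg_fold :: "nat set \<Rightarrow> nat \<Rightarrow> nat set" where
  "sg_fold S l = (if l = 0 then S else {\<Sum>i<l. x i | x. \<forall>i<l. x i \<in> S - {0}})"

definition sg_ord :: "nat set \<Rightarrow> nat set \<Rightarrow> nat \<Rightarrow> nat" where
  "sg_ord S E x = Max {l + 1 | l. x \<in> sg_fold S l + E}"

definition set_colon :: "int set \<Rightarrow> int set \<Rightarrow> int set" where
  "set_colon X Y = {z. \<forall>y\<in>Y. z + y \<in> X}"

text \<open>The set \<open>E'\<close>.\<close>

definition sg_blowup :: "nat set \<Rightarrow> nat set \<Rightarrow> int set" where
  "sg_blowup S E =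
     (\<Union>l\<in>{1..}. set_colon (int ` (E + sg_fold S (l - 1))) (int ` sg_fold S l))"

definition least_cong :: "'a::{unique_euclidean_semiring, ord} \<Rightarrow> 'a \<Rightarrow> 'a set \<Rightarrow> 'a" where
  "least_cong m i X = (LEAST x. x \<in> X \<and> [x = i] (mod m))"

definition sg_alpha :: "nat set \<Rightarrow> nat set \<Rightarrow> nat \<Rightarrow> nat" where
  "sg_alpha S E i = least_cong (sg_multiplicity S) i E"

definition sg_alpha' :: "nat set \<Rightarrow> nat set \<Rightarrow> nat \<Rightarrow> int" where
  "sg_alpha' S E i = least_cong (int (sg_multiplicity S)) (int i) (sg_blowup S E)"

definition sg_a :: "nat set \<Rightarrow> nat set \<Rightarrow> nat \<Rightarrow> int" where
  "sg_a S E i = (THE a. sg_alpha' S E i + int (sg_multiplicity S) * a = int (sg_alpha S E i))"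

definition sg_b :: "nat set \<Rightarrow> nat set \<Rightarrow> nat \<Rightarrow> nat" where
  "sg_b S E i = sg_ord S E (sg_alpha S E i)"


section \<open>The semigroup ring\<close>

definition semigroup_ring :: "nat set \<Rightarrow> 'k::field fps ring" where
  "semigroup_ring S = \<lparr>carrier = {f. \<forall>n. fps_nth f n \<noteq> 0 \<longrightarrow> n \<in> S}, monoid.mult = (*),
     one = 1, ring.zero = 0, add = (+)\<rparr>"

end

theory Submission
  imports "HOL-Computational_Algebra.Polynomial" Defs
begin

text \<open>Both \<open>gr(R)\<close> and \<open>gr(I)\<close> have a basis of monomials \<open>t^s\<close> (\<open>s \<in> S\<close>, respectively \<open>s \<in> E\<close>) sitting
  in the degree given by their order, and a product of monomials is the expected monomial if the
  orders add up and \<open>0\<close> otherwise. The initial form \<open>T\<close> of \<open>t^m\<close> hence kills a basis element \<open>t^e\<close> iff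
  \<open>ord(e + m) > ord(e) + 1\<close>, and otherwise shifts it. If this never happens, \<open>gr(I)\<close> is torsion free
  over \<open>k[T]\<close>. If it does, a power of the irrelevant maximal ideal kills \<open>t^e\<close>, because \<open>T\<close> generates a
  reduction of that ideal.

  All monomials but the powers of \<open>T\<close> are nilpotent in \<open>gr(R)\<close>, so \<open>gr(R)\<close> modulo its nilradical is
  \<open>k[T]\<close>. The coefficients of \<open>t^e\<close> for \<open>e = min E + j m\<close> define a semilinear map from \<open>gr(I)\<close> onto \<open>k[T]\<close>, so
  that \<open>gr(I)\<close> has dimension one at every maximal ideal, and the Cohen-Macaulay property only asks for
  one nonzerodivisor in each localization.

  For the last equivalence, \<open>z \<in> E'\<close> iff \<open>z + l m \<in> E\<close> has order at least \<open>l\<close> for some \<open>l \<ge> 1\<close>, again by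
  the reduction property. So \<open>a\<^sub>i = b\<^sub>i\<close> says that the order grows by exactly one at each step of
  \<open>\<alpha>\<^sub>i, \<alpha>\<^sub>i + m, \<alpha>\<^sub>i + 2 m, \<dots>\<close>.\<close>

section \<open>Orders in an ideal of a numerical semigroup\<close>

text \<open>The Cohen-Macaulay property is tested at every maximal ideal of gr(R), not only at the
  irrelevant one, and finite generation is never established. Two devices take its place. The first
  is a divisibility fact: if \<phi> f \<noteq> 0 and h lies in a prime P, then u h^n is a multiple
  of f for some n and some u outside P. It excludes chains of three primes and also stops regular
  sequences after one element. The second is the initial form x0 of t^(min E), on which \<psi> takes
  the value 1. In place of Nakayama's lemma it shows that the localizations are nonzero and that an
  element of P does not map the localized module onto itself. A failure of (3) is detected at the
  irrelevant ideal alone, whereas (3) must produce a nonzerodivisor at each maximal ideal; there it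
  is the lift of a nonzero polynomial in T.\<close>

primrec ipow :: "nat set \<Rightarrow> nat set \<Rightarrow> nat \<Rightarrow> nat set" where
  "ipow S X 0 = X"
| "ipow S X (Suc l) = (S - {0}) + ipow S X l"

text \<open>One less than the order, so that the initial form of \<open>t^x\<close> sits in degree
  \<open>sg_val S X x\<close>. For an ideal \<open>X\<close> the set \<open>ipow S X l\<close> is
  \<open>sg_fold S l + X\<close>, and for \<open>X = S\<close> it is lM itself, so one function
  serves both the ideal and the semigroup.\<close>

definition sg_val :: "nat set \<Rightarrow> nat set \<Rightarrow> nat \<Rightarrow> nat" where
  "sg_val S X x = Max {l. x \<in> ipow S X l}"

lemma ipow_SucI: "a \<in> S \<Longrightarrow> a \<noteq> 0 \<Longrightarrow> y \<in> ipow S X l \<Longrightarrow> a + y \<in> ipow S X (Suc l)"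
  unfolding ipow.simps by (rule set_plus_intro) auto

lemma ipow_SucE:
  assumes "x \<in> ipow S X (Suc l)"
  obtains a y where "x = a + y" "a \<in> S" "a \<noteq> 0" "y \<in> ipow S X l"
  using assms unfolding ipow.simps by (elim set_plus_elim) (metis DiffE insertCI)

locale num_semigroup =
  fixes S :: "nat set" and m :: nat
  assumes numerical: "numerical_semigroup S"
    and m_def: "m = sg_multiplicity S"
begin

lemma zero_mem: "0 \<in> S" and add_mem: "x \<in> S \<Longrightarrow> y \<in> S \<Longrightarrow> x + y \<in> S" and cofinite: "finite (- S)"
  using numerical unfolding numerical_semigroup_def by auto

lemma ex_nonzero: "\<exists>s. s \<in> S \<and> s \<noteq> 0"
proof (rule ccontr)
  assume "\<not> ?thesis"
  then have "UNIV = - S \<union> {0}" by auto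
  then show False using cofinite by (metis finite.emptyI finite_Un finite_insert infinite_UNIV_nat)
qed

lemma m_mem: "m \<in> S" and m_pos: "m > 0"
  using LeastI_ex[OF ex_nonzero] unfolding m_def sg_multiplicity_def by auto

lemma m_le: "s \<in> S \<Longrightarrow> s \<noteq> 0 \<Longrightarrow> m \<le> s"
  unfolding m_def sg_multiplicity_def by (simp add: Least_le)

lemma self_ideal: "sg_ideal S S"
  using zero_mem add_mem unfolding sg_ideal_def by (auto elim!: set_plus_elim)

lemma mult_m_mem: "j * m \<in> S"
  by (induction j) (auto simp: zero_mem m_mem add_mem)

end

locale num_ideal = num_semigroup +
  fixes X :: "nat set"
  assumes ideal: "sg_ideal S X"
begin

lemma X_sub: "X \<subseteq> S" and X_ne: "X \<noteq> {}" and X_add: "x \<in> X \<Longrightarrow> s \<in> S \<Longrightarrow> s + x \<in> X"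
  using ideal unfolding sg_ideal_def by (auto simp: add.commute)

abbreviation "D \<equiv> ipow S X"

abbreviation "v \<equiv> sg_val S X"

definition x0 :: nat where "x0 = (LEAST x. x \<in> X)"

lemma x0_mem: "x0 \<in> X" and x0_le: "x \<in> X \<Longrightarrow> x0 \<le> x"
  using X_ne unfolding x0_def by (auto intro: LeastI Least_le)

lemma ipow_add: "x \<in> D l \<Longrightarrow> s \<in> S \<Longrightarrow> s + x \<in> D l"
proof (induction l arbitrary: x)
  case 0
  then show ?case by (simp add: X_add)
next
  case (Suc l)
  then obtain a y where "x = a + y" "a \<in> S" "a \<noteq> 0" "y \<in> D l"
    by (elim ipow_SucE)
  then show ?case using Suc.IH[of y] Suc.prems ipow_SucI[of a S "s + y"] by (simp add: add.left_commute)
qed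

lemma ipow_Suc_sub: "D (Suc l) \<subseteq> D l"
proof
  fix x assume "x \<in> D (Suc l)" then show "x \<in> D l" by (elim ipow_SucE) (simp add: ipow_add)
qed

lemma ipow_antimono: "i \<le> j \<Longrightarrow> D j \<subseteq> D i"
  using lift_Suc_antimono_le[of D] ipow_Suc_sub by blast

lemma ipow_sub_X: "D l \<subseteq> X"
  using ipow_antimono[of 0 l] by simp

text \<open>Each of the \<open>l\<close> summands from \<open>S - {0}\<close> is at least
  \<open>m\<close>. The bound makes orders finite and pins them down along
  \<open>x0 + j * m\<close>.\<close>

lemma ipow_bound: "x \<in> D l \<Longrightarrow> l * m + x0 \<le> x"
proof (induction l arbitrary: x)
  case 0
  then show ?case by (simp add: x0_le)
next
  case (Suc l)
  then obtain a y where "x = a + y" "a \<in> S" "a \<noteq> 0" "y \<in> D l"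
    by (elim ipow_SucE)
  moreover have "m \<le> a" using calculation m_le by auto
  ultimately show ?case using Suc.IH[of y] by simp
qed

text \<open>Allows the results on ideals, such as cofiniteness and generation by monomials, to be
  applied to the filtration levels themselves.\<close>

lemma ipow_ideal: "sg_ideal S (D l)"
proof -
  have "D l \<noteq> {}"
  proof (induction l)
    case (Suc l)
    then show ?case using m_mem m_pos by (auto simp: set_plus_def)
  qed (use X_ne in simp)
  then show ?thesis unfolding sg_ideal_def
    using ipow_sub_X[of l] X_sub ipow_add[of _ l] by (auto elim!: set_plus_elim) (metis add.commute)
qed

text \<open>The \<open>Max\<close> in \<open>sg_val\<close> is meaningful only for a finite set;
  \<open>l \<le> l * m \<le> x\<close> bounds the levels.\<close>

lemma finite_levels: "finite {l. x \<in> D l}"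
proof (rule finite_subset)
  show "{l. x \<in> D l} \<subseteq> {..x}"
  proof (intro subsetI CollectI)
    fix l assume "l \<in> {l. x \<in> D l}"
    then have "l * m \<le> x" using ipow_bound[of x l] by simp
    moreover have "l \<le> l * m" using m_pos by simp
    ultimately show "l \<in> {..x}" unfolding atMost_iff by (rule order_trans[rotated])
  qed
qed simp

lemma mem_ipow_iff: "x \<in> X \<Longrightarrow> x \<in> D l \<longleftrightarrow> l \<le> v x"
proof
  assume "x \<in> D l" then show "l \<le> v x"
    unfolding sg_val_def using finite_levels by (simp add: Max_ge)
next
  assume "x \<in> X" "l \<le> v x"
  have "v x \<in> {l. x \<in> D l}"
    unfolding sg_val_def using finite_levels \<open>x \<in> X\<close>
    by (intro Max_in) (auto intro: exI[of _ 0])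
  then show "x \<in> D l" using ipow_antimono[OF \<open>l \<le> v x\<close>] by auto
qed

lemma mem_ipow_iff': "x \<in> D l \<longleftrightarrow> x \<in> X \<and> l \<le> v x"
  using mem_ipow_iff ipow_sub_X by blast

lemma v_bound: "x \<in> X \<Longrightarrow> v x * m + x0 \<le> x"
  using ipow_bound mem_ipow_iff by blast

lemma ipow_plus: "s \<in> ipow S S i \<Longrightarrow> x \<in> D j \<Longrightarrow> s + x \<in> D (i + j)"
proof (induction i arbitrary: s)
  case 0
  then show ?case by (simp add: ipow_add)
next
  case (Suc i)
  then obtain a y where "s = a + y" "a \<in> S" "a \<noteq> 0" "y \<in> ipow S S i"
    by (elim ipow_SucE)
  then show ?case using Suc.IH[of y] Suc.prems ipow_SucI[of a S "y + x"] by (simp add: add.assoc)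
qed

text \<open>From \<open>x0\<close> on, a number \<open>x0 + w\<close> can be missing from
  \<open>X\<close> only if \<open>w\<close> is a gap of \<open>S\<close>.\<close>

lemma cofinite_ideal: "finite (- X)"
proof -
  have "- X \<subseteq> {..<x0} \<union> (+) x0 ` (- S)"
  proof
    fix y assume y: "y \<in> - X"
    show "y \<in> {..<x0} \<union> (+) x0 ` (- S)"
    proof (cases "y < x0")
      case False
      then obtain w where w: "y = x0 + w" using le_Suc_ex[of x0 y] by auto
      then have "w \<notin> S"
        using X_add[OF x0_mem, of w] y by (auto simp: add.commute)
      then show ?thesis unfolding w by (intro UnI2 imageI) simp
    qed simp
  qed
  then show ?thesis using cofinite by (meson finite_Un finite_imageI finite_lessThan finite_subset)
qed

end

text \<open>The order on \<open>S\<close> is the special case \<open>X = S\<close>, where the least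
  element is 0. It grades the ring, while \<open>v\<close> grades the module.\<close>

sublocale num_semigroup \<subseteq> self: num_ideal S m S
  by unfold_locales (rule self_ideal)

context num_semigroup begin

abbreviation "u \<equiv> sg_val S S"

lemma self_x0: "self.x0 = 0"
  using self.x0_le[OF zero_mem] by simp

lemma u_mult_m: "u (j * m) = j"
proof -
  have "j * m \<in> ipow S S j"
  proof (induction j)
    case 0 then show ?case by (simp add: zero_mem)
  next
    case (Suc j)
    then show ?case using ipow_SucI[of m S "j * m"] m_mem m_pos by simp
  qed
  then have "j \<le> u (j * m)" using self.mem_ipow_iff' by blast
  moreover have "u (j * m) * m \<le> j * m" using self.v_bound[OF mult_m_mem] by (simp add: self_x0)
  ultimately show ?thesis using m_pos by simp
qed

lemma u_m: "u m = 1"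
  using u_mult_m[of 1] by simp

lemma u_zero: "u 0 = 0"
  using u_mult_m[of 0] by simp

lemma u_zero_iff: "s \<in> S \<Longrightarrow> u s = 0 \<longleftrightarrow> s = 0"
proof -
  assume s: "s \<in> S"
  { assume "s \<noteq> 0"
    then have "s + 0 \<in> ipow S S (Suc 0)" unfolding ipow.simps using s zero_mem by blast
    then have "u s \<ge> 1" using self.mem_ipow_iff' by (metis One_nat_def add.right_neutral)
  }
  then show ?thesis using u_zero by fastforce
qed

text \<open>The sets \<open>l M - l m\<close> form an increasing chain of cofinite sets of natural numbers, which is
  therefore stationary: \<open>t^m\<close> generates a reduction of the maximal ideal.\<close>

lemma reduction: "\<exists>L. \<forall>l\<ge>L. \<forall>x\<in>ipow S S (Suc l). \<exists>y\<in>ipow S S l. x = m + y"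
proof -
  define A where "A l = {x. x + l * m \<in> ipow S S l}" for l
  have A_mono: "A l \<subseteq> A l'" if le: "l \<le> l'" for l l'
  proof
    fix x assume "x \<in> A l"
    then have "(l' - l) * m + (x + l * m) \<in> ipow S S ((l' - l) + l)"
      unfolding A_def using self.ipow_plus[of "(l' - l) * m" "l' - l"] self.mem_ipow_iff'[of "(l' - l) * m"]
      by (auto simp: mult_m_mem u_mult_m)
    moreover obtain k where "l' = l + k" using le_Suc_ex[OF le] by blast
    then have "(l' - l) * m + (x + l * m) = x + l' * m" by (simp add: distrib_right)
    ultimately show "x \<in> A l'" using le unfolding A_def by simp
  qed
  \<comment> \<open>Only the finitely many gaps of \<open>S\<close> matter, since elements of
    \<open>S\<close> already lie in \<open>A 0\<close>. For a gap that never enters the chain the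
    \<open>LEAST\<close> is an unspecified number, which can only enlarge the maximum.\<close>
  define L where "L = Max (insert 0 ((\<lambda>x. LEAST l. x \<in> A l) ` (- S)))"
  have stat: "x \<in> A L" if "x \<in> A l" for x l
  proof (cases "x \<in> S")
    case True
    then have "x \<in> A 0" by (simp add: A_def)
    then show ?thesis using A_mono by blast
  next
    case False
    then have "(LEAST l. x \<in> A l) \<le> L" unfolding L_def using cofinite by (intro Max_ge) auto
    moreover have "x \<in> A (LEAST l. x \<in> A l)" using that by (rule LeastI)
    ultimately show ?thesis using A_mono by blast
  qed
  have "\<exists>y\<in>ipow S S l. x = m + y" if l: "l \<ge> L" and x: "x \<in> ipow S S (Suc l)" for l x
  proof -
    have le: "Suc l * m \<le> x" using self.ipow_bound[OF x] by (simp add: self_x0)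
    then have "x - Suc l * m \<in> A (Suc l)" using x by (simp add: A_def)
    then have "x - Suc l * m \<in> A l" using stat A_mono[OF l] by blast
    moreover have "x - Suc l * m + l * m = x - m" using le by simp
    ultimately have "x - m \<in> ipow S S l" unfolding A_def by simp
    then show ?thesis using le by (intro bexI[of _ "x - m"]) auto
  qed
  then show ?thesis by blast
qed

lemma sg_fold_eq: "sg_fold S l = ipow S S l"
proof (induction l)
  case 0
  then show ?case by (simp add: sg_fold_def)
next
  case (Suc l)
  show ?case
  \<comment> \<open>\<open>sg_fold S 0\<close> is \<open>S\<close> by convention and not
    \<open>{0}\<close>, so passing from level 0 to level 1 rests on M + S = M instead of splitting
    off a summand.\<close>
  proof (cases "l = 0")
    case True
    have "sg_fold S (Suc 0) = S - {0}"
      unfolding sg_fold_def by (auto simp: lessThan_Suc)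
    also have "\<dots> = ipow S S (Suc 0)"
    proof -
      have "S - {0} \<subseteq> (S - {0}) + S" using zero_mem by (metis add.right_neutral set_plus_intro subsetI)
      moreover have "(S - {0}) + S \<subseteq> S - {0}" using add_mem by (auto elim!: set_plus_elim)
      ultimately show ?thesis by auto
    qed
    finally show ?thesis using True by simp
  next
    case False
    have "sg_fold S (Suc l) = (S - {0}) + sg_fold S l"
    proof (intro equalityI subsetI)
      fix z assume "z \<in> sg_fold S (Suc l)"
      then obtain x where x: "z = (\<Sum>i<Suc l. x i)" "\<forall>i<Suc l. x i \<in> S - {0}"
        unfolding sg_fold_def by auto
      then have "z = x l + (\<Sum>i<l. x i)" by simp
      moreover have "(\<Sum>i<l. x i) \<in> sg_fold S l" using x False unfolding sg_fold_def by auto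
      ultimately show "z \<in> (S - {0}) + sg_fold S l" using x(2) by (metis lessI set_plus_intro)
    next
      fix z assume "z \<in> (S - {0}) + sg_fold S l"
      then obtain a x where x: "z = a + (\<Sum>i<l. x i)" "a \<in> S - {0}" "\<forall>i<l. x i \<in> S - {0}"
        using False unfolding sg_fold_def by (auto elim!: set_plus_elim simp del: Diff_iff)
      have "z = (\<Sum>i<Suc l. (x(l := a)) i)" using x(1) by simp
      moreover have "\<forall>i<Suc l. (x(l := a)) i \<in> S - {0}" using x by auto
      ultimately show "z \<in> sg_fold S (Suc l)" unfolding sg_fold_def by (simp only: nat.simps if_False) blast
    qed
    then show ?thesis using Suc by simp
  qed
qed

end

context num_ideal begin

lemma ipow_self_plus: "ipow S S l + X = D l"
proof (induction l)
  case 0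
  have "X \<subseteq> S + X" using zero_mem by (metis add_0 set_plus_intro subsetI)
  then show ?case using X_add by (auto elim!: set_plus_elim)
next
  case (Suc l)
  then show ?case by (simp add: add.assoc)
qed

lemma sg_ord_eq: "x \<in> X \<Longrightarrow> sg_ord S X x = v x + 1"
proof -
  assume x: "x \<in> X"
  have "{l + 1 | l. x \<in> sg_fold S l + X} = Suc ` {l. x \<in> D l}"
    by (auto simp: sg_fold_eq ipow_self_plus)
  moreover have "Max (Suc ` {l. x \<in> D l}) = Suc (Max {l. x \<in> D l})"
    by (rule mono_Max_commute[symmetric]) (use finite_levels x in \<open>auto intro: monoI exI[of _ 0]\<close>)
  ultimately show ?thesis by (simp add: sg_ord_def sg_val_def)
qed

text \<open>The filtration is multiplicative, so a sum may gain order but cannot lose any. A strict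
  gain is what makes the product of two initial forms vanish.\<close>

lemma v_superadd: "s \<in> S \<Longrightarrow> x \<in> X \<Longrightarrow> u s + v x \<le> v (s + x)"
  by (meson X_add ipow_plus mem_ipow_iff order_refl self.mem_ipow_iff)

lemma v_add_m: "x \<in> X \<Longrightarrow> v x + 1 \<le> v (x + m)"
  using v_superadd[OF m_mem, of x] by (simp add: u_m add.commute)

lemma add_mult_m_mem: "x \<in> X \<Longrightarrow> x + j * m \<in> X"
  using X_add mult_m_mem by (metis add.commute)

lemma v_add_mult_m: "x \<in> X \<Longrightarrow> v x + j \<le> v (x + j * m)"
  using v_superadd[OF mult_m_mem] by (metis add.commute u_mult_m)

text \<open>The bound \<open>v x * m + x0 \<le> x\<close> is attained on this ray, so the order
  cannot jump there, whatever the ideal. The map \<psi> reads off exactly these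
  coefficients.\<close>

lemma v_x0: "v (x0 + j * m) = j"
proof -
  have "v x0 + j \<le> v (x0 + j * m)" using v_add_mult_m[OF x0_mem] .
  moreover have "v (x0 + j * m) * m + x0 \<le> x0 + j * m" using v_bound add_mult_m_mem x0_mem by blast
  then have "v (x0 + j * m) \<le> j" using m_pos by simp
  ultimately show ?thesis by simp
qed

text \<open>An \<open>s\<close> of high order is \<open>m + s'\<close> with \<open>s'\<close> of
  order at least \<open>u s - 1\<close>, by the reduction property. Hence \<open>s + y\<close> is
  reached through \<open>y + m\<close>, and the excess order gained there is never lost
  again.\<close>

lemma v_strict_imp_nilpotent:
  assumes y: "y \<in> X" and jump: "v (y + m) \<noteq> v y + 1"
  shows "\<exists>L. \<forall>s\<in>S. L \<le> u s \<longrightarrow> u s + v y \<noteq> v (s + y)"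
proof -
  obtain L where L: "\<And>l x. l \<ge> L \<Longrightarrow> x \<in> ipow S S (Suc l) \<Longrightarrow> \<exists>y\<in>ipow S S l. x = m + y"
    using reduction by blast
  have "u s + v y < v (s + y)" if s: "s \<in> S" and ge: "Suc L \<le> u s" for s
  proof -
    obtain l where l: "u s = Suc l" "L \<le> l" using ge by (cases "u s") auto
    then have "s \<in> ipow S S (Suc l)" using s by (simp only: self.mem_ipow_iff)
    then obtain s' where s': "s' \<in> ipow S S l" "s = m + s'" using L l(2) by blast
    have "u s + v y < l + v (y + m)" using v_add_m[OF y] jump l by simp
    also have "\<dots> \<le> u s' + v (y + m)" using s' self.mem_ipow_iff' by auto
    also have "\<dots> \<le> v (s' + (y + m))"
      using v_superadd s' self.ipow_sub_X add_mult_m_mem[OF y, of 1] by auto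
    finally show ?thesis using s'(2) by (simp add: ac_simps)
  qed
  then show ?thesis by (metis nat_neq_iff)
qed

end

section \<open>The set E' and the invariants a_i and b_i\<close>

lemma int_set_least:
  fixes A :: "int set"
  assumes "A \<noteq> {}" "\<And>x. x \<in> A \<Longrightarrow> b \<le> x"
  shows "(LEAST x. x \<in> A) \<in> A" "x \<in> A \<Longrightarrow> (LEAST x. x \<in> A) \<le> x"
proof -
  let ?B = "(\<lambda>x. nat (x - b)) ` A"
  \<comment> \<open>The integers are not well-ordered; subtracting the lower bound \<open>b\<close>
    moves the set into the naturals, where a least element exists.\<close>
  obtain a where "a \<in> A" using assms(1) by blast
  then have "nat (a - b) \<in> ?B" by (rule imageI)
  then have "(LEAST n. n \<in> ?B) \<in> ?B" by (rule LeastI)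
  then obtain y where y: "y \<in> A" "nat (y - b) = (LEAST n. n \<in> ?B)"
    by (elim imageE) (rule that, simp_all only:)
  have le: "y \<le> x" if "x \<in> A" for x
  proof -
    have "nat (y - b) \<le> nat (x - b)" using y(2) that by (simp add: Least_le)
    then have "y - b \<le> x - b" using assms(2)[OF that] by (subst (asm) nat_le_eq_zle) simp_all
    then show ?thesis by simp
  qed
  have "(LEAST x. x \<in> A) = y" by (rule Least_equality) (use y le in auto)
  then show "(LEAST x. x \<in> A) \<in> A" "x \<in> A \<Longrightarrow> (LEAST x. x \<in> A) \<le> x" using y le by auto
qed

context num_ideal begin

lemma blowup_eq: "sg_blowup S X = {z. \<exists>l. \<exists>x\<in>D l. z + int (Suc l) * int m = int x}"
proof (intro equalityI subsetI)
  fix z assume "z \<in> sg_blowup S X"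
  then obtain l' where l': "l' \<ge> 1" "z \<in> set_colon (int ` (X + sg_fold S (l' - 1))) (int ` sg_fold S l')"
    unfolding sg_blowup_def by auto
  then obtain l where l: "l' = Suc l" by (cases l') auto
  have "Suc l * m \<in> sg_fold S l'"
    unfolding sg_fold_eq l by (subst self.mem_ipow_iff[OF mult_m_mem]) (simp only: u_mult_m)
  then have "z + int (Suc l * m) \<in> int ` (X + sg_fold S l)"
    using l' l unfolding set_colon_def by auto
  also have "X + sg_fold S l = D l" by (simp add: sg_fold_eq ipow_self_plus[symmetric] add.commute)
  finally show "z \<in> {z. \<exists>l. \<exists>x\<in>D l. z + int (Suc l) * int m = int x}"
    unfolding of_nat_mult by blast
next
  fix z assume "z \<in> {z. \<exists>l. \<exists>x\<in>D l. z + int (Suc l) * int m = int x}"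
  then obtain l x where lx: "x \<in> D l" "z + int (Suc l) * int m = int x" by auto
  obtain L where L: "\<And>l x. l \<ge> L \<Longrightarrow> x \<in> ipow S S (Suc l) \<Longrightarrow> \<exists>y\<in>ipow S S l. x = m + y"
    using reduction by blast
  \<comment> \<open>Iterating the reduction splits off one copy of \<open>m\<close> per level as
    long as the level stays above \<open>L\<close>.\<close>
  have L': "\<exists>y\<in>ipow S S L. x = j * m + y" if "x \<in> ipow S S (L + j)" for j x
    using that
  proof (induction j arbitrary: x)
    case (Suc j)
    then obtain y where "y \<in> ipow S S (L + j)" "x = m + y" using L[of "L + j" x] by auto
    then show ?case using Suc.IH[of y] by auto
  qed simp
  \<comment> \<open>An element of (l + 1)M need not be a shift by \<open>Suc l * m\<close>. At level
    \<open>L + Suc l\<close> every element is \<open>Suc l * m + w\<close> with \<open>w\<close> in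
    LM, so the one known shift of \<open>z\<close> decides all of them.\<close>
  have "z \<in> set_colon (int ` (X + sg_fold S (L + Suc l - 1))) (int ` sg_fold S (L + Suc l))"
    unfolding set_colon_def
  proof (intro CollectI ballI)
    fix y assume "y \<in> int ` sg_fold S (L + Suc l)"
    then obtain w where w: "w \<in> ipow S S L" "y = int (Suc l * m + w)"
      using L' unfolding sg_fold_eq by blast
    have "z + y = int (w + x)" using w(2) lx(2) by (simp add: distrib_right)
    moreover have "D (L + l) = X + sg_fold S (L + Suc l - 1)"
      by (simp add: sg_fold_eq ipow_self_plus[symmetric] add.commute)
    then have "w + x \<in> X + sg_fold S (L + Suc l - 1)" using ipow_plus[OF w(1) lx(1)] by simp
    ultimately show "z + y \<in> int ` (X + sg_fold S (L + Suc l - 1))" by (simp only: imageI)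
  qed
  then show "z \<in> sg_blowup S X" unfolding sg_blowup_def
    by (intro UN_I[of "L + Suc l"]) auto
qed

lemma alpha_mem: "sg_alpha S X i \<in> X" "[sg_alpha S X i = i] (mod m)"
  and alpha_le: "x \<in> X \<Longrightarrow> [x = i] (mod m) \<Longrightarrow> sg_alpha S X i \<le> x"
proof -
  have "\<exists>x. x \<in> X \<and> [x = i] (mod m)"
  proof -
    have "infinite (range (\<lambda>j. i + j * m))"
      by (rule range_inj_infinite) (use m_pos in \<open>auto simp: inj_def\<close>)
    then obtain j where "i + j * m \<in> X" using cofinite_ideal
      by (metis (no_types, lifting) ComplI finite_subset image_subsetI)
    then show ?thesis by (intro exI[of _ "i + j * m"]) (simp add: cong_def)
  qed
  from LeastI_ex[OF this] show "sg_alpha S X i \<in> X" "[sg_alpha S X i = i] (mod m)"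
    unfolding sg_alpha_def least_cong_def m_def by auto
  show "sg_alpha S X i \<le> x" if "x \<in> X" "[x = i] (mod m)"
    using that unfolding sg_alpha_def least_cong_def m_def by (simp add: Least_le)
qed

lemma ex_alpha: assumes "x \<in> X" "[x = i] (mod m)" shows "\<exists>j. x = sg_alpha S X i + j * m"
proof -
  have "[x = sg_alpha S X i] (mod m)" using assms(2) alpha_mem(2) cong_sym cong_trans by blast
  then show ?thesis using alpha_le[OF assms]
    by (metis cong_altdef_nat le_add_diff_inverse dvdE mult.commute)
qed

lemma alpha'_mem: "sg_alpha' S X i \<in> sg_blowup S X" "[sg_alpha' S X i = int i] (mod int m)"
  and alpha'_le: "z \<in> sg_blowup S X \<Longrightarrow> [z = int i] (mod int m) \<Longrightarrow> sg_alpha' S X i \<le> z"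
proof -
  let ?A = "{z. z \<in> sg_blowup S X \<and> [z = int i] (mod int m)}"
  \<comment> \<open>Taking \<open>l = 0\<close> in \<open>blowup_eq\<close> puts every element of
    \<open>X\<close>, lowered by \<open>m\<close>, into E'.\<close>
  have "int (sg_alpha S X i) - int m \<in> ?A"
    unfolding blowup_eq using alpha_mem[of i]
    by (auto intro!: exI[of _ 0] bexI[of _ "sg_alpha S X i"] simp: cong_def mod_diff_right_eq simp flip: zmod_int)
  then have ne: "?A \<noteq> {}" by blast
  \<comment> \<open>The shift is by \<open>Suc l\<close> copies of \<open>m\<close> but the level is
    only \<open>l\<close>. One copy stays uncovered, so the lower bound is \<open>- int m\<close>
    and not 0.\<close>
  have bd: "- int m \<le> z" if "z \<in> ?A" for z
  proof -
    obtain l x where x: "x \<in> D l" "z + int (Suc l) * int m = int x" using \<open>z \<in> ?A\<close> unfolding blowup_eq by auto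
    then have "int l * int m \<le> int x" using ipow_bound[OF x(1)] by (metis add_leD1 of_nat_le_iff of_nat_mult)
    then show ?thesis using x(2) by (simp add: algebra_simps)
  qed
  have eq: "sg_alpha' S X i = (LEAST z. z \<in> ?A)"
    unfolding sg_alpha'_def least_cong_def m_def by simp
  show "sg_alpha' S X i \<in> sg_blowup S X" "[sg_alpha' S X i = int i] (mod int m)"
    using int_set_least(1)[OF ne bd] unfolding eq by auto
  show "sg_alpha' S X i \<le> z" if "z \<in> sg_blowup S X" "[z = int i] (mod int m)"
    using int_set_least(2)[OF ne bd, of z] that unfolding eq by auto
qed

lemma a_eq: "sg_alpha' S X i + int m * sg_a S X i = int (sg_alpha S X i)"
proof -
  have "[sg_alpha' S X i = int (sg_alpha S X i)] (mod int m)"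
    using alpha'_mem(2) alpha_mem(2) by (metis cong_int_iff cong_sym cong_trans)
  then have "\<exists>a. sg_alpha' S X i + int m * a = int (sg_alpha S X i)"
    by (simp add: cong_iff_lin) metis
  then obtain a where a: "sg_alpha' S X i + int m * a = int (sg_alpha S X i)" ..
  moreover have "sg_a S X i = a" unfolding sg_a_def m_def[symmetric]
  proof (rule the_equality)
    show "a' = a" if "sg_alpha' S X i + int m * a' = int (sg_alpha S X i)" for a'
    proof -
      have "int m * a' = int m * a" using that a by linarith
      then show ?thesis using m_pos by simp
    qed
  qed (rule a)
  ultimately show ?thesis by simp
qed

text \<open>Each \<open>x\<close> on the ray from \<alpha> contributes
  \<open>x - m * (v x + 1)\<close> to E', and \<alpha>' is the least of these values. The starting
  point contributes \<alpha> - m b, so a is always at least b, and equality means that no later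
  point of the ray has more order than the steps account for.\<close>

lemma a_eq_b_iff: "sg_a S X i = int (sg_b S X i) \<longleftrightarrow> 
  (\<forall>j. v (sg_alpha S X i + j * m) = v (sg_alpha S X i) + j)" (is "_ \<longleftrightarrow> ?R")
proof -
  let ?\<alpha> = "sg_alpha S X i" 
  let ?z = "int ?\<alpha> - int m * int (Suc (v ?\<alpha>))"
  have b: "sg_b S X i = Suc (v ?\<alpha>)" unfolding sg_b_def using sg_ord_eq alpha_mem(1) by simp
  have z: "?z \<in> sg_blowup S X" "[?z = int i] (mod int m)"
  proof -
    have "?\<alpha> \<in> D (v ?\<alpha>)" using mem_ipow_iff alpha_mem(1) by simp
    moreover have "?z + int (Suc (v ?\<alpha>)) * int m = int ?\<alpha>" by (simp add: algebra_simps)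
    ultimately show "?z \<in> sg_blowup S X" unfolding blowup_eq by blast
    have "[?z = int ?\<alpha>] (mod int m)" by (simp add: cong_iff_dvd_diff)
    then show "[?z = int i] (mod int m)" using alpha_mem(2) by (metis cong_int_iff cong_trans)
  qed
  have "sg_a S X i = int (sg_b S X i) \<longleftrightarrow> int m * sg_a S X i = int m * int (Suc (v ?\<alpha>))"
    using b m_pos by simp
  also have "\<dots> \<longleftrightarrow> sg_alpha' S X i = ?z" using a_eq[of i] by linarith
  also have "\<dots> \<longleftrightarrow> ?R"
  proof
    assume eq: "sg_alpha' S X i = ?z"
    show ?R
    proof
      fix j
      let ?x = "?\<alpha> + j * m" and ?w = "int (?\<alpha> + j * m) - int m * int (Suc (v (?\<alpha> + j * m)))"
      have "?x \<in> D (v ?x)" using mem_ipow_iff add_mult_m_mem alpha_mem(1) by simp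
      moreover have "?w + int (Suc (v ?x)) * int m = int ?x" by (simp add: algebra_simps)
      ultimately have "?w \<in> sg_blowup S X" unfolding blowup_eq by blast
      moreover have "[?w = int ?\<alpha>] (mod int m)" by (simp add: cong_iff_dvd_diff)
      then have "[?w = int i] (mod int m)" using alpha_mem(2) by (metis cong_int_iff cong_trans)
      ultimately have "?z \<le> ?w" using alpha'_le eq by metis
      then have "int m * int (v ?x) \<le> int m * int (v ?\<alpha> + j)" by (simp add: algebra_simps)
      then have "v ?x \<le> v ?\<alpha> + j" using m_pos by (simp del: of_nat_add)
      then show "v ?x = v ?\<alpha> + j" using v_add_mult_m alpha_mem(1) by (simp add: order_antisym)
    qed
  next
    assume R: ?R
    obtain l x where x: "x \<in> D l" "sg_alpha' S X i + int (Suc l) * int m = int x"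
      using alpha'_mem(1)[of i] unfolding blowup_eq by auto
    have "[int x = sg_alpha' S X i] (mod int m)" using x(2)[symmetric] by (simp add: cong_iff_dvd_diff)
    then have "[x = i] (mod m)" using alpha'_mem(2) by (metis cong_int_iff cong_trans)
    then obtain j where j: "x = ?\<alpha> + j * m" using ex_alpha x(1) ipow_sub_X by blast
    have "l \<le> v ?\<alpha> + j" using R x(1) j mem_ipow_iff' by auto
    then have "int m * int l \<le> int m * (int (v ?\<alpha>) + int j)" by (intro mult_left_mono) auto
    then have "?z \<le> sg_alpha' S X i" using x(2) j by (simp add: algebra_simps)
    then show "sg_alpha' S X i = ?z" using alpha'_le[OF z] by simp
  qed
  finally show ?thesis .
qed

text \<open>Every \<open>x\<close> lies on the ray of its residue class, so exact growth at each
  single step is the same as exact growth measured from the start of each ray.\<close>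

lemma a_eq_b_all_iff:
  "(\<forall>i\<in>{0..m - 1}. sg_a S X i = int (sg_b S X i)) \<longleftrightarrow> (\<forall>x\<in>X. v (x + m) = v x + 1)"
proof
  assume ab: "\<forall>i\<in>{0..m - 1}. sg_a S X i = int (sg_b S X i)"
  show "\<forall>x\<in>X. v (x + m) = v x + 1"
  proof
    fix x assume x: "x \<in> X"
    let ?i = "x mod m"
    obtain j where j: "x = sg_alpha S X ?i + j * m" using ex_alpha[OF x, of ?i] by (auto simp: cong_def)
    have "?i \<le> m - 1" using m_pos mod_less_divisor[of m x] by linarith
    then have R: "v (sg_alpha S X ?i + j * m) = v (sg_alpha S X ?i) + j" for j
      using ab a_eq_b_iff by auto
    have "x + m = sg_alpha S X ?i + Suc j * m" using j by simp
    then have "v (x + m) = v (sg_alpha S X ?i) + Suc j" by (simp only: R)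
    also have "v (sg_alpha S X ?i) + j = v x" using R[of j] j by simp
    then have "v (sg_alpha S X ?i) + Suc j = v x + 1" by simp
    finally show "v (x + m) = v x + 1" .
  qed
next
  assume *: "\<forall>x\<in>X. v (x + m) = v x + 1"
  have "v (x + j * m) = v x + j" if "x \<in> X" for x j
  proof (induction j)
    case (Suc j)
    then show ?case using *[rule_format, OF add_mult_m_mem[OF that, of j]] by (simp add: ac_simps)
  qed simp
  then show "\<forall>i\<in>{0..m - 1}. sg_a S X i = int (sg_b S X i)" using a_eq_b_iff alpha_mem(1) by blast
qed

end

section \<open>Modules over commutative rings\<close>

lemma self_module_simps [simp]:
  "carrier (self_module R) = carrier R" "\<zero>\<^bsub>self_module R\<^esub> = \<zero>\<^bsub>R\<^esub>"
  "a \<oplus>\<^bsub>self_module R\<^esub> b = a \<oplus>\<^bsub>R\<^esub> b" "a \<odot>\<^bsub>self_module R\<^esub> b = a \<otimes>\<^bsub>R\<^esub> b"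
  by (simp_all add: self_module_def)

lemma (in cring) self_module_module: "module R (self_module R)"
proof (rule moduleI)
  show "abelian_group (self_module R)"
    by (rule abelian_groupI) (auto simp: a_ac intro: bexI[of _ "\<ominus> _"] l_neg)
qed (auto simp: l_distr r_distr m_assoc is_cring)

lemma abelian_group_ring_of_action:
  assumes "abelian_group N" shows "abelian_group (ring_of_action N u)"
proof -
  interpret abelian_group N by fact
  show ?thesis
    by (rule abelian_groupI)
      (auto simp: a_ac ring_of_action_def intro: bexI[of _ "\<ominus>\<^bsub>N\<^esub> _"] r_neg)
qed

lemma ring_of_action_simps [simp]:
  "carrier (ring_of_action N u) = carrier N" "\<zero>\<^bsub>ring_of_action N u\<^esub> = \<zero>\<^bsub>N\<^esub>" "\<one>\<^bsub>ring_of_action N u\<^esub> = u"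
  "a \<oplus>\<^bsub>ring_of_action N u\<^esub> b = a \<oplus>\<^bsub>N\<^esub> b" "a \<otimes>\<^bsub>ring_of_action N u\<^esub> b = a \<odot>\<^bsub>N\<^esub> b"
  by (simp_all add: ring_of_action_def)

lemma (in primeideal) one_notin: "\<one> \<notin> I"
  using I_notcarr one_imp_carrier by blast

lemma (in primeideal) pow_imp_mem: "a \<in> carrier R \<Longrightarrow> a [^] (n::nat) \<in> I \<Longrightarrow> a \<in> I"
  by (induction n) (auto simp: one_notin dest: I_prime[rotated 2])

text \<open>One factor is pulled out on the left, so that inductions on powers of a nonzerodivisor
  can strip it off.\<close>

lemma (in module) smult_pow:
  "a \<in> carrier R \<Longrightarrow> x \<in> carrier M \<Longrightarrow> a [^] Suc n \<odot>\<^bsub>M\<^esub> x = a \<odot>\<^bsub>M\<^esub> (a [^] n \<odot>\<^bsub>M\<^esub> x)"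
  using smult_assoc1[of a "a [^] n" x] by (simp add: m_comm)

section \<open>Quotients, regular sequences and depth\<close>

text \<open>Same content as \<open>module\<close>. The separate name keeps the depth lemmas out of
  the base module and lets them be interpreted at the localized module only.\<close>

locale plain_module = module R M for R :: "('a, 'm) ring_scheme" (structure)
  and M :: "('a, 'b) module" (structure)
begin

text \<open>The action on \<open>quot_module\<close> is a union over all representatives; closure of
  \<open>H\<close> under scalars makes all members of the union the same coset.\<close>

lemma quot_smult:
  assumes H: "submodule H R M" and a: "a \<in> carrier R" and x: "x \<in> carrier M"
  shows "a \<odot>\<^bsub>quot_module M H\<^esub> (H +>\<^bsub>M\<^esub> x) = H +>\<^bsub>M\<^esub> (a \<odot>\<^bsub>M\<^esub> x)"
proof -
  interpret H: submodule H R M by fact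
  have sub: "subgroup H (add_monoid M)" by (rule H.subgroup_axioms)
  have "H +>\<^bsub>M\<^esub> (a \<odot>\<^bsub>M\<^esub> y) = H +>\<^bsub>M\<^esub> (a \<odot>\<^bsub>M\<^esub> x)" if y: "y \<in> H +>\<^bsub>M\<^esub> x" for y
  proof -
    obtain h where h: "h \<in> H" "y = h \<oplus>\<^bsub>M\<^esub> x" using y by (auto simp: a_r_coset_def')
    then have "h \<in> carrier M" using H.subset by auto
    then have "a \<odot>\<^bsub>M\<^esub> y = a \<odot>\<^bsub>M\<^esub> h \<oplus>\<^bsub>M\<^esub> a \<odot>\<^bsub>M\<^esub> x" using h a x by (simp add: smult_r_distr)
    then have "a \<odot>\<^bsub>M\<^esub> y \<in> H +>\<^bsub>M\<^esub> (a \<odot>\<^bsub>M\<^esub> x)" using h a by (auto simp: a_r_coset_def')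
    then show ?thesis using M.add.repr_independence[OF _ _ sub, folded a_r_coset_def] a x by (metis smult_closed)
  qed
  then have "(\<Union>y\<in>H +>\<^bsub>M\<^esub> x. H +>\<^bsub>M\<^esub> (a \<odot>\<^bsub>M\<^esub> y)) = (\<Union>y\<in>H +>\<^bsub>M\<^esub> x. H +>\<^bsub>M\<^esub> (a \<odot>\<^bsub>M\<^esub> x))"
    by (intro SUP_cong refl)
  also have "x \<in> H +>\<^bsub>M\<^esub> x" using M.add.rcos_self[OF x sub] by (simp add: a_r_coset_def)
  then have "(\<Union>y\<in>H +>\<^bsub>M\<^esub> x. H +>\<^bsub>M\<^esub> (a \<odot>\<^bsub>M\<^esub> x)) = H +>\<^bsub>M\<^esub> (a \<odot>\<^bsub>M\<^esub> x)" by auto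
  finally show ?thesis by (simp add: quot_module_def)
qed

lemma zero_divisor_on_quot:
  assumes H: "submodule H R M" and a: "a \<in> carrier R"
  shows "zero_divisor_on (quot_module M H) a \<longleftrightarrow> (\<exists>x\<in>carrier M. x \<notin> H \<and> a \<odot>\<^bsub>M\<^esub> x \<in> H)"
proof -
  have sub: "subgroup H (add_monoid M)" using H by (rule submodule.axioms)
  have coset: "H +>\<^bsub>M\<^esub> x = H \<longleftrightarrow> x \<in> H" if "x \<in> carrier M" for x
    using M.add.coset_join1[OF _ _ sub, of x] M.add.coset_join2[OF _ sub, of x] that
    by (auto simp: a_r_coset_def)
  have carr: "carrier (quot_module M H) = (\<lambda>x. H +>\<^bsub>M\<^esub> x) ` carrier M"
    by (auto simp: quot_module_def A_RCOSETS_def')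
  have zero: "\<zero>\<^bsub>quot_module M H\<^esub> = H" by (simp add: quot_module_def)
  show ?thesis unfolding zero_divisor_on_def carr zero
    using coset quot_smult[OF H a] a by simp
qed

lemma zero_submodule: "submodule {\<zero>\<^bsub>M\<^esub>} R M"
  by (rule submoduleI) auto

lemma ideal_smult_empty: "ideal_smult R {} M N = {\<zero>\<^bsub>M\<^esub>}"
proof -
  have "{\<zero>\<^bsub>M\<^esub>} \<subseteq> H" if "submodule H R M" for H
    using submodule.axioms(1)[OF that] subgroup.one_closed by fastforce
  then have "\<Inter> {H. submodule H R M} = {\<zero>\<^bsub>M\<^esub>}" using zero_submodule by blast
  then show ?thesis by (simp add: ideal_smult_def submodule_span_def)
qed

lemma smult_image_submodule:
  assumes a: "a \<in> carrier R"
  shows "submodule {a \<odot>\<^bsub>M\<^esub> x | x. x \<in> carrier M} R M"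
proof (rule submoduleI)
  show "\<zero>\<^bsub>M\<^esub> \<in> {a \<odot>\<^bsub>M\<^esub> x | x. x \<in> carrier M}" using a smult_r_null by force
next
  fix y assume "y \<in> {a \<odot>\<^bsub>M\<^esub> x | x. x \<in> carrier M}"
  then obtain x where "y = a \<odot>\<^bsub>M\<^esub> x" "x \<in> carrier M" by blast
  then have "\<ominus>\<^bsub>M\<^esub> y = a \<odot>\<^bsub>M\<^esub> (\<ominus>\<^bsub>M\<^esub> x)" "\<ominus>\<^bsub>M\<^esub> x \<in> carrier M" using a by (simp_all add: smult_r_minus)
  then show "\<ominus>\<^bsub>M\<^esub> y \<in> {a \<odot>\<^bsub>M\<^esub> x | x. x \<in> carrier M}" by blast
next
  fix y z assume "y \<in> {a \<odot>\<^bsub>M\<^esub> x | x. x \<in> carrier M}" "z \<in> {a \<odot>\<^bsub>M\<^esub> x | x. x \<in> carrier M}"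
  then obtain x w where "y = a \<odot>\<^bsub>M\<^esub> x" "x \<in> carrier M" "z = a \<odot>\<^bsub>M\<^esub> w" "w \<in> carrier M" by blast
  then have "y \<oplus>\<^bsub>M\<^esub> z = a \<odot>\<^bsub>M\<^esub> (x \<oplus>\<^bsub>M\<^esub> w)" "x \<oplus>\<^bsub>M\<^esub> w \<in> carrier M" using a by (simp_all add: smult_r_distr)
  then show "y \<oplus>\<^bsub>M\<^esub> z \<in> {a \<odot>\<^bsub>M\<^esub> x | x. x \<in> carrier M}" by blast
next
  fix b y assume "b \<in> carrier R" "y \<in> {a \<odot>\<^bsub>M\<^esub> x | x. x \<in> carrier M}"
  then show "b \<odot>\<^bsub>M\<^esub> y \<in> {a \<odot>\<^bsub>M\<^esub> x | x. x \<in> carrier M}"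
    using a by clarify (metis m_comm smult_assoc1 smult_closed)
qed (use a in auto)

lemma ideal_smult_singleton:
  assumes a: "a \<in> carrier R"
  shows "ideal_smult R {a} M (carrier M) = {a \<odot>\<^bsub>M\<^esub> x | x. x \<in> carrier M}"
proof -
  have "{b \<odot>\<^bsub>M\<^esub> x | b x. b \<in> {a} \<and> x \<in> carrier M} = {a \<odot>\<^bsub>M\<^esub> x | x. x \<in> carrier M}" by auto
  then show ?thesis using smult_image_submodule[OF a]
    unfolding ideal_smult_def submodule_span_def by (intro equalityI Inter_lower Inter_greatest) auto
qed

lemma zero_divisor_on_mod_zero:
  assumes "a \<in> carrier R"
  shows "zero_divisor_on (quot_module M (ideal_smult R {} M N)) a \<longleftrightarrow>
    (\<exists>x\<in>carrier M. x \<noteq> \<zero>\<^bsub>M\<^esub> \<and> a \<odot>\<^bsub>M\<^esub> x = \<zero>\<^bsub>M\<^esub>)"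
  unfolding ideal_smult_empty zero_divisor_on_quot[OF zero_submodule assms] by simp

lemma zero_divisor_on_mod_singleton:
  assumes "a \<in> carrier R" "b \<in> carrier R"
  shows "zero_divisor_on (quot_module M (ideal_smult R {a} M (carrier M))) b \<longleftrightarrow>
    (\<exists>x\<in>carrier M. (\<nexists>y. y \<in> carrier M \<and> x = a \<odot>\<^bsub>M\<^esub> y) \<and> (\<exists>y\<in>carrier M. b \<odot>\<^bsub>M\<^esub> x = a \<odot>\<^bsub>M\<^esub> y))"
  unfolding ideal_smult_singleton[OF assms(1)]
    zero_divisor_on_quot[OF smult_image_submodule[OF assms(1)] assms(2)] by auto

text \<open>The element \<open>y\<close> is the witness for a M \<noteq> M, the last clause in the
  definition of a regular sequence.\<close>

lemma depth_ge_1: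
  assumes "a \<in> J" "a \<in> carrier R" and inj: "\<And>x. x \<in> carrier M \<Longrightarrow> a \<odot>\<^bsub>M\<^esub> x = \<zero>\<^bsub>M\<^esub> \<Longrightarrow> x = \<zero>\<^bsub>M\<^esub>"
    and "y \<in> carrier M" "\<And>x. x \<in> carrier M \<Longrightarrow> y \<noteq> a \<odot>\<^bsub>M\<^esub> x"
  shows "1 \<le> depth R J M"
proof -
  have "regular_sequence R M [a]"
    unfolding regular_sequence_def
  proof (intro conjI allI impI)
    fix i assume "i < length [a]"
    then show "\<not> zero_divisor_on (quot_module M (ideal_smult R (set (take i [a])) M (carrier M))) ([a] ! i)"
      using zero_divisor_on_mod_zero[OF assms(2), of "carrier M"] inj by (simp add: less_Suc_eq) blast
  next
    have "y \<notin> ideal_smult R (set [a]) M (carrier M)"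
      using ideal_smult_singleton[of a] assms(2,5) by auto
    then show "ideal_smult R (set [a]) M (carrier M) \<noteq> carrier M" using assms(4) by blast
  qed (use assms(2) in simp)
  then have "enat (length [a]) \<le> depth R J M"
    unfolding depth_def using assms(1) by (intro Sup_upper) fastforce
  then show ?thesis by (simp add: one_enat_def)
qed

lemma depth_ge_1_imp:
  assumes "1 \<le> depth R J M"
  obtains a where "a \<in> J" "a \<in> carrier R" "\<And>x. x \<in> carrier M \<Longrightarrow> a \<odot>\<^bsub>M\<^esub> x = \<zero>\<^bsub>M\<^esub> \<Longrightarrow> x = \<zero>\<^bsub>M\<^esub>"
proof -
  have "\<exists>as. set as \<subseteq> J \<and> regular_sequence R M as \<and> as \<noteq> []"
  proof (rule ccontr)
    assume "\<not> ?thesis"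
    then have "depth R J M \<le> 0" unfolding depth_def by (intro Sup_least) (auto simp: zero_enat_def)
    then show False using assms by simp
  qed
  then obtain a as where as: "set (a # as) \<subseteq> J" "regular_sequence R M (a # as)" by (metis neq_Nil_conv)
  then have "a \<in> carrier R" "\<not> zero_divisor_on (quot_module M (ideal_smult R {} M (carrier M))) a"
    unfolding regular_sequence_def by (auto dest: spec[of _ 0])
  then show ?thesis using that[of a] as(1) zero_divisor_on_mod_zero[of a "carrier M"] by auto
qed

text \<open>If \<open>a\<close>, \<open>b\<close> began a regular sequence, then \<open>b\<close>
  and all its powers would act injectively modulo a M. An element outside a M that a power of
  \<open>b\<close> moves into a M contradicts this.\<close>

lemma depth_le_1:
  assumes "\<And>a b. \<lbrakk>a \<in> J; b \<in> J; a \<in> carrier R; b \<in> carrier R;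
      \<And>x. x \<in> carrier M \<Longrightarrow> a \<odot>\<^bsub>M\<^esub> x = \<zero>\<^bsub>M\<^esub> \<Longrightarrow> x = \<zero>\<^bsub>M\<^esub>\<rbrakk> \<Longrightarrow>
      \<exists>y\<in>carrier M. (\<forall>z\<in>carrier M. y \<noteq> a \<odot>\<^bsub>M\<^esub> z) \<and> (\<exists>n::nat. \<exists>z\<in>carrier M. b [^] n \<odot>\<^bsub>M\<^esub> y = a \<odot>\<^bsub>M\<^esub> z)"
  shows "depth R J M \<le> 1"
  unfolding depth_def
proof (intro Sup_least, clarify)
  fix as assume as: "set as \<subseteq> J" "regular_sequence R M as"
  have "length as \<le> 1"
  proof (rule ccontr)
    assume "\<not> length as \<le> 1"
    then obtain a b cs where eq: "as = a # b # cs" by (cases as; cases "tl as") auto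
    have carr: "a \<in> carrier R" "b \<in> carrier R" "a \<in> J" "b \<in> J" using as unfolding eq regular_sequence_def by auto
    have "\<not> zero_divisor_on (quot_module M (ideal_smult R {} M (carrier M))) a"
      using as(2) unfolding eq regular_sequence_def by (auto dest: spec[of _ 0])
    moreover have "\<not> zero_divisor_on (quot_module M (ideal_smult R {a} M (carrier M))) b"
      using as(2) unfolding eq regular_sequence_def by (auto dest: spec[of _ 1])
    ultimately have inj: "\<And>x. x \<in> carrier M \<Longrightarrow> a \<odot>\<^bsub>M\<^esub> x = \<zero>\<^bsub>M\<^esub> \<Longrightarrow> x = \<zero>\<^bsub>M\<^esub>"
      and inj2: "\<And>x y. x \<in> carrier M \<Longrightarrow> y \<in> carrier M \<Longrightarrow> b \<odot>\<^bsub>M\<^esub> x = a \<odot>\<^bsub>M\<^esub> y \<Longrightarrow> \<exists>z. z \<in> carrier M \<and> x = a \<odot>\<^bsub>M\<^esub> z"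
      using zero_divisor_on_mod_zero[of a "carrier M"] zero_divisor_on_mod_singleton[of a b] carr by blast+
    obtain y n where y: "y \<in> carrier M" "\<And>z. z \<in> carrier M \<Longrightarrow> y \<noteq> a \<odot>\<^bsub>M\<^esub> z"
      and n: "\<exists>z\<in>carrier M. b [^] (n::nat) \<odot>\<^bsub>M\<^esub> y = a \<odot>\<^bsub>M\<^esub> z"
      using assms[of a b] carr inj by blast
    from n have "\<exists>z\<in>carrier M. y = a \<odot>\<^bsub>M\<^esub> z"
    proof (induction n)
      case 0
      then show ?case using y(1) by simp
    next
      case (Suc n)
      then obtain z where "z \<in> carrier M" "b \<odot>\<^bsub>M\<^esub> (b [^] n \<odot>\<^bsub>M\<^esub> y) = a \<odot>\<^bsub>M\<^esub> z"
        using smult_pow carr y(1) by metis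
      then show ?case using inj2[of "b [^] n \<odot>\<^bsub>M\<^esub> y" z] Suc.IH carr y(1) by auto
    qed
    then show False using y by blast
  qed
  then show "enat (length as) \<le> 1" by (simp add: one_enat_def)
qed

end

section \<open>Localization\<close>

locale localization = module R M for R :: "('a, 'm) ring_scheme" (structure)
  and M :: "('a, 'b) module" (structure) +
  fixes P
  assumes prime: "primeideal P R"
begin

definition U where "U = carrier R - P"

abbreviation frac where "frac \<equiv> fraction R M P"

lemma one_U [simp]: "\<one> \<in> U" and mult_U [simp]: "s \<in> U \<Longrightarrow> t \<in> U \<Longrightarrow> s \<otimes> t \<in> U"
  and P_carr: "a \<in> P \<Longrightarrow> a \<in> carrier R" and U_carr [simp]: "a \<in> U \<Longrightarrow> a \<in> carrier R"
proof -
  interpret P: primeideal P R by (rule prime)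
  show "\<one> \<in> U" using P.one_notin by (simp add: U_def)
  show "a \<in> P \<Longrightarrow> a \<in> carrier R" using P.a_subset by blast
  have iff: "a \<in> carrier R \<Longrightarrow> b \<in> carrier R \<Longrightarrow> a \<otimes> b \<in> P \<longleftrightarrow> a \<in> P \<or> b \<in> P" for a b
    using P.I_prime P.I_l_closed P.I_r_closed by blast
  show "s \<in> U \<Longrightarrow> t \<in> U \<Longrightarrow> s \<otimes> t \<in> U" using iff by (auto simp: U_def)
qed (simp add: U_def)

lemmas norm_simps = smult_assoc1[symmetric] smult_r_distr smult_l_distr m_ac U_carr

lemma mem_frac: "(y, t) \<in> frac x s \<longleftrightarrow> y \<in> carrier M \<and> t \<in> U \<and>
    (\<exists>w\<in>U. w \<odot>\<^bsub>M\<^esub> (t \<odot>\<^bsub>M\<^esub> x) = w \<odot>\<^bsub>M\<^esub> (s \<odot>\<^bsub>M\<^esub> y))"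
  by (auto simp: fraction_def U_def)

lemma mem_frac_self: "x \<in> carrier M \<Longrightarrow> s \<in> U \<Longrightarrow> (x, s) \<in> frac x s"
  unfolding mem_frac using one_U by auto

lemma frac_trans:
  assumes "(y, t) \<in> frac x s" "(z, r) \<in> frac y t" "x \<in> carrier M" "s \<in> U"
  shows "(z, r) \<in> frac x s"
proof -
  obtain u w where u: "u \<in> U" "u \<odot>\<^bsub>M\<^esub> (t \<odot>\<^bsub>M\<^esub> x) = u \<odot>\<^bsub>M\<^esub> (s \<odot>\<^bsub>M\<^esub> y)" "y \<in> carrier M" "t \<in> U"
    and w: "w \<in> U" "w \<odot>\<^bsub>M\<^esub> (r \<odot>\<^bsub>M\<^esub> y) = w \<odot>\<^bsub>M\<^esub> (t \<odot>\<^bsub>M\<^esub> z)" "z \<in> carrier M" "r \<in> U"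
    using assms unfolding mem_frac by blast
  note [simp] = U_carr[OF u(1)] U_carr[OF u(4)] U_carr[OF w(1)] U_carr[OF w(4)] U_carr[OF assms(4)]
    u(3) w(3) assms(3)
  \<comment> \<open>Eliminating \<open>y\<close> from the two relations leaves the factor
    \<open>t\<close> on both sides. It is not cancellable, so it becomes part of the
    multiplier.\<close>
  have "(u \<otimes> w \<otimes> t) \<odot>\<^bsub>M\<^esub> (r \<odot>\<^bsub>M\<^esub> x) = (w \<otimes> r) \<odot>\<^bsub>M\<^esub> (u \<odot>\<^bsub>M\<^esub> (t \<odot>\<^bsub>M\<^esub> x))"
    by (simp add: norm_simps)
  also have "\<dots> = (u \<otimes> s) \<odot>\<^bsub>M\<^esub> (w \<odot>\<^bsub>M\<^esub> (r \<odot>\<^bsub>M\<^esub> y))"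
    unfolding u(2) by (simp add: norm_simps)
  also have "\<dots> = (u \<otimes> w \<otimes> t) \<odot>\<^bsub>M\<^esub> (s \<odot>\<^bsub>M\<^esub> z)"
    unfolding w(2) by (simp add: norm_simps)
  finally show ?thesis unfolding mem_frac using u w by (auto intro!: mult_U bexI[of _ "u \<otimes> w \<otimes> t"])
qed

lemma frac_sym: "(y, t) \<in> frac x s \<Longrightarrow> x \<in> carrier M \<Longrightarrow> s \<in> U \<Longrightarrow> (x, s) \<in> frac y t"
  unfolding mem_frac by metis

lemma frac_cong: assumes "(y, t) \<in> frac x s" "x \<in> carrier M" "s \<in> U" shows "frac y t = frac x s"
proof -
  have y: "y \<in> carrier M" "t \<in> U" using assms(1) by (auto simp: mem_frac)
  have "p \<in> frac y t \<longleftrightarrow> p \<in> frac x s" for p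
    using frac_trans[OF assms(1) _ assms(2,3)] frac_trans[OF frac_sym[OF assms] _ y] by (cases p) blast
  then show ?thesis by blast
qed

lemma frac_eq_iff:
  assumes "x \<in> carrier M" "s \<in> U" "y \<in> carrier M" "t \<in> U"
  shows "frac x s = frac y t \<longleftrightarrow> (\<exists>w\<in>U. w \<odot>\<^bsub>M\<^esub> (t \<odot>\<^bsub>M\<^esub> x) = w \<odot>\<^bsub>M\<^esub> (s \<odot>\<^bsub>M\<^esub> y))"
proof -
  have "frac x s = frac y t \<longleftrightarrow> (y, t) \<in> frac x s"
    using frac_cong[of y t x s] mem_frac_self assms by auto
  then show ?thesis using assms by (simp add: mem_frac)
qed

lemma frac_eqI:
  assumes "x \<in> carrier M" "s \<in> U" "y \<in> carrier M" "t \<in> U" "t \<odot>\<^bsub>M\<^esub> x = s \<odot>\<^bsub>M\<^esub> y"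
  shows "frac x s = frac y t"
  using assms one_U by (subst frac_eq_iff) auto

lemma frac_eqI':
  assumes "w \<in> U" "w \<odot>\<^bsub>M\<^esub> (t \<odot>\<^bsub>M\<^esub> x) = w \<odot>\<^bsub>M\<^esub> (s \<odot>\<^bsub>M\<^esub> y)"
    "x \<in> carrier M" "s \<in> U" "y \<in> carrier M" "t \<in> U"
  shows "frac x s = frac y t"
  unfolding frac_eq_iff[OF assms(3-6)] using assms(1,2) by blast

lemma loc_carrier: "carrier (loc_module R M P) = {frac x s | x s. x \<in> carrier M \<and> s \<in> U}"
  and loc_zero: "\<zero>\<^bsub>loc_module R M P\<^esub> = frac \<zero>\<^bsub>M\<^esub> \<one>"
  by (simp_all add: loc_module_def U_def)

lemma frac_carrier [intro, simp]: "x \<in> carrier M \<Longrightarrow> s \<in> U \<Longrightarrow> frac x s \<in> carrier (loc_module R M P)"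
  unfolding loc_carrier by blast

lemma loc_carrierE:
  assumes "X \<in> carrier (loc_module R M P)"
  obtains x s where "X = frac x s" "x \<in> carrier M" "s \<in> U"
  using assms unfolding loc_carrier by blast

lemma frac_eq_zero_iff:
  assumes "x \<in> carrier M" "s \<in> U"
  shows "frac x s = \<zero>\<^bsub>loc_module R M P\<^esub> \<longleftrightarrow> (\<exists>w\<in>U. w \<odot>\<^bsub>M\<^esub> x = \<zero>\<^bsub>M\<^esub>)"
  unfolding loc_zero using assms one_U by (subst frac_eq_iff) (auto simp: U_carr)

text \<open>The sum is a union over representatives that all yield the same fraction; the product of
  the multipliers of the two summands witnesses this.\<close>

lemma loc_add:
  assumes "x \<in> carrier M" "s \<in> U" "y \<in> carrier M" "t \<in> U"
  shows "frac x s \<oplus>\<^bsub>loc_module R M P\<^esub> frac y t = frac (t \<odot>\<^bsub>M\<^esub> x \<oplus>\<^bsub>M\<^esub> s \<odot>\<^bsub>M\<^esub> y) (s \<otimes> t)"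
proof -
  note [simp] = U_carr[OF assms(2)] U_carr[OF assms(4)] assms(1,3)
  have "frac (t' \<odot>\<^bsub>M\<^esub> x' \<oplus>\<^bsub>M\<^esub> s' \<odot>\<^bsub>M\<^esub> y') (s' \<otimes> t') = frac (t \<odot>\<^bsub>M\<^esub> x \<oplus>\<^bsub>M\<^esub> s \<odot>\<^bsub>M\<^esub> y) (s \<otimes> t)"
    if xs: "(x', s') \<in> frac x s" and yt: "(y', t') \<in> frac y t" for x' s' y' t'
  proof -
    obtain u w where u: "u \<in> U" "u \<odot>\<^bsub>M\<^esub> (s' \<odot>\<^bsub>M\<^esub> x) = u \<odot>\<^bsub>M\<^esub> (s \<odot>\<^bsub>M\<^esub> x')" "x' \<in> carrier M" "s' \<in> U"
      and w: "w \<in> U" "w \<odot>\<^bsub>M\<^esub> (t' \<odot>\<^bsub>M\<^esub> y) = w \<odot>\<^bsub>M\<^esub> (t \<odot>\<^bsub>M\<^esub> y')" "y' \<in> carrier M" "t' \<in> U"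
      using xs yt unfolding mem_frac by blast
    note [simp] = U_carr[OF u(1)] U_carr[OF u(4)] U_carr[OF w(1)] U_carr[OF w(4)] u(3) w(3)
    have "(u \<otimes> w) \<odot>\<^bsub>M\<^esub> ((s \<otimes> t) \<odot>\<^bsub>M\<^esub> (t' \<odot>\<^bsub>M\<^esub> x' \<oplus>\<^bsub>M\<^esub> s' \<odot>\<^bsub>M\<^esub> y')) =
      (w \<otimes> t \<otimes> t') \<odot>\<^bsub>M\<^esub> (u \<odot>\<^bsub>M\<^esub> (s \<odot>\<^bsub>M\<^esub> x')) \<oplus>\<^bsub>M\<^esub> (u \<otimes> s \<otimes> s') \<odot>\<^bsub>M\<^esub> (w \<odot>\<^bsub>M\<^esub> (t \<odot>\<^bsub>M\<^esub> y'))"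
      by (simp add: norm_simps)
    also have "\<dots> = (u \<otimes> w) \<odot>\<^bsub>M\<^esub> ((s' \<otimes> t') \<odot>\<^bsub>M\<^esub> (t \<odot>\<^bsub>M\<^esub> x \<oplus>\<^bsub>M\<^esub> s \<odot>\<^bsub>M\<^esub> y))"
      unfolding u(2)[symmetric] w(2)[symmetric] by (simp add: norm_simps)
    finally show ?thesis using assms u(1,4) w(1,4)
      by (rule_tac frac_eqI'[where w = "u \<otimes> w"]) (simp_all add: mult_U)
  qed
  then have "(\<Union>(x', s')\<in>frac x s. \<Union>(y', t')\<in>frac y t.
       frac (t' \<odot>\<^bsub>M\<^esub> x' \<oplus>\<^bsub>M\<^esub> s' \<odot>\<^bsub>M\<^esub> y') (s' \<otimes> t')) = 
    (\<Union>p\<in>frac x s. \<Union>q\<in>frac y t. frac (t \<odot>\<^bsub>M\<^esub> x \<oplus>\<^bsub>M\<^esub> s \<odot>\<^bsub>M\<^esub> y) (s \<otimes> t))"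
    by (intro SUP_cong refl) (auto split: prod.splits)
  also have "\<dots> = frac (t \<odot>\<^bsub>M\<^esub> x \<oplus>\<^bsub>M\<^esub> s \<odot>\<^bsub>M\<^esub> y) (s \<otimes> t)"
    using mem_frac_self[OF assms(1,2)] mem_frac_self[OF assms(3,4)] by blast
  finally show ?thesis by (simp add: loc_module_def)
qed

end

text \<open>The localized ring is the localization of \<open>R\<close> as a module over itself, so
  the calculus of fractions is developed once and used for both.\<close>

sublocale localization \<subseteq> ring: localization R "self_module R" P
  by (intro localization.intro localization_axioms.intro self_module_module prime)

context localization begin

abbreviation rfrac where "rfrac \<equiv> fraction R (self_module R) P"

lemma loc_smult:
  assumes "a \<in> carrier R" "s \<in> U" "y \<in> carrier M" "t \<in> U"
  shows "rfrac a s \<odot>\<^bsub>loc_module R M P\<^esub> frac y t = frac (a \<odot>\<^bsub>M\<^esub> y) (s \<otimes> t)"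
proof -
  note [simp] = U_carr[OF assms(2)] U_carr[OF assms(4)] assms(1,3)
  have "frac (a' \<odot>\<^bsub>M\<^esub> y') (s' \<otimes> t') = frac (a \<odot>\<^bsub>M\<^esub> y) (s \<otimes> t)"
    if as: "(a', s') \<in> rfrac a s" and yt: "(y', t') \<in> frac y t" for a' s' y' t'
  proof -
    obtain u w where u: "u \<in> U" "u \<otimes> (s' \<otimes> a) = u \<otimes> (s \<otimes> a')" "a' \<in> carrier R" "s' \<in> U"
      and w: "w \<in> U" "w \<odot>\<^bsub>M\<^esub> (t' \<odot>\<^bsub>M\<^esub> y) = w \<odot>\<^bsub>M\<^esub> (t \<odot>\<^bsub>M\<^esub> y')" "y' \<in> carrier M" "t' \<in> U"
      using as yt unfolding mem_frac ring.mem_frac by auto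
    note [simp] = U_carr[OF u(1)] U_carr[OF u(4)] U_carr[OF w(1)] U_carr[OF w(4)] u(3) w(3)
    have "(u \<otimes> w) \<odot>\<^bsub>M\<^esub> ((s \<otimes> t) \<odot>\<^bsub>M\<^esub> (a' \<odot>\<^bsub>M\<^esub> y')) = (u \<otimes> (s \<otimes> a')) \<odot>\<^bsub>M\<^esub> (w \<odot>\<^bsub>M\<^esub> (t \<odot>\<^bsub>M\<^esub> y'))"
      by (simp add: norm_simps)
    also have "\<dots> = (u \<otimes> w) \<odot>\<^bsub>M\<^esub> ((s' \<otimes> t') \<odot>\<^bsub>M\<^esub> (a \<odot>\<^bsub>M\<^esub> y))"
      unfolding u(2)[symmetric] w(2)[symmetric] by (simp add: norm_simps)
    finally show ?thesis using assms u(1,4) w(1,4)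
      by (rule_tac frac_eqI'[where w = "u \<otimes> w"]) (simp_all add: mult_U)
  qed
  then have "(\<Union>(a', s')\<in>rfrac a s. \<Union>(y', t')\<in>frac y t. frac (a' \<odot>\<^bsub>M\<^esub> y') (s' \<otimes> t')) = 
    (\<Union>p\<in>rfrac a s. \<Union>q\<in>frac y t. frac (a \<odot>\<^bsub>M\<^esub> y) (s \<otimes> t))"
    by (intro SUP_cong refl) (auto split: prod.splits)
  also have "\<dots> = frac (a \<odot>\<^bsub>M\<^esub> y) (s \<otimes> t)"
    using mem_frac_self[OF assms(3,4)] ring.mem_frac_self[of a s] assms(1,2) by (simp add: ex_in_conv) blast
  finally show ?thesis by (simp add: loc_module_def)
qed

lemma loc_abelian_group: "abelian_group (loc_module R M P)"
proof (rule abelian_groupI)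
  show "X \<oplus>\<^bsub>loc_module R M P\<^esub> Y \<in> carrier (loc_module R M P)"
    if "X \<in> carrier (loc_module R M P)" "Y \<in> carrier (loc_module R M P)" for X Y
    using that by (elim loc_carrierE) (simp only: loc_add, intro frac_carrier, auto intro: mult_U simp: U_carr)
  show "\<zero>\<^bsub>loc_module R M P\<^esub> \<in> carrier (loc_module R M P)" unfolding loc_zero using one_U by blast
  show "X \<oplus>\<^bsub>loc_module R M P\<^esub> Y \<oplus>\<^bsub>loc_module R M P\<^esub> Z = X \<oplus>\<^bsub>loc_module R M P\<^esub> (Y \<oplus>\<^bsub>loc_module R M P\<^esub> Z)"
    if "X \<in> carrier (loc_module R M P)" "Y \<in> carrier (loc_module R M P)" "Z \<in> carrier (loc_module R M P)" for X Y Z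
    using that
  proof (elim loc_carrierE)
    fix x s y t z r
    assume A: "X = frac x s" "x \<in> carrier M" "s \<in> U" "Y = frac y t" "y \<in> carrier M" "t \<in> U" "Z = frac z r" "z \<in> carrier M" "r \<in> U"
    then have [simp]: "s \<in> carrier R" "t \<in> carrier R" "r \<in> carrier R" by auto
    have U: "s \<otimes> t \<in> U" "t \<otimes> r \<in> U" using A mult_U by auto
    show ?thesis unfolding A using A(2,3,5,6,8,9) U
      by (simp add: loc_add) (simp add: norm_simps M.a_ac)
  qed
  show "X \<oplus>\<^bsub>loc_module R M P\<^esub> Y = Y \<oplus>\<^bsub>loc_module R M P\<^esub> X"
    if "X \<in> carrier (loc_module R M P)" "Y \<in> carrier (loc_module R M P)" for X Y
    using that by (elim loc_carrierE) (simp add: loc_add M.a_comm m_comm)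
  show "\<zero>\<^bsub>loc_module R M P\<^esub> \<oplus>\<^bsub>loc_module R M P\<^esub> X = X"
    if "X \<in> carrier (loc_module R M P)" for X
    using that one_U by (elim loc_carrierE) (simp add: loc_add loc_zero)
  show "\<exists>Y\<in>carrier (loc_module R M P). Y \<oplus>\<^bsub>loc_module R M P\<^esub> X = \<zero>\<^bsub>loc_module R M P\<^esub>"
    if "X \<in> carrier (loc_module R M P)" for X
    using that
  proof (elim loc_carrierE)
    fix x s assume A: "X = frac x s" "x \<in> carrier M" "s \<in> U"
    then have "s \<odot>\<^bsub>M\<^esub> (\<ominus>\<^bsub>M\<^esub> x) \<oplus>\<^bsub>M\<^esub> s \<odot>\<^bsub>M\<^esub> x = \<zero>\<^bsub>M\<^esub>"
      by (simp add: smult_r_minus M.l_neg)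
    then have "frac (\<ominus>\<^bsub>M\<^esub> x) s \<oplus>\<^bsub>loc_module R M P\<^esub> X = \<zero>\<^bsub>loc_module R M P\<^esub>"
      using A one_U mult_U[of s s] by (simp add: loc_add frac_eq_zero_iff) auto
    then show ?thesis using A by blast
  qed
qed

lemma loc_ring_simps:
  "carrier (loc_ring R P) = {rfrac a s | a s. a \<in> carrier R \<and> s \<in> U}"
  "\<zero>\<^bsub>loc_ring R P\<^esub> = rfrac \<zero> \<one>" "\<one>\<^bsub>loc_ring R P\<^esub> = rfrac \<one> \<one>"
  by (simp_all add: loc_ring_def ring.loc_carrier ring.loc_zero)

lemma loc_ring_carrierE:
  assumes "A \<in> carrier (loc_ring R P)"
  obtains a s where "A = rfrac a s" "a \<in> carrier R" "s \<in> U"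
  using assms unfolding loc_ring_simps by blast

lemma rfrac_carrier [intro, simp]: "a \<in> carrier R \<Longrightarrow> s \<in> U \<Longrightarrow> rfrac a s \<in> carrier (loc_ring R P)"
  unfolding loc_ring_simps by blast

lemma rfrac_add: "\<lbrakk>a \<in> carrier R; s \<in> U; b \<in> carrier R; t \<in> U\<rbrakk> \<Longrightarrow>
    rfrac a s \<oplus>\<^bsub>loc_ring R P\<^esub> rfrac b t = rfrac (t \<otimes> a \<oplus> s \<otimes> b) (s \<otimes> t)"
  using ring.loc_add[of a s b t] by (simp add: loc_ring_def)

end

context localization begin

lemma rfrac_mult: "\<lbrakk>a \<in> carrier R; s \<in> U; b \<in> carrier R; t \<in> U\<rbrakk> \<Longrightarrow>
    rfrac a s \<otimes>\<^bsub>loc_ring R P\<^esub> rfrac b t = rfrac (a \<otimes> b) (s \<otimes> t)"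
  using ring.loc_smult[of a s b t] by (simp add: loc_ring_def)

lemma loc_cring: "cring (loc_ring R P)"
proof (rule cringI)
  show "abelian_group (loc_ring R P)"
    unfolding loc_ring_def by (rule abelian_group_ring_of_action[OF ring.loc_abelian_group])
  show "Group.comm_monoid (loc_ring R P)"
  proof (rule comm_monoidI)
    show "X \<otimes>\<^bsub>loc_ring R P\<^esub> Y \<in> carrier (loc_ring R P)"
      if "X \<in> carrier (loc_ring R P)" "Y \<in> carrier (loc_ring R P)" for X Y
      using that by (elim loc_ring_carrierE) (simp only: rfrac_mult, intro rfrac_carrier m_closed mult_U)
    show "\<one>\<^bsub>loc_ring R P\<^esub> \<in> carrier (loc_ring R P)"
      using one_U unfolding loc_ring_simps(3) by blast
    show "\<one>\<^bsub>loc_ring R P\<^esub> \<otimes>\<^bsub>loc_ring R P\<^esub> X = X"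
      if "X \<in> carrier (loc_ring R P)" for X
      using that one_U by (elim loc_ring_carrierE) (simp add: loc_ring_simps(3) rfrac_mult)
    show "X \<otimes>\<^bsub>loc_ring R P\<^esub> Y \<otimes>\<^bsub>loc_ring R P\<^esub> Z = X \<otimes>\<^bsub>loc_ring R P\<^esub> (Y \<otimes>\<^bsub>loc_ring R P\<^esub> Z)"
      if "X \<in> carrier (loc_ring R P)" "Y \<in> carrier (loc_ring R P)" "Z \<in> carrier (loc_ring R P)" for X Y Z
      using that
    proof (elim loc_ring_carrierE)
      fix x s y t z r
      assume A: "X = rfrac x s" "x \<in> carrier R" "s \<in> U" "Y = rfrac y t" "y \<in> carrier R" "t \<in> U" "Z = rfrac z r" "z \<in> carrier R" "r \<in> U"
      then have [simp]: "s \<in> carrier R" "t \<in> carrier R" "r \<in> carrier R" by auto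
      have U: "s \<otimes> t \<in> U" "t \<otimes> r \<in> U" using A mult_U by auto
      show ?thesis unfolding A using A(2,3,5,6,8,9) U
        by (simp add: rfrac_mult) (simp add: m_ac)
    qed
    show "X \<otimes>\<^bsub>loc_ring R P\<^esub> Y = Y \<otimes>\<^bsub>loc_ring R P\<^esub> X"
      if "X \<in> carrier (loc_ring R P)" "Y \<in> carrier (loc_ring R P)" for X Y
      using that by (elim loc_ring_carrierE) (simp add: rfrac_mult m_comm)
  qed
  show "(X \<oplus>\<^bsub>loc_ring R P\<^esub> Y) \<otimes>\<^bsub>loc_ring R P\<^esub> Z =
      X \<otimes>\<^bsub>loc_ring R P\<^esub> Z \<oplus>\<^bsub>loc_ring R P\<^esub> Y \<otimes>\<^bsub>loc_ring R P\<^esub> Z"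
    if "X \<in> carrier (loc_ring R P)" "Y \<in> carrier (loc_ring R P)" "Z \<in> carrier (loc_ring R P)" for X Y Z
    using that
  proof (elim loc_ring_carrierE)
    fix x s y t z r
    assume A: "X = rfrac x s" "x \<in> carrier R" "s \<in> U" "Y = rfrac y t" "y \<in> carrier R" "t \<in> U" "Z = rfrac z r" "z \<in> carrier R" "r \<in> U"
    then have [simp]: "s \<in> carrier R" "t \<in> carrier R" "r \<in> carrier R" by auto
    have U: "s \<otimes> t \<in> U" "s \<otimes> r \<in> U" "t \<otimes> r \<in> U" "s \<otimes> t \<otimes> r \<in> U" "s \<otimes> r \<otimes> (t \<otimes> r) \<in> U"
      using A mult_U by auto
    show ?thesis unfolding A using A(2,3,5,6,8,9) U
      by (simp add: rfrac_mult rfrac_add, intro ring.frac_eqI)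
        (simp_all, simp add: l_distr r_distr m_ac)
  qed
qed

lemma loc_module: "module (loc_ring R P) (loc_module R M P)"
proof (rule moduleI)
  show "cring (loc_ring R P)" by (rule loc_cring)
  show "abelian_group (loc_module R M P)" by (rule loc_abelian_group)
  show "A \<odot>\<^bsub>loc_module R M P\<^esub> X \<in> carrier (loc_module R M P)"
    if "A \<in> carrier (loc_ring R P)" "X \<in> carrier (loc_module R M P)" for A X
    using that by (elim loc_ring_carrierE loc_carrierE) (simp only: loc_smult, intro frac_carrier smult_closed mult_U)
  show "\<one>\<^bsub>loc_ring R P\<^esub> \<odot>\<^bsub>loc_module R M P\<^esub> X = X" if "X \<in> carrier (loc_module R M P)" for X
    using that one_U by (elim loc_carrierE) (simp add: loc_ring_simps(3) loc_smult)
  show "(A \<oplus>\<^bsub>loc_ring R P\<^esub> B) \<odot>\<^bsub>loc_module R M P\<^esub> X =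
      A \<odot>\<^bsub>loc_module R M P\<^esub> X \<oplus>\<^bsub>loc_module R M P\<^esub> B \<odot>\<^bsub>loc_module R M P\<^esub> X"
    "(A \<otimes>\<^bsub>loc_ring R P\<^esub> B) \<odot>\<^bsub>loc_module R M P\<^esub> X =
      A \<odot>\<^bsub>loc_module R M P\<^esub> (B \<odot>\<^bsub>loc_module R M P\<^esub> X)"
    if "A \<in> carrier (loc_ring R P)" "B \<in> carrier (loc_ring R P)" "X \<in> carrier (loc_module R M P)" for A B X
  proof -
    obtain x s y t z r where
      A: "A = rfrac x s" "x \<in> carrier R" "s \<in> U" "B = rfrac y t" "y \<in> carrier R" "t \<in> U"
        "X = frac z r" "z \<in> carrier M" "r \<in> U"
      using \<open>A \<in> _\<close> \<open>B \<in> _\<close> \<open>X \<in> _\<close> by (elim loc_ring_carrierE loc_carrierE)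
    then have [simp]: "s \<in> carrier R" "t \<in> carrier R" "r \<in> carrier R" by auto
    have U: "s \<otimes> t \<in> U" "s \<otimes> r \<in> U" "t \<otimes> r \<in> U" "s \<otimes> t \<otimes> r \<in> U" "s \<otimes> r \<otimes> (t \<otimes> r) \<in> U"
      using A mult_U by auto
    show "(A \<oplus>\<^bsub>loc_ring R P\<^esub> B) \<odot>\<^bsub>loc_module R M P\<^esub> X =
      A \<odot>\<^bsub>loc_module R M P\<^esub> X \<oplus>\<^bsub>loc_module R M P\<^esub> B \<odot>\<^bsub>loc_module R M P\<^esub> X"
      unfolding A using A(2,3,5,6,8,9) U
      by (simp add: rfrac_add loc_smult loc_add, intro frac_eqI)
        (simp_all, simp add: norm_simps)
    show "(A \<otimes>\<^bsub>loc_ring R P\<^esub> B) \<odot>\<^bsub>loc_module R M P\<^esub> X =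
      A \<odot>\<^bsub>loc_module R M P\<^esub> (B \<odot>\<^bsub>loc_module R M P\<^esub> X)"
      unfolding A using A(2,3,5,6,8,9) U
      by (simp add: rfrac_mult loc_smult) (simp add: norm_simps)
  qed
  show "A \<odot>\<^bsub>loc_module R M P\<^esub> (X \<oplus>\<^bsub>loc_module R M P\<^esub> Y) =
      A \<odot>\<^bsub>loc_module R M P\<^esub> X \<oplus>\<^bsub>loc_module R M P\<^esub> A \<odot>\<^bsub>loc_module R M P\<^esub> Y"
    if AXY: "A \<in> carrier (loc_ring R P)" "X \<in> carrier (loc_module R M P)" "Y \<in> carrier (loc_module R M P)" for A X Y
  proof -
    obtain x s y t z r where
      A: "A = rfrac x s" "x \<in> carrier R" "s \<in> U" "X = frac y t" "y \<in> carrier M" "t \<in> U"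
        "Y = frac z r" "z \<in> carrier M" "r \<in> U"
      using AXY by (elim loc_ring_carrierE loc_carrierE)
    then have [simp]: "s \<in> carrier R" "t \<in> carrier R" "r \<in> carrier R" by auto
    have U: "t \<otimes> r \<in> U" "s \<otimes> r \<in> U" "s \<otimes> t \<in> U" "s \<otimes> (t \<otimes> r) \<in> U" "s \<otimes> t \<otimes> (s \<otimes> r) \<in> U"
      using A mult_U by auto
    show ?thesis
      unfolding A using A(2,3,5,6,8,9) U
      by (simp add: loc_smult loc_add, intro frac_eqI)
        (simp_all, simp add: norm_simps)
  qed
qed

end

section \<open>Kernels as prime ideals, powers of a sum, and dimension one\<close>

lemma (in cring) ideal_cringI:
  assumes "I \<subseteq> carrier R" "\<zero> \<in> I" "\<And>a b. a \<in> I \<Longrightarrow> b \<in> I \<Longrightarrow> a \<oplus> b \<in> I"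
    and mult: "\<And>a x. a \<in> I \<Longrightarrow> x \<in> carrier R \<Longrightarrow> x \<otimes> a \<in> I"
  shows "ideal I R"
proof (rule idealI)
  have "\<ominus> a \<in> I" if "a \<in> I" for a
  proof -
    have "\<ominus> a = (\<ominus> \<one>) \<otimes> a" using that assms(1) by (simp add: l_minus subset_iff)
    then show ?thesis using mult[OF that, of "\<ominus> \<one>"] by simp
  qed
  then show "subgroup I (add_monoid R)"
    using assms by (intro add.subgroupI) (auto simp: a_inv_def)
  show "a \<otimes> x \<in> I" if "a \<in> I" "x \<in> carrier R" for a x
    using mult[OF that] that assms(1) by (simp add: m_comm subset_iff)
qed (use mult ring_axioms in auto)

text \<open>Serves twice: for \<phi> with values in k[T], and for \<phi> followed by evaluation at
  0.\<close>

lemma (in cring) kernel_primeideal: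
  fixes \<chi> :: "'a \<Rightarrow> 'c::idom"
  assumes add: "\<And>a b. \<lbrakk>a \<in> carrier R; b \<in> carrier R\<rbrakk> \<Longrightarrow> \<chi> (a \<oplus> b) = \<chi> a + \<chi> b"
    and mult: "\<And>a b. \<lbrakk>a \<in> carrier R; b \<in> carrier R\<rbrakk> \<Longrightarrow> \<chi> (a \<otimes> b) = \<chi> a * \<chi> b"
    and one: "\<chi> \<one> = 1"
  shows "primeideal {a \<in> carrier R. \<chi> a = 0} R"
proof (rule primeidealI)
  have "\<chi> \<zero> = 0" using add[OF zero_closed zero_closed] by (metis add.right_neutral add_left_imp_eq l_zero zero_closed)
  then show "ideal {a \<in> carrier R. \<chi> a = 0} R"
    by (intro ideal_cringI) (auto simp: add mult)
  show "carrier R \<noteq> {a \<in> carrier R. \<chi> a = 0}" using one by force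
qed (auto simp: mult is_cring)

text \<open>The binomial theorem modulo \<open>b\<close>. For nilpotent \<open>d\<close> it turns a
  power of \<open>d \<oplus> b\<close> into a multiple of \<open>b\<close>.\<close>

lemma (in cring) pow_add_expand:
  assumes "d \<in> carrier R" "b \<in> carrier R"
  shows "\<exists>c\<in>carrier R. (d \<oplus> b) [^] (n::nat) = d [^] n \<oplus> b \<otimes> c"
proof (induction n)
  case 0
  then show ?case using assms by (intro bexI[of _ \<zero>]) auto
next
  case (Suc n)
  then obtain c where c: "c \<in> carrier R" "(d \<oplus> b) [^] n = d [^] n \<oplus> b \<otimes> c" by blast
  have "(d \<oplus> b) [^] Suc n = d [^] Suc n \<oplus> b \<otimes> (d [^] n \<oplus> c \<otimes> (d \<oplus> b))"
    using assms c by (simp add: l_distr r_distr a_ac m_ac)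
  then show ?case using assms c by (intro bexI[of _ "d [^] n \<oplus> c \<otimes> (d \<oplus> b)"]) auto
qed

text \<open>A longer chain would begin with three primes, which the last hypothesis forbids;
  \<open>Q0\<close> and \<open>Q1\<close> realize length one.\<close>

lemma module_dim_eq_1I:
  assumes "primeideal Q0 R" "primeideal Q1 R" "annihilator R M \<subseteq> Q0" "Q0 \<subset> Q1"
    and le: "\<And>P0 P1 P2. \<lbrakk>primeideal P0 R; primeideal P1 R; primeideal P2 R; P0 \<subset> P1; P1 \<subset> P2\<rbrakk> \<Longrightarrow> False"
  shows "module_dim R M = 1"
proof -
  let ?A = "{enat n | n. \<exists>P :: nat \<Rightarrow> 'a set.
     (\<forall>i\<le>n. primeideal (P i) R \<and> annihilator R M \<subseteq> P i) \<and> (\<forall>i<n. P i \<subset> P (Suc i))}"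
  have "(\<forall>i\<le>1. primeideal ((case_nat Q0 (\<lambda>_. Q1)) i) R \<and> annihilator R M \<subseteq> (case_nat Q0 (\<lambda>_. Q1)) i) \<and>
    (\<forall>i<1. (case_nat Q0 (\<lambda>_. Q1)) i \<subset> (case_nat Q0 (\<lambda>_. Q1)) (Suc i))"
    using assms(1-4) by (auto split: nat.splits)
  then have "enat 1 \<in> ?A" by blast
  then have "enat 1 \<le> Sup ?A" by (rule Sup_upper)
  moreover have "Sup ?A \<le> enat 1"
  proof (rule Sup_least, clarify)
    fix n :: nat and P :: "nat \<Rightarrow> 'a set"
    assume "\<forall>i\<le>n. primeideal (P i) R \<and> annihilator R M \<subseteq> P i" "\<forall>i<n. P i \<subset> P (Suc i)"
    then have "\<not> 2 \<le> n" using le[of "P 0" "P 1" "P 2"] by (force simp: numeral_2_eq_2)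
    then show "enat n \<le> enat 1" by simp
  qed
  ultimately show ?thesis unfolding module_dim_def by (simp add: one_enat_def order_antisym)
qed

section \<open>Prime ideals and units of the localization\<close>

context localization begin

lemma rfrac_pow: "a \<in> carrier R \<Longrightarrow> s \<in> U \<Longrightarrow>
  s [^] n \<in> U \<and> rfrac a s [^]\<^bsub>loc_ring R P\<^esub> (n::nat) = rfrac (a [^] n) (s [^] n)"
  by (induction n) (auto simp: rfrac_mult loc_ring_simps(3))

definition extension where "extension Q = {rfrac a s | a s. a \<in> Q \<and> s \<in> U}"

text \<open>Membership does not depend on the chosen fraction: comparing two fractions introduces
  only factors outside \<open>P\<close>, hence outside the prime \<open>Q\<close>, and these can be
  cancelled.\<close>

lemma rfrac_mem_extension:
  assumes Q: "primeideal Q R" "Q \<subseteq> P" and a: "a \<in> carrier R" "s \<in> U"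
  shows "rfrac a s \<in> extension Q \<longleftrightarrow> a \<in> Q"
proof
  interpret Q: primeideal Q R by fact
  assume "rfrac a s \<in> extension Q"
  then obtain b t where b: "rfrac a s = rfrac b t" "b \<in> Q" "t \<in> U" unfolding extension_def by blast
  then have bc: "b \<in> carrier R" using Q.a_subset by blast
  obtain w where w: "w \<in> U" "w \<otimes> (t \<otimes> a) = w \<otimes> (s \<otimes> b)"
    using b a bc by (auto simp: ring.frac_eq_iff)
  have "w \<otimes> (t \<otimes> a) \<in> Q" unfolding w(2) using b(2) a w(1) Q.I_l_closed by simp
  moreover have "w \<notin> Q" "t \<notin> Q" using w(1) b(3) Q(2) by (auto simp: U_def)
  ultimately show "a \<in> Q" using w(1) b(3) a by (meson Q.I_prime U_carr m_closed)
qed (use a in \<open>auto simp: extension_def\<close>)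

lemma extension_prime:
  assumes Q: "primeideal Q R" "Q \<subseteq> P"
  shows "primeideal (extension Q) (loc_ring R P)"
proof -
  interpret Q: primeideal Q R by fact
  interpret L: cring "loc_ring R P" by (rule loc_cring)
  note mem = rfrac_mem_extension[OF Q]
  have Qc: "a \<in> carrier R" if "a \<in> Q" for a using that Q.a_subset by blast
  show ?thesis
  proof (rule primeidealI)
    show "ideal (extension Q) (loc_ring R P)"
    proof (rule L.ideal_cringI)
      show "extension Q \<subseteq> carrier (loc_ring R P)" using Qc by (auto simp: extension_def)
      show "\<zero>\<^bsub>loc_ring R P\<^esub> \<in> extension Q" unfolding loc_ring_simps by (simp add: mem)
    next
      fix A B assume "A \<in> extension Q" "B \<in> extension Q"
      then obtain a s b t where "A = rfrac a s" "a \<in> Q" "s \<in> U" "B = rfrac b t" "b \<in> Q" "t \<in> U"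
        unfolding extension_def by blast
      then show "A \<oplus>\<^bsub>loc_ring R P\<^esub> B \<in> extension Q" using Qc
        by (simp add: rfrac_add mem Q.I_l_closed)
    next
      fix A B assume "A \<in> extension Q" "B \<in> carrier (loc_ring R P)"
      then obtain a s b t where "A = rfrac a s" "a \<in> Q" "s \<in> U" "B = rfrac b t" "b \<in> carrier R" "t \<in> U"
        unfolding extension_def loc_ring_simps by blast
      then show "B \<otimes>\<^bsub>loc_ring R P\<^esub> A \<in> extension Q" using Qc
        by (simp add: rfrac_mult mem Q.I_l_closed)
    qed
    show "carrier (loc_ring R P) \<noteq> extension Q"
    proof -
      have "rfrac \<one> \<one> \<notin> extension Q" by (simp add: mem Q.one_notin)
      moreover have "rfrac \<one> \<one> \<in> carrier (loc_ring R P)" by (rule rfrac_carrier) simp_all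
      ultimately show ?thesis by metis
    qed
    fix A B assume "A \<in> carrier (loc_ring R P)" "B \<in> carrier (loc_ring R P)" and AB: "A \<otimes>\<^bsub>loc_ring R P\<^esub> B \<in> extension Q"
    then obtain a s b t where "A = rfrac a s" "a \<in> carrier R" "s \<in> U" "B = rfrac b t" "b \<in> carrier R" "t \<in> U"
      unfolding loc_ring_simps by blast
    then show "A \<in> extension Q \<or> B \<in> extension Q" using AB Q.I_prime
      by (simp add: rfrac_mult mem)
  qed (rule loc_cring)
qed

definition contraction where "contraction Q = {a \<in> carrier R. rfrac a \<one> \<in> Q}"

text \<open>The fractions with denominators \<open>s\<close> and \<one> are multiples of each other
  in the localization, so an ideal cannot separate them.\<close>

lemma mem_contraction:
  assumes Q: "primeideal Q (loc_ring R P)" and a: "a \<in> carrier R" "s \<in> U"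
  shows "a \<in> contraction Q \<longleftrightarrow> rfrac a s \<in> Q"
proof -
  interpret Q: primeideal Q "loc_ring R P" by fact
  have "rfrac a s = rfrac \<one> s \<otimes>\<^bsub>loc_ring R P\<^esub> rfrac a \<one>" using a by (simp add: rfrac_mult)
  moreover have "rfrac a \<one> = rfrac s \<one> \<otimes>\<^bsub>loc_ring R P\<^esub> rfrac a s" using a
    by (simp add: rfrac_mult) (rule ring.frac_eqI, simp_all add: m_comm)
  ultimately show ?thesis unfolding contraction_def
    using a Q.I_l_closed[of "rfrac a \<one>" "rfrac \<one> s"] Q.I_l_closed[of "rfrac a s" "rfrac s \<one>"] by auto
qed

lemma contraction_prime:
  assumes Q: "primeideal Q (loc_ring R P)"
  shows "primeideal (contraction Q) R"
proof -
  interpret Q: primeideal Q "loc_ring R P" by fact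
  note [simp] = mem_contraction[OF Q _ one_U]
  show ?thesis
  proof (rule primeidealI)
    show "ideal (contraction Q) R"
    proof (rule ideal_cringI)
      show "contraction Q \<subseteq> carrier R" by (auto simp: contraction_def)
      show "\<zero> \<in> contraction Q" using additive_subgroup.zero_closed[OF Q.is_additive_subgroup] by (simp add: loc_ring_simps(2))
    next
      fix a b assume "a \<in> contraction Q" "b \<in> contraction Q"
      then have ab: "a \<in> carrier R" "b \<in> carrier R" "rfrac a \<one> \<in> Q" "rfrac b \<one> \<in> Q"
        by (auto simp: contraction_def)
      from additive_subgroup.a_closed[OF Q.is_additive_subgroup ab(3,4)] ab(1,2) show "a \<oplus> b \<in> contraction Q"
        by (simp add: rfrac_add)
    next
      fix a b assume "a \<in> contraction Q" "b \<in> carrier R"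
      then have ab: "a \<in> carrier R" "b \<in> carrier R" "rfrac a \<one> \<in> Q"
        by (auto simp: contraction_def)
      from Q.I_l_closed[OF ab(3) rfrac_carrier[OF ab(2) one_U]] ab(1,2) show "b \<otimes> a \<in> contraction Q"
        by (simp add: rfrac_mult)
    qed
    have "\<one> \<notin> contraction Q" using Q.one_notin by (simp add: loc_ring_simps(3))
    then show "carrier R \<noteq> contraction Q" using one_closed by metis
    fix a b assume "a \<in> carrier R" "b \<in> carrier R" "a \<otimes> b \<in> contraction Q"
    then show "a \<in> contraction Q \<or> b \<in> contraction Q"
      using Q.I_prime[of "rfrac a \<one>" "rfrac b \<one>"] by (simp add: rfrac_mult)
  qed (rule is_cring)
qed

text \<open>Carries a strict chain of primes of the localization down to \<open>R\<close>, so that a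
  bound on chains in \<open>R\<close> bounds the local dimension.\<close>

lemma contraction_strict_mono:
  assumes "primeideal Q (loc_ring R P)" "primeideal Q' (loc_ring R P)" "Q \<subset> Q'"
  shows "contraction Q \<subset> contraction Q'"
proof -
  interpret Q': primeideal Q' "loc_ring R P" by fact
  obtain A where A: "A \<in> Q'" "A \<notin> Q" using assms(3) by blast
  then obtain a s where a: "A = rfrac a s" "a \<in> carrier R" "s \<in> U"
    using Q'.a_subset loc_ring_carrierE by blast
  then have "a \<in> contraction Q'" "a \<notin> contraction Q" using A mem_contraction assms by auto
  moreover have "contraction Q \<subseteq> contraction Q'" using assms(3) by (auto simp: contraction_def)
  ultimately show ?thesis by blast
qed

text \<open>Identifies the ideal in which \<open>local_cohen_macaulay\<close> looks for regular
  sequences. A fraction whose numerator avoids \<open>P\<close> is inverted by turning it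
  over.\<close>

lemma nonunits_eq: "carrier (loc_ring R P) - Units (loc_ring R P) = extension P"
proof -
  interpret P: primeideal P R by (rule prime)
  interpret E: primeideal "extension P" "loc_ring R P" by (rule extension_prime) (auto intro: prime)
  have "A \<in> Units (loc_ring R P) \<longleftrightarrow> A \<notin> extension P" if carr: "A \<in> carrier (loc_ring R P)" for A
  proof -
    obtain a s where a: "A = rfrac a s" "a \<in> carrier R" "s \<in> U" using carr by (elim loc_ring_carrierE)
    have mem: "A \<in> extension P \<longleftrightarrow> a \<in> P" using a rfrac_mem_extension[OF prime] by simp
    show ?thesis
    proof
      assume "A \<in> Units (loc_ring R P)"
      then obtain B where B: "B \<in> carrier (loc_ring R P)" "B \<otimes>\<^bsub>loc_ring R P\<^esub> A = \<one>\<^bsub>loc_ring R P\<^esub>"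
        unfolding Units_def by blast
      show "A \<notin> extension P"
      proof
        assume "A \<in> extension P"
        from E.I_l_closed[OF this B(1)] show False unfolding B(2) using E.one_notin by contradiction
      qed
    next
      assume "A \<notin> extension P"
      then have "a \<in> U" using mem a by (simp add: U_def)
      then have "rfrac a s \<otimes>\<^bsub>loc_ring R P\<^esub> rfrac s a = \<one>\<^bsub>loc_ring R P\<^esub>"
        "rfrac s a \<otimes>\<^bsub>loc_ring R P\<^esub> rfrac a s = \<one>\<^bsub>loc_ring R P\<^esub>"
        using a by (simp_all add: rfrac_mult loc_ring_simps(3)) (rule ring.frac_eqI, simp_all add: m_comm)+
      then show "A \<in> Units (loc_ring R P)"
        using a \<open>a \<in> U\<close> unfolding Units_def by auto
    qed
  qed
  moreover have "extension P \<subseteq> carrier (loc_ring R P)" by (rule E.a_subset)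
  ultimately show ?thesis by blast
qed

end

section \<open>Modules over a ring whose reduction is a polynomial ring\<close>

text \<open>Separates the commutative algebra from the combinatorics: gr(R) enters below only as a
  ring with a surjection onto k[T] whose kernel is nil.\<close>

locale nil_poly = cring R for R :: "('a, 'm) ring_scheme" (structure) +
  fixes \<phi> :: "'a \<Rightarrow> 'k::field poly"
  assumes phi_add: "\<lbrakk>a \<in> carrier R; b \<in> carrier R\<rbrakk> \<Longrightarrow> \<phi> (a \<oplus> b) = \<phi> a + \<phi> b"
    and phi_mult: "\<lbrakk>a \<in> carrier R; b \<in> carrier R\<rbrakk> \<Longrightarrow> \<phi> (a \<otimes> b) = \<phi> a * \<phi> b"
    and phi_one: "\<phi> \<one> = 1"
    and phi_surj: "\<exists>a\<in>carrier R. \<phi> a = p"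
    and phi_nil: "a \<in> carrier R \<Longrightarrow> \<phi> a = 0 \<Longrightarrow> \<exists>n::nat. a [^] n = \<zero>"
begin

lemma phi_zero: "\<phi> \<zero> = 0"
  using phi_add[OF zero_closed zero_closed] by (metis add.right_neutral add_left_imp_eq l_zero zero_closed)

lemma phi_minus: "\<lbrakk>a \<in> carrier R; b \<in> carrier R\<rbrakk> \<Longrightarrow> \<phi> (a \<ominus> b) = \<phi> a - \<phi> b"
  using phi_add[of "a \<ominus> b" b] by (simp add: a_minus_def a_assoc l_neg)

lemma phi_pow: "a \<in> carrier R \<Longrightarrow> \<phi> (a [^] (n::nat)) = \<phi> a ^ n"
  by (induction n) (auto simp: phi_one phi_mult)

lemma phi_zero_imp_mem: "primeideal P R \<Longrightarrow> a \<in> carrier R \<Longrightarrow> \<phi> a = 0 \<Longrightarrow> a \<in> P"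
proof -
  assume "primeideal P R" and a: "a \<in> carrier R" "\<phi> a = 0"
  then interpret P: primeideal P R by simp
  show ?thesis using phi_nil[OF a] P.pow_imp_mem a(1) P.zero_closed by metis
qed

text \<open>A prime contains the nil kernel of \<phi> and is therefore the full preimage of its
  image, so questions about primes can be settled in k[T].\<close>

lemma phi_eq_imp_mem: "primeideal P R \<Longrightarrow> a \<in> carrier R \<Longrightarrow> b \<in> P \<Longrightarrow> \<phi> a = \<phi> b \<Longrightarrow> a \<in> P"
proof -
  assume "primeideal P R" and a: "a \<in> carrier R" "b \<in> P" "\<phi> a = \<phi> b"
  then interpret P: primeideal P R by simp
  have b: "b \<in> carrier R" using a P.a_subset by blast
  have "a \<ominus> b \<in> P" using a b by (intro phi_zero_imp_mem[OF \<open>primeideal P R\<close>]) (auto simp: phi_minus)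
  then have "a \<ominus> b \<oplus> b \<in> P" using a(2) by simp
  then show ?thesis using a(1) b by (simp add: a_minus_def a_assoc l_neg)
qed

text \<open>Division with remainder: the image of a prime is closed under remainders because \<phi>
  is onto, so a nonzero element of least degree divides all others. A zero image has generator
  0.\<close>

lemma phi_image_principal:
  assumes "primeideal P R"
  shows "\<exists>p\<in>\<phi> ` P. \<forall>q\<in>\<phi> ` P. p dvd q"
proof (cases "\<exists>p\<in>\<phi> ` P. p \<noteq> 0")
  case False
  interpret P: primeideal P R by fact
  have "0 \<in> \<phi> ` P" using phi_zero P.zero_closed by (metis imageI)
  moreover have "\<forall>q\<in>\<phi> ` P. 0 dvd q" using False by (simp only: dvd_0_left_iff) blast
  ultimately show ?thesis by blast
next
  case True
  interpret P: primeideal P R by fact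
  from True obtain p1 where "p1 \<in> \<phi> ` P \<and> p1 \<noteq> 0" by blast
  from ex_has_least_nat[of "\<lambda>p. p \<in> \<phi> ` P \<and> p \<noteq> 0", OF this, of degree]
  obtain p where p: "p \<in> \<phi> ` P" "p \<noteq> 0"
    and min: "\<And>q. q \<in> \<phi> ` P \<Longrightarrow> q \<noteq> 0 \<Longrightarrow> degree p \<le> degree q"
    by blast
  have "p dvd q" if "q \<in> \<phi> ` P" for q
  proof (rule ccontr)
    assume "\<not> p dvd q"
    then have ne: "q mod p \<noteq> 0" by (simp add: mod_eq_0_iff_dvd)
    obtain a b c where a: "a \<in> P" "q = \<phi> a" "b \<in> P" "p = \<phi> b" "c \<in> carrier R" "\<phi> c = q div p"
      using \<open>q \<in> _\<close> p(1) phi_surj[of "q div p"] by blast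
    have carr: "a \<in> carrier R" "b \<in> carrier R" using a P.a_subset by auto
    have "\<phi> (a \<ominus> c \<otimes> b) = q mod p"
      using a carr by (simp add: phi_minus phi_mult minus_div_mult_eq_mod)
    moreover have "c \<otimes> b \<in> P" using a(3,5) P.I_l_closed by blast
    then have "a \<ominus> c \<otimes> b \<in> P" using a(1) by (simp add: a_minus_def)
    ultimately have "degree p \<le> degree (q mod p)" using min ne by (metis imageI)
    then show False using degree_mod_less'[OF p(2) ne] by simp
  qed
  then show ?thesis using p(1) by blast
qed

text \<open>As long as \<open>g\<close> lies in the image of \<open>P\<close>, the generator
  \<open>p\<close> of that image can be split off, and each such factor is absorbed by one power of
  \<open>h\<close>. Once the remaining polynomial leaves the image, any lift of it is outside
  \<open>P\<close> and serves as \<open>u\<close>.\<close>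

lemma dim_le_1_poly:
  assumes P: "primeideal P R" and "g \<noteq> 0" "h \<in> P"
  shows "\<exists>u\<in>carrier R - P. \<exists>n. g dvd \<phi> u * \<phi> h ^ n"
  using \<open>g \<noteq> 0\<close>
proof (induction "degree g" arbitrary: g rule: less_induct)
  case less
  interpret P: primeideal P R by fact
  obtain p where p: "p \<in> \<phi> ` P" "\<And>q. q \<in> \<phi> ` P \<Longrightarrow> p dvd q" using phi_image_principal[OF P] by blast
  show ?case
  proof (cases "g \<in> \<phi> ` P")
    case False
    obtain u where u: "u \<in> carrier R" "\<phi> u = g" using phi_surj by blast
    then have "u \<in> carrier R - P" using False by blast
    then show ?thesis using u by (metis dvd_triv_left)
  next
    case True
    then obtain g1 where g1: "g = p * g1" using p(2) by blast
    \<comment> \<open>A constant \<open>p\<close> would be a unit and put \<one> into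
      \<open>P\<close>; so splitting off \<open>p\<close> really lowers the degree.\<close>
    have "degree p \<noteq> 0"
    proof
      assume "degree p = 0"
      moreover have "p \<noteq> 0" using g1 less.prems by auto
      ultimately have "is_unit p" by (simp add: is_unit_iff_degree)
      then obtain c where c: "1 = c * p" by (metis dvd_def mult.commute)
      obtain a b where ab: "a \<in> P" "\<phi> a = p" "b \<in> carrier R" "\<phi> b = c" using p(1) phi_surj by blast
      then have "\<phi> \<one> = \<phi> (b \<otimes> a)" "b \<otimes> a \<in> P" using c P.a_subset P.I_l_closed by (auto simp: phi_one phi_mult)
      then have "\<one> \<in> P" using phi_eq_imp_mem[OF P] by blast
      then show False using P.one_notin by blast
    qed
    moreover have "p \<noteq> 0" "g1 \<noteq> 0" using g1 less.prems by auto
    ultimately have "degree g1 < degree g" using g1 by (simp add: degree_mult_eq)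
    then obtain u n where u: "u \<in> carrier R - P" "g1 dvd \<phi> u * \<phi> h ^ n"
      using less.hyps \<open>g1 \<noteq> 0\<close> by blast
    have "p dvd \<phi> h" using p(2) \<open>h \<in> P\<close> by blast
    then have "g dvd \<phi> h * (\<phi> u * \<phi> h ^ n)" using g1 u(2) by (simp add: mult_dvd_mono)
    then have "g dvd \<phi> u * \<phi> h ^ Suc n" by (simp add: ac_simps)
    then show ?thesis using u(1) by blast
  qed
qed

text \<open>The divisibility in k[T] lifts to \<open>R\<close> up to a nilpotent error
  \<open>?d\<close>; a power that kills the error leaves a multiple of \<open>f\<close>.\<close>

lemma dim_le_1:
  assumes P: "primeideal P R" and f: "f \<in> carrier R" "\<phi> f \<noteq> 0" and h: "h \<in> P"
  shows "\<exists>u\<in>carrier R - P. \<exists>n::nat. \<exists>w\<in>carrier R. u \<otimes> h [^] n = f \<otimes> w"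
proof -
  interpret P: primeideal P R by fact
  have hc: "h \<in> carrier R" using h P.a_subset by blast
  obtain u n where u: "u \<in> carrier R" "u \<notin> P" "\<phi> f dvd \<phi> u * \<phi> h ^ n"
    using dim_le_1_poly[OF P f(2) h] by blast
  obtain w where w: "w \<in> carrier R" "\<phi> u * \<phi> h ^ n = \<phi> f * \<phi> w" using u(3) phi_surj by (metis dvd_def)
  let ?d = "u \<otimes> h [^] n \<ominus> f \<otimes> w"
  have d: "?d \<in> carrier R" using u hc f w by simp
  have "\<phi> ?d = 0" using u hc f w by (simp add: phi_minus phi_mult phi_pow)
  then obtain k :: nat where k: "?d [^] k = \<zero>" using phi_nil d by blast
  obtain c where c: "c \<in> carrier R" "(?d \<oplus> f \<otimes> w) [^] k = ?d [^] k \<oplus> f \<otimes> w \<otimes> c"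
    using pow_add_expand[OF d, of "f \<otimes> w" k] f w by auto
  have "?d \<oplus> f \<otimes> w = u \<otimes> h [^] n" using u hc f w by (simp add: a_minus_def a_assoc l_neg)
  then have "(u \<otimes> h [^] n) [^] k = f \<otimes> (w \<otimes> c)" using c k f w by (simp add: m_assoc)
  moreover have "(u \<otimes> h [^] n) [^] k = u [^] k \<otimes> h [^] (n * k)" using u hc
    by (simp add: nat_pow_distrib nat_pow_pow)
  moreover have "u [^] k \<notin> P" using P.pow_imp_mem u by blast
  ultimately show ?thesis using u(1) w(1) c(1) by (metis DiffI m_closed nat_pow_closed)
qed

text \<open>Choose \<open>f\<close> in \<open>P1\<close> but not in \<open>P0\<close> and
  \<open>h\<close> in \<open>P2\<close> but not in \<open>P1\<close>. Then u h^n is a multiple of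
  \<open>f\<close> and hence lies in \<open>P1\<close>, although neither \<open>u\<close> nor
  \<open>h\<close> does.\<close>

lemma no_chain:
  assumes "primeideal P0 R" "primeideal P1 R" "primeideal P2 R" "P0 \<subset> P1" "P1 \<subset> P2"
  shows False
proof -
  interpret P1: primeideal P1 R by fact
  interpret P2: primeideal P2 R by fact
  obtain f h where f: "f \<in> P1" "f \<notin> P0" "h \<in> P2" "h \<notin> P1" using assms by blast
  have fc: "f \<in> carrier R" "h \<in> carrier R" using f P1.a_subset P2.a_subset by auto
  have "\<phi> f \<noteq> 0" using phi_zero_imp_mem[OF assms(1) fc(1)] f(2) by blast
  then obtain u n w where u: "u \<in> carrier R - P2" "w \<in> carrier R" "u \<otimes> h [^] (n::nat) = f \<otimes> w"
    using dim_le_1[OF assms(3) fc(1) _ f(3)] by blast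
  have "u \<otimes> h [^] n \<in> P1" unfolding u(3) using f(1) u(2) P1.I_r_closed by blast
  then have "u \<in> P1 \<or> h [^] n \<in> P1" using u(1) fc by (intro P1.I_prime) auto
  then show False using u(1) assms(5) f(4) P1.pow_imp_mem[OF fc(2)] by blast
qed

lemma kernel_prime: "primeideal {a \<in> carrier R. \<phi> a = 0} R"
  by (rule kernel_primeideal) (auto simp: phi_add phi_mult phi_one)

text \<open>The preimage of the ideal (T). In gr(R) this is the irrelevant maximal ideal, as only
  the monomial t^0 has degree 0.\<close>

definition origin where "origin = {a \<in> carrier R. poly (\<phi> a) 0 = 0}"

lemma origin_prime: "primeideal origin R"
  unfolding origin_def by (rule kernel_primeideal) (auto simp: phi_add phi_mult phi_one)

lemma kernel_psubset_origin: "{a \<in> carrier R. \<phi> a = 0} \<subset> origin"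
proof -
  obtain a where "a \<in> carrier R" "\<phi> a = [:0, 1:]" using phi_surj by blast
  then have "a \<in> origin" "a \<notin> {a \<in> carrier R. \<phi> a = 0}" by (auto simp: origin_def)
  moreover have "{a \<in> carrier R. \<phi> a = 0} \<subseteq> origin" by (auto simp: origin_def)
  ultimately show ?thesis by blast
qed

text \<open>The residue field at \<open>origin\<close> is k, so scaling by the inverse of the
  constant term of \<phi> u gives an inverse of \<open>u\<close> modulo
  \<open>origin\<close>.\<close>

lemma origin_complement:
  assumes "u \<in> carrier R" "u \<notin> origin"
  obtains v w where "v \<in> carrier R" "w \<in> origin" "v \<otimes> u = \<one> \<oplus> w"
proof -
  obtain v where v: "v \<in> carrier R" "\<phi> v = [:1 / poly (\<phi> u) 0:]" using phi_surj by blast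
  have "poly (\<phi> u) 0 \<noteq> 0" using assms by (simp add: origin_def)
  then have "v \<otimes> u \<ominus> \<one> \<in> origin" using assms(1) v
    by (simp add: origin_def phi_minus phi_mult phi_one)
  moreover have "v \<otimes> u = \<one> \<oplus> (v \<otimes> u \<ominus> \<one>)"
    using assms(1) v a_lcomm[of \<one> "v \<otimes> u" "\<ominus> \<one>"] by (simp add: a_minus_def r_neg)
  ultimately show ?thesis using that v(1) by blast
qed

lemma origin_maximal: "maximalideal origin R"
proof (rule maximalidealI)
  interpret O: primeideal origin R by (rule origin_prime)
  show "ideal origin R" by (rule O.is_ideal)
  show "carrier R \<noteq> origin" by (rule O.I_notcarr)
  fix J assume J: "ideal J R" "origin \<subseteq> J" "J \<subseteq> carrier R"
  interpret J: ideal J R by fact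
  show "J = origin \<or> J = carrier R"
  proof (cases "J \<subseteq> origin")
    case False
    then obtain u where u: "u \<in> J" "u \<notin> origin" by blast
    then have "u \<in> carrier R" using J by blast
    then obtain v w where v: "v \<in> carrier R" "w \<in> origin" "v \<otimes> u = \<one> \<oplus> w"
      using origin_complement u(2) by blast
    have "v \<otimes> u \<in> J" "\<ominus> w \<in> J" using J.I_l_closed[OF u(1) v(1)] v(2) J(2) by (simp, blast intro: J.a_inv_closed)
    then have "\<one> \<oplus> w \<oplus> \<ominus> w \<in> J" unfolding v(3) by simp
    moreover have "w \<in> carrier R" using v(2) unfolding origin_def by blast
    then have "\<one> \<oplus> w \<oplus> \<ominus> w = \<one>" by (simp add: a_assoc r_neg)
    ultimately show ?thesis using J.one_imp_carrier by simp
  qed (use J in blast)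
qed

text \<open>The kernel of \<phi> sits strictly inside the proper ideal \<open>origin\<close>, so no
  maximal ideal is contained in it. This is why every localization considered has dimension one and
  not zero.\<close>

lemma maximal_phi_nonzero:
  assumes P: "maximalideal P R"
  shows "\<exists>a\<in>P. \<phi> a \<noteq> 0"
proof (rule ccontr)
  assume *: "\<not> ?thesis"
  interpret P: maximalideal P R by fact
  interpret O: primeideal origin R by (rule origin_prime)
  have "P \<subseteq> {a \<in> carrier R. \<phi> a = 0}" using * P.a_subset by blast
  then have "P \<subset> origin" using kernel_psubset_origin by blast
  then show False using P.I_maximal[OF O.is_ideal] O.I_notcarr O.a_subset by blast
qed

end

text \<open>Through \<open>x0\<close> the map \<psi> shows that the annihilator lies in the kernel
  of \<phi>, that localizations are nonzero, and that \<open>x0\<close> is not a multiple of an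
  element of the prime.\<close>

locale nil_poly_module = nil_poly R \<phi> + module R M
  for R :: "('a, 'm) ring_scheme" (structure) and M :: "('a, 'b) module" (structure)
    and \<phi> :: "'a \<Rightarrow> 'k::field poly" +
  fixes \<psi> :: "'b \<Rightarrow> 'k poly" and x0 :: 'b
  assumes psi_smult: "\<lbrakk>a \<in> carrier R; x \<in> carrier M\<rbrakk> \<Longrightarrow> \<psi> (a \<odot>\<^bsub>M\<^esub> x) = \<phi> a * \<psi> x"
    and x0: "x0 \<in> carrier M" "\<psi> x0 = 1"
begin

lemma psi_zero: "\<psi> \<zero>\<^bsub>M\<^esub> = 0"
  using psi_smult[of \<zero> x0] x0 by (simp add: phi_zero)

lemma dim_eq_1: "module_dim R M = 1"
proof (rule module_dim_eq_1I[OF kernel_prime origin_prime _ kernel_psubset_origin no_chain])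
  show "annihilator R M \<subseteq> {a \<in> carrier R. \<phi> a = 0}"
  proof
    fix a assume "a \<in> annihilator R M"
    then have "a \<in> carrier R" "a \<odot>\<^bsub>M\<^esub> x0 = \<zero>\<^bsub>M\<^esub>" using x0(1) by (auto simp: annihilator_def)
    then show "a \<in> {a \<in> carrier R. \<phi> a = 0}" using psi_smult[of a x0] x0 psi_zero by simp
  qed
qed

end

section \<open>Dimension and depth at a prime that exceeds the kernel\<close>

locale nil_poly_local = nil_poly_module R M \<phi> \<psi> x0 + localization R M P
  for R :: "('a, 'm) ring_scheme" (structure) and M :: "('a, 'b) module" (structure)
    and \<phi> :: "'a \<Rightarrow> 'k::field poly" and \<psi> x0 P +
  assumes phi_nonzero: "\<exists>a\<in>P. \<phi> a \<noteq> 0"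
begin

sublocale L: plain_module "loc_ring R P" "loc_module R M P"
  by (intro plain_module.intro loc_module)

lemma x0_frac: "frac x0 \<one> \<in> carrier (loc_module R M P)" "frac x0 \<one> \<noteq> \<zero>\<^bsub>loc_module R M P\<^esub>"
proof -
  show "frac x0 \<one> \<in> carrier (loc_module R M P)" using x0 by simp
  have "w \<odot>\<^bsub>M\<^esub> x0 \<noteq> \<zero>\<^bsub>M\<^esub>" if "w \<in> U" for w
    using psi_smult[of w x0] x0 psi_zero phi_zero_imp_mem[OF prime, of w] that unfolding U_def by auto
  then show "frac x0 \<one> \<noteq> \<zero>\<^bsub>loc_module R M P\<^esub>" using x0 by (simp add: frac_eq_zero_iff)
qed

lemma in_support: "in_support R M P"
  unfolding in_support_def using x0_frac by (metis singletonD)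

lemma loc_dim: "module_dim (loc_ring R P) (loc_module R M P) = 1"
proof (rule module_dim_eq_1I)
  let ?K = "{a \<in> carrier R. \<phi> a = 0}"
  have KP: "?K \<subset> P" using phi_zero_imp_mem[OF prime] phi_nonzero by blast
  show K: "primeideal (extension ?K) (loc_ring R P)" by (rule extension_prime[OF kernel_prime]) (use KP in blast)
  show "primeideal (extension P) (loc_ring R P)" by (rule extension_prime[OF prime]) blast
  obtain a where a: "a \<in> P" "\<phi> a \<noteq> 0" using phi_nonzero by blast
  then have "rfrac a \<one> \<in> extension P" "rfrac a \<one> \<notin> extension ?K"
    using rfrac_mem_extension[OF prime] rfrac_mem_extension[OF kernel_prime] KP P_carr by auto
  moreover have "extension ?K \<subseteq> extension P" using KP unfolding extension_def by blast
  ultimately show "extension ?K \<subset> extension P" by blast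
  show "annihilator (loc_ring R P) (loc_module R M P) \<subseteq> extension ?K"
  proof
    fix A assume "A \<in> annihilator (loc_ring R P) (loc_module R M P)"
    then have A: "A \<in> carrier (loc_ring R P)" "A \<odot>\<^bsub>loc_module R M P\<^esub> frac x0 \<one> = \<zero>\<^bsub>loc_module R M P\<^esub>"
      using x0_frac(1) by (auto simp: annihilator_def)
    then obtain a s where a: "A = rfrac a s" "a \<in> carrier R" "s \<in> U" by (elim loc_ring_carrierE)
    then have "\<exists>w\<in>U. w \<odot>\<^bsub>M\<^esub> (a \<odot>\<^bsub>M\<^esub> x0) = \<zero>\<^bsub>M\<^esub>"
      using A(2) x0 by (simp add: loc_smult frac_eq_zero_iff)
    then obtain w where w: "w \<in> U" "w \<odot>\<^bsub>M\<^esub> (a \<odot>\<^bsub>M\<^esub> x0) = \<zero>\<^bsub>M\<^esub>" by blast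
    then have "\<phi> w * \<phi> a = 0" using psi_smult[of w "a \<odot>\<^bsub>M\<^esub> x0"] psi_smult[of a x0] a x0 psi_zero by simp
    moreover have "\<phi> w \<noteq> 0" using w(1) phi_zero_imp_mem[OF prime] unfolding U_def by blast
    ultimately have "\<phi> a = 0" by simp
    then show "A \<in> extension ?K" using a unfolding extension_def by blast
  qed
  fix P0 P1 P2
  assume "primeideal P0 (loc_ring R P)" "primeideal P1 (loc_ring R P)" "primeideal P2 (loc_ring R P)"
    "P0 \<subset> P1" "P1 \<subset> P2"
  then show False
    using no_chain[OF contraction_prime contraction_prime contraction_prime
        contraction_strict_mono contraction_strict_mono] by metis
qed

text \<open>Replaces Nakayama's lemma. Applying \<psi> to a relation w s t x0 = w a y gives an
  equality of values of \<phi> whose right side comes from \<open>P\<close>, so w s t would lie in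
  \<open>P\<close> although it is a product of elements outside.\<close>

lemma x0_not_multiple:
  assumes "A \<in> extension P" "Y \<in> carrier (loc_module R M P)"
  shows "frac x0 \<one> \<noteq> A \<odot>\<^bsub>loc_module R M P\<^esub> Y"
proof
  assume eq: "frac x0 \<one> = A \<odot>\<^bsub>loc_module R M P\<^esub> Y"
  interpret P: primeideal P R by (rule prime)
  obtain a s y t where a: "A = rfrac a s" "a \<in> P" "s \<in> U" "Y = frac y t" "y \<in> carrier M" "t \<in> U"
    using assms unfolding extension_def loc_carrier by blast
  note [simp] = P_carr[OF a(2)]
  obtain w where w: "w \<in> U" "w \<odot>\<^bsub>M\<^esub> ((s \<otimes> t) \<odot>\<^bsub>M\<^esub> x0) = w \<odot>\<^bsub>M\<^esub> (a \<odot>\<^bsub>M\<^esub> y)"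
    using eq a x0 by (auto simp: loc_smult frac_eq_iff)
  \<comment> \<open>Lifting \<psi> y to \<open>R\<close> turns the right side into the image under
    \<phi> of an element of \<open>P\<close>.\<close>
  obtain b where b: "b \<in> carrier R" "\<phi> b = \<psi> y" using phi_surj by blast
  have "\<psi> (w \<odot>\<^bsub>M\<^esub> ((s \<otimes> t) \<odot>\<^bsub>M\<^esub> x0)) = \<phi> (w \<otimes> (s \<otimes> t))"
    using w(1) a x0 by (simp add: psi_smult phi_mult)
  moreover have "\<psi> (w \<odot>\<^bsub>M\<^esub> (a \<odot>\<^bsub>M\<^esub> y)) = \<phi> (w \<otimes> (b \<otimes> a))"
    using w(1) a x0 b by (simp add: psi_smult phi_mult)
  ultimately have "\<phi> (w \<otimes> (s \<otimes> t)) = \<phi> (w \<otimes> (b \<otimes> a))" using w(2) by simp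
  moreover have "w \<otimes> (b \<otimes> a) \<in> P" using a(2) b(1) w(1) P.I_l_closed by simp
  ultimately have "w \<otimes> (s \<otimes> t) \<in> P" using phi_eq_imp_mem[OF prime, of "w \<otimes> (s \<otimes> t)"] w(1) a by simp
  moreover have "w \<otimes> (s \<otimes> t) \<in> U" using w(1) a by simp
  ultimately show False by (simp add: U_def)
qed

lemma pow_smult_frac:
  assumes "a \<in> carrier R" "s \<in> U" "x \<in> carrier M" "t \<in> U"
  shows "(rfrac a s [^]\<^bsub>loc_ring R P\<^esub> (n::nat)) \<odot>\<^bsub>loc_module R M P\<^esub> frac x t = frac (a [^] n \<odot>\<^bsub>M\<^esub> x) (s [^] n \<otimes> t)"
  using assms rfrac_pow[OF assms(1,2), of n] by (simp add: loc_smult)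

lemma nonzerodivisor_pow:
  assumes A: "A \<in> carrier (loc_ring R P)"
    and inj: "\<And>X. X \<in> carrier (loc_module R M P) \<Longrightarrow> A \<odot>\<^bsub>loc_module R M P\<^esub> X = \<zero>\<^bsub>loc_module R M P\<^esub> \<Longrightarrow> X = \<zero>\<^bsub>loc_module R M P\<^esub>"
    and X: "X \<in> carrier (loc_module R M P)"
    and pow: "(A [^]\<^bsub>loc_ring R P\<^esub> (n::nat)) \<odot>\<^bsub>loc_module R M P\<^esub> X = \<zero>\<^bsub>loc_module R M P\<^esub>"
  shows "X = \<zero>\<^bsub>loc_module R M P\<^esub>"
  using pow
proof (induction n)
  case 0
  then show ?case using X by simp
next
  case (Suc n)
  then show ?case using inj[of "(A [^]\<^bsub>loc_ring R P\<^esub> n) \<odot>\<^bsub>loc_module R M P\<^esub> X"] L.smult_pow[OF A X, of n] A X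
    by (metis L.R.nat_pow_closed L.smult_closed)
qed

text \<open>For a nonzerodivisor \<open>A\<close> and any \<open>B\<close> in the maximal ideal,
  \<open>dim_le_1\<close> moves a power of \<open>B\<close> times \<open>x0\<close> into the image
  of \<open>A\<close>, while \<open>x0\<close> itself is not in that image.\<close>

lemma loc_depth_le: "depth (loc_ring R P) (carrier (loc_ring R P) - Units (loc_ring R P)) (loc_module R M P) \<le> 1"
  unfolding nonunits_eq
proof (rule L.depth_le_1)
  fix A B assume A: "A \<in> extension P" "A \<in> carrier (loc_ring R P)" and B: "B \<in> extension P"
    and inj: "\<And>X. X \<in> carrier (loc_module R M P) \<Longrightarrow> A \<odot>\<^bsub>loc_module R M P\<^esub> X = \<zero>\<^bsub>loc_module R M P\<^esub> \<Longrightarrow> X = \<zero>\<^bsub>loc_module R M P\<^esub>"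
  obtain f s where f: "A = rfrac f s" "f \<in> P" "s \<in> U" using A unfolding extension_def by blast
  obtain h t where h: "B = rfrac h t" "h \<in> P" "t \<in> U" using B unfolding extension_def by blast
  note [simp] = P_carr[OF f(2)] P_carr[OF h(2)] x0(1)
  \<comment> \<open>Otherwise \<open>f\<close> is nilpotent, and a power of the nonzerodivisor
    \<open>A\<close> would kill the nonzero fraction of \<open>x0\<close>.\<close>
  have "\<phi> f \<noteq> 0"
  proof
    assume "\<phi> f = 0"
    then obtain n :: nat where n: "f [^] n = \<zero>" using phi_nil[of f] by auto
    then have "(A [^]\<^bsub>loc_ring R P\<^esub> n) \<odot>\<^bsub>loc_module R M P\<^esub> frac x0 \<one> = \<zero>\<^bsub>loc_module R M P\<^esub>"
      using f rfrac_pow[of f s n, THEN conjunct1]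
      by (simp add: pow_smult_frac frac_eq_zero_iff) (use one_U in blast)
    then show False using nonzerodivisor_pow[OF A(2) inj x0_frac(1)] x0_frac(2) by blast
  qed
  then obtain u n w where u: "u \<in> carrier R - P" "w \<in> carrier R" "u \<otimes> h [^] (n::nat) = f \<otimes> w"
    using dim_le_1[OF prime _ _ h(2), of f] by auto
  then have uU: "u \<in> U" by (simp add: U_def)
  have tn: "t [^] n \<in> U" using rfrac_pow[of h t n] h by auto
  have "(B [^]\<^bsub>loc_ring R P\<^esub> n) \<odot>\<^bsub>loc_module R M P\<^esub> frac x0 \<one> = frac (h [^] n \<odot>\<^bsub>M\<^esub> x0) (t [^] n)"
    using h tn by (simp add: pow_smult_frac)
  \<comment> \<open>The factor \<open>s\<close> compensates the denominator of \<open>A\<close>, and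
    \<open>u\<close> can move into the denominator because it lies outside \<open>P\<close>.\<close>
  also have "\<dots> = frac (f \<odot>\<^bsub>M\<^esub> (s \<odot>\<^bsub>M\<^esub> (w \<odot>\<^bsub>M\<^esub> x0))) (s \<otimes> (u \<otimes> t [^] n))"
  proof (rule frac_eqI)
    have "(s \<otimes> (u \<otimes> t [^] n)) \<odot>\<^bsub>M\<^esub> (h [^] n \<odot>\<^bsub>M\<^esub> x0) = (s \<otimes> t [^] n \<otimes> (u \<otimes> h [^] n)) \<odot>\<^bsub>M\<^esub> x0"
      using f tn uU by (simp add: norm_simps)
    also have "\<dots> = t [^] n \<odot>\<^bsub>M\<^esub> (f \<odot>\<^bsub>M\<^esub> (s \<odot>\<^bsub>M\<^esub> (w \<odot>\<^bsub>M\<^esub> x0)))"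
      unfolding u(3) using f tn uU u(2) by (simp add: norm_simps)
    finally show "(s \<otimes> (u \<otimes> t [^] n)) \<odot>\<^bsub>M\<^esub> (h [^] n \<odot>\<^bsub>M\<^esub> x0) = t [^] n \<odot>\<^bsub>M\<^esub> (f \<odot>\<^bsub>M\<^esub> (s \<odot>\<^bsub>M\<^esub> (w \<odot>\<^bsub>M\<^esub> x0)))" .
  qed (use f tn uU u(2) in simp_all)
  also have "\<dots> = A \<odot>\<^bsub>loc_module R M P\<^esub> frac (s \<odot>\<^bsub>M\<^esub> (w \<odot>\<^bsub>M\<^esub> x0)) (u \<otimes> t [^] n)"
    using f tn uU u(2) by (simp add: loc_smult)
  finally have eq: "(B [^]\<^bsub>loc_ring R P\<^esub> n) \<odot>\<^bsub>loc_module R M P\<^esub> frac x0 \<one> =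
    A \<odot>\<^bsub>loc_module R M P\<^esub> frac (s \<odot>\<^bsub>M\<^esub> (w \<odot>\<^bsub>M\<^esub> x0)) (u \<otimes> t [^] n)" .
  show "\<exists>Y\<in>carrier (loc_module R M P). (\<forall>Z\<in>carrier (loc_module R M P). Y \<noteq> A \<odot>\<^bsub>loc_module R M P\<^esub> Z) \<and>
    (\<exists>n::nat. \<exists>Z\<in>carrier (loc_module R M P). (B [^]\<^bsub>loc_ring R P\<^esub> n) \<odot>\<^bsub>loc_module R M P\<^esub> Y = A \<odot>\<^bsub>loc_module R M P\<^esub> Z)"
    using x0_frac(1) x0_not_multiple[OF A(1)] eq f tn uU u(2)
    by (intro bexI[of _ "frac x0 \<one>"] conjI ballI exI[of _ n] bexI[of _ "frac (s \<odot>\<^bsub>M\<^esub> (w \<odot>\<^bsub>M\<^esub> x0)) (u \<otimes> t [^] n)"]) auto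
qed

text \<open>With dimension one and depth at most one, only a single nonzerodivisor in the maximal
  ideal is asked for; \<open>x0\<close> supplies the condition that it does not act surjectively.
  Denominators are units, so a numerator suffices.\<close>

lemma local_cm_iff: "local_cohen_macaulay (loc_ring R P) (loc_module R M P) \<longleftrightarrow>
  (\<exists>f\<in>P. \<forall>x\<in>carrier M. (\<exists>w\<in>U. w \<odot>\<^bsub>M\<^esub> (f \<odot>\<^bsub>M\<^esub> x) = \<zero>\<^bsub>M\<^esub>) \<longrightarrow> (\<exists>w\<in>U. w \<odot>\<^bsub>M\<^esub> x = \<zero>\<^bsub>M\<^esub>))" (is "_ \<longleftrightarrow> ?R")
proof -
  have inj_iff: "(\<forall>X\<in>carrier (loc_module R M P). rfrac f s \<odot>\<^bsub>loc_module R M P\<^esub> X = \<zero>\<^bsub>loc_module R M P\<^esub> \<longrightarrow> X = \<zero>\<^bsub>loc_module R M P\<^esub>) \<longleftrightarrow>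
    (\<forall>x\<in>carrier M. (\<exists>w\<in>U. w \<odot>\<^bsub>M\<^esub> (f \<odot>\<^bsub>M\<^esub> x) = \<zero>\<^bsub>M\<^esub>) \<longrightarrow> (\<exists>w\<in>U. w \<odot>\<^bsub>M\<^esub> x = \<zero>\<^bsub>M\<^esub>))" (is "?lhs \<longleftrightarrow> ?rhs")
    if f: "f \<in> P" "s \<in> U" for f s
  proof
    assume l: ?lhs
    show ?rhs
    proof (intro ballI impI)
      fix x assume x: "x \<in> carrier M" "\<exists>w\<in>U. w \<odot>\<^bsub>M\<^esub> (f \<odot>\<^bsub>M\<^esub> x) = \<zero>\<^bsub>M\<^esub>"
      then have "rfrac f s \<odot>\<^bsub>loc_module R M P\<^esub> frac x \<one> = \<zero>\<^bsub>loc_module R M P\<^esub>"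
        using f P_carr by (simp add: loc_smult frac_eq_zero_iff)
      then show "\<exists>w\<in>U. w \<odot>\<^bsub>M\<^esub> x = \<zero>\<^bsub>M\<^esub>" using l x(1) frac_eq_zero_iff[of x \<one>] by auto
    qed
  next
    assume r: ?rhs
    show ?lhs
    proof (intro ballI impI)
      fix X assume X: "X \<in> carrier (loc_module R M P)" "rfrac f s \<odot>\<^bsub>loc_module R M P\<^esub> X = \<zero>\<^bsub>loc_module R M P\<^esub>"
      then obtain x t where x: "X = frac x t" "x \<in> carrier M" "t \<in> U" by (elim loc_carrierE)
      then have "\<exists>w\<in>U. w \<odot>\<^bsub>M\<^esub> (f \<odot>\<^bsub>M\<^esub> x) = \<zero>\<^bsub>M\<^esub>" using X(2) f P_carr by (simp add: loc_smult frac_eq_zero_iff)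
      then show "X = \<zero>\<^bsub>loc_module R M P\<^esub>" using r x by (simp add: frac_eq_zero_iff)
    qed
  qed
  have Ec: "A \<in> carrier (loc_ring R P)" if "A \<in> extension P" for A using that P_carr unfolding extension_def by auto
  have "local_cohen_macaulay (loc_ring R P) (loc_module R M P) \<longleftrightarrow>
      1 \<le> depth (loc_ring R P) (extension P) (loc_module R M P)"
    unfolding local_cohen_macaulay_def loc_dim using loc_depth_le unfolding nonunits_eq by auto
  also have "\<dots> \<longleftrightarrow> (\<exists>A\<in>extension P. \<forall>X\<in>carrier (loc_module R M P).
      A \<odot>\<^bsub>loc_module R M P\<^esub> X = \<zero>\<^bsub>loc_module R M P\<^esub> \<longrightarrow> X = \<zero>\<^bsub>loc_module R M P\<^esub>)"
  proof
    assume "1 \<le> depth (loc_ring R P) (extension P) (loc_module R M P)"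
    then show "\<exists>A\<in>extension P. \<forall>X\<in>carrier (loc_module R M P).
      A \<odot>\<^bsub>loc_module R M P\<^esub> X = \<zero>\<^bsub>loc_module R M P\<^esub> \<longrightarrow> X = \<zero>\<^bsub>loc_module R M P\<^esub>"
      by (rule L.depth_ge_1_imp) blast
  next
    assume "\<exists>A\<in>extension P. \<forall>X\<in>carrier (loc_module R M P).
      A \<odot>\<^bsub>loc_module R M P\<^esub> X = \<zero>\<^bsub>loc_module R M P\<^esub> \<longrightarrow> X = \<zero>\<^bsub>loc_module R M P\<^esub>"
    then obtain A where A: "A \<in> extension P" "\<And>X. X \<in> carrier (loc_module R M P) \<Longrightarrow>
      A \<odot>\<^bsub>loc_module R M P\<^esub> X = \<zero>\<^bsub>loc_module R M P\<^esub> \<Longrightarrow> X = \<zero>\<^bsub>loc_module R M P\<^esub>" by blast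
    show "1 \<le> depth (loc_ring R P) (extension P) (loc_module R M P)"
      by (rule L.depth_ge_1[OF A(1) Ec[OF A(1)] A(2) x0_frac(1) x0_not_multiple[OF A(1)]])
  qed
  also have "\<dots> \<longleftrightarrow> ?R"
  proof
    assume "\<exists>A\<in>extension P. \<forall>X\<in>carrier (loc_module R M P).
      A \<odot>\<^bsub>loc_module R M P\<^esub> X = \<zero>\<^bsub>loc_module R M P\<^esub> \<longrightarrow> X = \<zero>\<^bsub>loc_module R M P\<^esub>"
    then obtain f s where "f \<in> P" "s \<in> U" "\<forall>X\<in>carrier (loc_module R M P).
      rfrac f s \<odot>\<^bsub>loc_module R M P\<^esub> X = \<zero>\<^bsub>loc_module R M P\<^esub> \<longrightarrow> X = \<zero>\<^bsub>loc_module R M P\<^esub>"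
      unfolding extension_def by blast
    then show ?R using inj_iff[of f s] by blast
  next
    assume ?R
    then obtain f where f: "f \<in> P" "\<forall>x\<in>carrier M. (\<exists>w\<in>U. w \<odot>\<^bsub>M\<^esub> (f \<odot>\<^bsub>M\<^esub> x) = \<zero>\<^bsub>M\<^esub>) \<longrightarrow> (\<exists>w\<in>U. w \<odot>\<^bsub>M\<^esub> x = \<zero>\<^bsub>M\<^esub>)" by blast
    then have "rfrac f \<one> \<in> extension P" unfolding extension_def using one_U by blast
    then show "\<exists>A\<in>extension P. \<forall>X\<in>carrier (loc_module R M P).
      A \<odot>\<^bsub>loc_module R M P\<^esub> X = \<zero>\<^bsub>loc_module R M P\<^esub> \<longrightarrow> X = \<zero>\<^bsub>loc_module R M P\<^esub>"
      using f inj_iff[OF f(1) one_U] by blast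
  qed
  finally show ?thesis .
qed

end

section \<open>Criteria for and against the Cohen-Macaulay property\<close>

context nil_poly_module begin

lemma nil_poly_localI: "primeideal P R \<Longrightarrow> \<exists>a\<in>P. \<phi> a \<noteq> 0 \<Longrightarrow> nil_poly_local R M \<phi> \<psi> x0 P"
  by (intro nil_poly_local.intro nil_poly_local_axioms.intro localization.intro localization_axioms.intro)
    (rule nil_poly_module_axioms module_axioms | assumption)+

text \<open>The map \<iota> is a section of \<phi>; in the application it sends the variable of k[T]
  to the initial form of t^m.\<close>

lemma cohen_macaulayI:
  assumes \<iota>: "\<And>p. \<iota> p \<in> carrier R" "\<And>p. \<phi> (\<iota> p) = p"
    and inj: "\<And>p x. p \<noteq> 0 \<Longrightarrow> x \<in> carrier M \<Longrightarrow> \<iota> p \<odot>\<^bsub>M\<^esub> x = \<zero>\<^bsub>M\<^esub> \<Longrightarrow> x = \<zero>\<^bsub>M\<^esub>"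
  shows "cohen_macaulay R M"
  unfolding cohen_macaulay_def
proof (intro allI impI, elim conjE)
  fix P assume P: "maximalideal P R"
  have prime: "primeideal P R" using P by (rule maximalideal_prime)
  obtain a where a: "a \<in> P" "\<phi> a \<noteq> 0" using maximal_phi_nonzero[OF P] by blast
  interpret nil_poly_local R M \<phi> \<psi> x0 P by (rule nil_poly_localI[OF prime]) (use a in blast)
  \<comment> \<open>The element \<open>a\<close> itself may be a zero divisor. Its replacement has
    the same image under \<phi>, so it stays in \<open>P\<close>, and it is the lift of a nonzero
    polynomial.\<close>
  have f: "\<iota> (\<phi> a) \<in> P" using phi_eq_imp_mem[OF prime _ a(1)] \<iota> by simp
  have "\<exists>w\<in>U. w \<odot>\<^bsub>M\<^esub> x = \<zero>\<^bsub>M\<^esub>" if "x \<in> carrier M" "w \<in> U" "w \<odot>\<^bsub>M\<^esub> (\<iota> (\<phi> a) \<odot>\<^bsub>M\<^esub> x) = \<zero>\<^bsub>M\<^esub>" for x w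
  proof -
    have "\<iota> (\<phi> a) \<odot>\<^bsub>M\<^esub> (w \<odot>\<^bsub>M\<^esub> x) = w \<odot>\<^bsub>M\<^esub> (\<iota> (\<phi> a) \<odot>\<^bsub>M\<^esub> x)"
      using that \<iota>(1)[of "\<phi> a"] by (simp add: smult_assoc1[symmetric] m_comm)
    then have "w \<odot>\<^bsub>M\<^esub> x = \<zero>\<^bsub>M\<^esub>" using inj[OF a(2), of "w \<odot>\<^bsub>M\<^esub> x"] that by simp
    then show ?thesis using that by blast
  qed
  then show "local_cohen_macaulay (loc_ring R P) (loc_module R M P)"
    unfolding local_cm_iff using f by blast
qed

text \<open>A nonzerodivisor in the localization at \<open>origin\<close> would force
  \<open>x\<close> to vanish there, since one of its powers kills \<open>x\<close>. Then some
  \<open>u\<close> outside \<open>origin\<close> kills \<open>x\<close>; as \<open>u\<close> is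
  invertible modulo elements that act nilpotently on \<open>x\<close>, this gives x = 0.\<close>

lemma not_cohen_macaulayI:
  assumes x: "x \<in> carrier M" "x \<noteq> \<zero>\<^bsub>M\<^esub>"
    and nil: "\<And>f. f \<in> carrier R \<Longrightarrow> poly (\<phi> f) 0 = 0 \<Longrightarrow> \<exists>n::nat. f [^] n \<odot>\<^bsub>M\<^esub> x = \<zero>\<^bsub>M\<^esub>"
  shows "\<not> cohen_macaulay R M"
proof
  assume CM: "cohen_macaulay R M"
  have nz: "\<exists>a\<in>origin. \<phi> a \<noteq> 0" using kernel_psubset_origin by (auto simp: origin_def)
  interpret nil_poly_local R M \<phi> \<psi> x0 origin by (rule nil_poly_localI[OF origin_prime nz])
  have "local_cohen_macaulay (loc_ring R origin) (loc_module R M origin)"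
    using CM origin_maximal in_support unfolding cohen_macaulay_def by blast
  then obtain f where f: "f \<in> origin"
    and inj: "\<And>x. x \<in> carrier M \<Longrightarrow> \<exists>w\<in>U. w \<odot>\<^bsub>M\<^esub> (f \<odot>\<^bsub>M\<^esub> x) = \<zero>\<^bsub>M\<^esub> \<Longrightarrow> \<exists>w\<in>U. w \<odot>\<^bsub>M\<^esub> x = \<zero>\<^bsub>M\<^esub>"
    unfolding local_cm_iff by blast
  have fc: "f \<in> carrier R" "poly (\<phi> f) 0 = 0" using f by (auto simp: origin_def)
  obtain n :: nat where n: "f [^] n \<odot>\<^bsub>M\<^esub> x = \<zero>\<^bsub>M\<^esub>" using nil[OF fc] by blast
  have "\<exists>w\<in>U. w \<odot>\<^bsub>M\<^esub> (f [^] n \<odot>\<^bsub>M\<^esub> x) = \<zero>\<^bsub>M\<^esub>" unfolding n by (rule bexI[OF _ one_U]) simp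
  then have "\<exists>w\<in>U. w \<odot>\<^bsub>M\<^esub> x = \<zero>\<^bsub>M\<^esub>"
  proof (induction n)
    case 0
    then show ?case using x(1) by simp
  next
    case (Suc n)
    then show ?case using inj[of "f [^] n \<odot>\<^bsub>M\<^esub> x"] smult_pow[OF fc(1) x(1), of n] fc(1) x(1) by simp
  qed
  then obtain u where u: "u \<in> U" "u \<odot>\<^bsub>M\<^esub> x = \<zero>\<^bsub>M\<^esub>" by blast
  then obtain v w where v: "v \<in> carrier R" "w \<in> origin" "v \<otimes> u = \<one> \<oplus> w"
    using origin_complement[of u] by (auto simp: U_def)
  have wc: "w \<in> carrier R" "poly (\<phi> w) 0 = 0" using v(2) by (auto simp: origin_def)
  \<comment> \<open>From v u = 1 + w: whatever \<open>u\<close> and \<open>w\<close> both kill is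
    zero. So powers of \<open>w\<close> can be stripped off any element killed by
    \<open>u\<close>.\<close>
  have inj': "y = \<zero>\<^bsub>M\<^esub>" if y: "y \<in> carrier M" "u \<odot>\<^bsub>M\<^esub> y = \<zero>\<^bsub>M\<^esub>" "w \<odot>\<^bsub>M\<^esub> y = \<zero>\<^bsub>M\<^esub>" for y
  proof -
    have "(v \<otimes> u) \<odot>\<^bsub>M\<^esub> y = \<zero>\<^bsub>M\<^esub>" using y v(1) u(1) by (simp add: smult_assoc1)
    then show ?thesis unfolding v(3) using y wc by (simp add: smult_l_distr)
  qed
  obtain k :: nat where "w [^] k \<odot>\<^bsub>M\<^esub> x = \<zero>\<^bsub>M\<^esub>" using nil[OF wc] by blast
  then have "x = \<zero>\<^bsub>M\<^esub>"
  proof (induction k)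
    case 0
    then show ?case using x(1) by simp
  next
    case (Suc k)
    have "u \<odot>\<^bsub>M\<^esub> (w [^] k \<odot>\<^bsub>M\<^esub> x) = w [^] k \<odot>\<^bsub>M\<^esub> (u \<odot>\<^bsub>M\<^esub> x)"
      using u(1) wc(1) x(1) by (simp add: smult_assoc1[symmetric] m_comm)
    then show ?case using Suc inj'[of "w [^] k \<odot>\<^bsub>M\<^esub> x"] smult_pow[OF wc(1) x(1), of k] wc(1) x(1) u by simp
  qed
  then show False using x(2) by blast
qed

end

section \<open>The associated graded module in terms of monomials\<close>

definition fps_supp :: "nat set \<Rightarrow> 'k::field fps set" where
  "fps_supp X = {f. \<forall>n. fps_nth f n \<noteq> 0 \<longrightarrow> n \<in> X}"

lemma fps_supp_zero [simp]: "0 \<in> fps_supp X"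
  and fps_supp_add: "f \<in> fps_supp X \<Longrightarrow> g \<in> fps_supp X \<Longrightarrow> f + g \<in> fps_supp X"
  and fps_supp_uminus: "f \<in> fps_supp X \<Longrightarrow> - f \<in> fps_supp X"
  and fps_supp_mono: "X \<subseteq> Y \<Longrightarrow> fps_supp X \<subseteq> fps_supp Y"
  by (auto simp: fps_supp_def) (metis add_0)

lemma fps_supp_diff: "f \<in> fps_supp X \<Longrightarrow> g \<in> fps_supp X \<Longrightarrow> f - g \<in> fps_supp X"
  using fps_supp_add[of f X "- g"] fps_supp_uminus[of g X] by simp

lemma fps_supp_sum: "(\<And>i. i \<in> A \<Longrightarrow> f i \<in> fps_supp X) \<Longrightarrow> (\<Sum>i\<in>A. f i) \<in> fps_supp X"
  by (induction A rule: infinite_finite_induct) (auto intro: fps_supp_add)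

lemma fps_supp_mult: 
  assumes "f \<in> fps_supp X" "g \<in> fps_supp Y" shows "f * g \<in> fps_supp (X + Y)"
  unfolding fps_supp_def
proof (intro CollectI allI impI)
  fix n assume "fps_nth (f * g) n \<noteq> 0"
  then obtain i where "i \<le> n" "fps_nth f i * fps_nth g (n - i) \<noteq> 0"
    unfolding fps_mult_nth by (metis (no_types, lifting) atLeastAtMost_iff sum.neutral)
  then have "i \<in> X" "n - i \<in> Y" "n = i + (n - i)" using assms by (auto simp: fps_supp_def)
  then show "n \<in> X + Y" by (metis set_plus_intro)
qed

lemma fps_X_power_supp [simp]: "fps_X ^ n \<in> fps_supp X \<longleftrightarrow> n \<in> X"
  by (auto simp: fps_supp_def fps_X_power_nth)

lemma semigroup_ring_simps [simp]:
  "carrier (semigroup_ring S) = fps_supp S" "\<zero>\<^bsub>semigroup_ring S\<^esub> = 0" "\<one>\<^bsub>semigroup_ring S\<^esub> = 1"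
  "f \<oplus>\<^bsub>semigroup_ring S\<^esub> g = f + g" "f \<otimes>\<^bsub>semigroup_ring S\<^esub> g = f * g"
  by (simp_all add: semigroup_ring_def fps_supp_def)

lemma ideal_module_simps [simp]:
  "carrier (ideal_module R I) = I" "\<zero>\<^bsub>ideal_module R I\<^esub> = \<zero>\<^bsub>R\<^esub>"
  "f \<oplus>\<^bsub>ideal_module R I\<^esub> g = f \<oplus>\<^bsub>R\<^esub> g" "f \<odot>\<^bsub>ideal_module R I\<^esub> g = f \<otimes>\<^bsub>R\<^esub> g"
  "(ideal_module R I)\<lparr>carrier := I'\<rparr> = ideal_module R I'"
  by (simp_all add: ideal_module_def self_module_def)

lemma self_module_eq: "self_module R = ideal_module R (carrier R)"
  by (simp add: ideal_module_def self_module_def)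

text \<open>An element of the graded module is encoded by the polynomial whose coefficient at \<open>x\<close> is the
  coordinate with respect to the initial form of \<open>t^x\<close>; \<open>gr_elt\<close> decodes and \<open>gr_mult\<close> is the product.\<close>

definition ord_part :: "nat set \<Rightarrow> nat set \<Rightarrow> nat \<Rightarrow> 'k::field poly \<Rightarrow> 'k fps" where
  "ord_part S X i p = Abs_fps (\<lambda>x. if x \<in> X \<and> sg_val S X x = i then coeff p x else 0)"

definition ord_coset :: "nat set \<Rightarrow> nat set \<Rightarrow> nat \<Rightarrow> 'k::field fps \<Rightarrow> 'k fps set" where
  "ord_coset S X i f = {h + f | h. h \<in> fps_supp (ipow S X (Suc i))}"

definition gr_elt :: "nat set \<Rightarrow> nat set \<Rightarrow> 'k::field poly \<Rightarrow> nat \<Rightarrow> 'k fps set" where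
  "gr_elt S X p = (\<lambda>i. ord_coset S X i (ord_part S X i p))"

definition poly_supp :: "nat set \<Rightarrow> 'k::field poly set" where
  "poly_supp X = {p. \<forall>n. coeff p n \<noteq> 0 \<longrightarrow> n \<in> X}"

definition gr_mult :: "nat set \<Rightarrow> nat set \<Rightarrow> 'k::field poly \<Rightarrow> 'k poly \<Rightarrow> 'k poly" where
  "gr_mult S X a p = Abs_poly (\<lambda>x. \<Sum>s\<le>x.
     if s \<in> S \<and> x - s \<in> X \<and> sg_val S S s + sg_val S X (x - s) = sg_val S X x
     then coeff a s * coeff p (x - s) else 0)"

text \<open>Beyond \<open>degree a + degree p\<close> all terms vanish, which is the finiteness that
  \<open>Abs_poly\<close> requires.\<close>

lemma coeff_gr_mult: "coeff (gr_mult S X a p) x = (\<Sum>s\<le>x.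
     if s \<in> S \<and> x - s \<in> X \<and> sg_val S S s + sg_val S X (x - s) = sg_val S X x
     then coeff a s * coeff p (x - s) else 0)"
proof -
  have "(\<Sum>s\<le>x. if s \<in> S \<and> x - s \<in> X \<and> sg_val S S s + sg_val S X (x - s) = sg_val S X x
     then coeff a s * coeff p (x - s) else 0) = 0" if "x > degree a + degree p" for x
  proof (intro sum.neutral ballI)
    fix s assume "s \<in> {..x}"
    have "coeff a s * coeff p (x - s) = 0"
    proof (cases "s > degree a")
      case False
      then have "x - s > degree p" using that by linarith
      then show ?thesis by (simp add: coeff_eq_0)
    qed (simp add: coeff_eq_0)
    then show "(if s \<in> S \<and> x - s \<in> X \<and> sg_val S S s + sg_val S X (x - s) = sg_val S X x
     then coeff a s * coeff p (x - s) else 0) = 0" by simp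
  qed
  then show ?thesis unfolding gr_mult_def by (subst coeff_Abs_poly) auto
qed

lemma fps_decompose:
  fixes f :: "'k::field fps"
  assumes "m > 0"
  shows "f = (\<Sum>i<m. Abs_fps (\<lambda>n. if n mod m = i then fps_nth f n else 0))"
proof (rule fps_ext)
  fix n
  have "fps_nth (\<Sum>i<m. Abs_fps (\<lambda>n. if n mod m = i then fps_nth f n else 0)) n =
    (\<Sum>i<m. if n mod m = i then fps_nth f n else 0)" by (simp add: fps_sum_nth)
  also have "\<dots> = fps_nth f n" using assms by (simp add: sum.delta)
  finally show "fps_nth f n = fps_nth (\<Sum>i<m. Abs_fps (\<lambda>n. if n mod m = i then fps_nth f n else 0)) n" ..
qed

section \<open>The semigroup ring, monomial ideals and their adic powers\<close>

context num_semigroup begin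

abbreviation R :: "'k::field fps ring" where "R \<equiv> semigroup_ring S"

abbreviation J :: "'k::field fps set" where "J \<equiv> fps_supp (S - {0})"

lemma S_plus_S: "S + S = S"
  using add_mem zero_mem by (auto elim!: set_plus_elim) (metis add_0 set_plus_intro)

lemma R_cring: "cring (R :: 'k::field fps ring)"
proof (rule cringI)
  show "abelian_group (R :: 'k fps ring)"
  proof (rule abelian_groupI)
    show "\<exists>y\<in>carrier R. y \<oplus>\<^bsub>R\<^esub> x = \<zero>\<^bsub>R\<^esub>" if "x \<in> carrier R" for x :: "'k fps"
      using that fps_supp_uminus by (intro bexI[of _ "- x"]) auto
  qed (auto simp: fps_supp_add ac_simps)
  show "Group.comm_monoid (R :: 'k fps ring)"
  proof (rule comm_monoidI)
    show "f \<otimes>\<^bsub>R\<^esub> g \<in> carrier R" if "f \<in> carrier R" "g \<in> carrier R" for f g :: "'k fps"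
      using that fps_supp_mult[of f S g S] by (simp add: S_plus_S)
    show "\<one>\<^bsub>R\<^esub> \<in> carrier (R :: 'k fps ring)" using zero_mem fps_X_power_supp[of 0 S] by simp
  qed (auto simp: ac_simps)
qed (auto simp: distrib_right)

end

context num_ideal begin

abbreviation Mo :: "('k::field fps, 'k fps) module" where "Mo \<equiv> ideal_module R (fps_supp X)"

lemma S_plus_X: "S + X = X"
  using X_add zero_mem by (auto elim!: set_plus_elim) (metis add_0 set_plus_intro)

lemma fps_supp_smult: "f \<in> fps_supp S \<Longrightarrow> g \<in> fps_supp X \<Longrightarrow> f * g \<in> fps_supp X"
  using fps_supp_mult[of f S g X] by (simp add: S_plus_X)

lemma Mo_module: "Module.module R (Mo :: ('k::field fps, 'k fps) module)"
proof (rule moduleI)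
  show "abelian_group (Mo :: ('k fps, 'k fps) module)"
  proof (rule abelian_groupI)
    show "\<exists>y\<in>carrier Mo. y \<oplus>\<^bsub>Mo\<^esub> x = \<zero>\<^bsub>Mo\<^esub>" if "x \<in> carrier Mo" for x :: "'k fps"
      using that fps_supp_uminus by (intro bexI[of _ "- x"]) auto
  qed (auto simp: fps_supp_add ac_simps)
qed (auto simp: R_cring fps_supp_smult algebra_simps)

text \<open>Ideals and submodules are closed under finite sums only, while a series may have
  infinitely many terms. Splitting by residues modulo \<open>m\<close> leaves finitely many pieces,
  and the piece for \<open>i\<close> is t^\<alpha> times a series supported on multiples of
  \<open>m\<close>, which belongs to the ring.\<close>

lemma fps_supp_subset:
  fixes H :: "'k::field fps set"
  assumes "0 \<in> H" and add: "\<And>f g. f \<in> H \<Longrightarrow> g \<in> H \<Longrightarrow> f + g \<in> H"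
    and mono: "\<And>x g. x \<in> X \<Longrightarrow> g \<in> fps_supp S \<Longrightarrow> fps_X ^ x * g \<in> H"
  shows "fps_supp X \<subseteq> H"
proof
  fix f :: "'k fps" assume f: "f \<in> fps_supp X"
  have sum: "(\<Sum>i\<in>A. g i) \<in> H" if "\<And>i. i \<in> A \<Longrightarrow> g i \<in> H" for A :: "nat set" and g
    using that by (induction A rule: infinite_finite_induct) (auto intro: assms(1) add)
  have "Abs_fps (\<lambda>n. if n mod m = i then fps_nth f n else 0) \<in> H" if "i < m" for i
  proof -
    let ?\<alpha> = "sg_alpha S X i"
    let ?g = "Abs_fps (\<lambda>n. if (?\<alpha> + n) mod m = i then fps_nth f (?\<alpha> + n) else 0)"
    have cong: "[n = i] (mod m) \<longleftrightarrow> n mod m = i" for n using that by (simp add: cong_def)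
    have "Abs_fps (\<lambda>n. if n mod m = i then fps_nth f n else 0) = fps_X ^ ?\<alpha> * ?g"
    proof (rule fps_ext)
      fix n
      have "fps_nth f n = 0" if "n mod m = i" "n < ?\<alpha>"
        using alpha_le[of n i] that f cong by (force simp: fps_supp_def)
      then show "fps_nth (Abs_fps (\<lambda>n. if n mod m = i then fps_nth f n else 0)) n = fps_nth (fps_X ^ ?\<alpha> * ?g) n"
        by (auto simp: fps_X_power_mult_nth)
    qed
    moreover have "?g \<in> fps_supp S"
      unfolding fps_supp_def
    proof (intro CollectI allI impI)
      fix n assume "fps_nth ?g n \<noteq> 0"
      then have "?\<alpha> + n \<in> X" "(?\<alpha> + n) mod m = i" using f by (auto simp: fps_supp_def split: if_splits)
      then obtain j where "?\<alpha> + n = ?\<alpha> + j * m" using ex_alpha[of "?\<alpha> + n" i] cong by blast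
      then show "n \<in> S" using mult_m_mem by simp
    qed
    ultimately show ?thesis using mono[OF alpha_mem(1), of ?g i] by simp
  qed
  then have "(\<Sum>i<m. Abs_fps (\<lambda>n. if n mod m = i then fps_nth f n else 0)) \<in> H" by (intro sum) auto
  then show "f \<in> H" by (simp only: fps_decompose[OF m_pos, of f, symmetric])
qed

end

context num_ideal begin

text \<open>Computes both the maximal ideal, with all of \<open>S - {0}\<close> as \<open>T\<close>,
  and I, with the given generators as \<open>T\<close>.\<close>

lemma genideal_monomials:
  assumes T: "T \<subseteq> X" "\<And>x. x \<in> X \<Longrightarrow> \<exists>t\<in>T. \<exists>s\<in>S. x = t + s"
  shows "Idl\<^bsub>R\<^esub> {fps_X ^ t | t. t \<in> T} = (fps_supp X :: 'k::field fps set)"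
proof
  interpret R: cring "R :: 'k fps ring" by (rule R_cring)
  have sub: "{fps_X ^ t | t. t \<in> T} \<subseteq> (fps_supp X :: 'k fps set)" using T(1) by auto
  have XS: "fps_supp X \<subseteq> (fps_supp S :: 'k fps set)" by (rule fps_supp_mono[OF X_sub])
  have "ideal (fps_supp X :: 'k fps set) R"
    by (rule R.ideal_cringI) (use XS in \<open>auto simp: fps_supp_add fps_supp_smult\<close>)
  then show "Idl\<^bsub>R\<^esub> {fps_X ^ t | t. t \<in> T} \<subseteq> (fps_supp X :: 'k fps set)"
    using sub by (rule R.genideal_minimal)
  have carr: "{fps_X ^ t | t. t \<in> T} \<subseteq> carrier (R :: 'k fps ring)" using sub XS by auto
  interpret I: ideal "Idl\<^bsub>R\<^esub> {fps_X ^ t | t. t \<in> T}" "R :: 'k fps ring"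
    by (rule R.genideal_ideal[OF carr])
  show "(fps_supp X :: 'k fps set) \<subseteq> Idl\<^bsub>R\<^esub> {fps_X ^ t | t. t \<in> T}"
  proof (rule fps_supp_subset)
    show "0 \<in> Idl\<^bsub>R\<^esub> {fps_X ^ t :: 'k fps | t. t \<in> T}"
      using additive_subgroup.zero_closed[OF I.is_additive_subgroup] by simp
    show "f + g \<in> Idl\<^bsub>R\<^esub> {fps_X ^ t | t. t \<in> T}"
      if "f \<in> Idl\<^bsub>R\<^esub> {fps_X ^ t | t. t \<in> T}" "g \<in> Idl\<^bsub>R\<^esub> {fps_X ^ t | t. t \<in> T}" for f g :: "'k fps"
      using additive_subgroup.a_closed[OF I.is_additive_subgroup that] by simp
    fix x and g :: "'k fps" assume "x \<in> X" and g: "g \<in> fps_supp S"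
    then obtain t s where t: "t \<in> T" "s \<in> S" "x = t + s" using T(2) by blast
    have "fps_X ^ t \<in> Idl\<^bsub>R\<^esub> {fps_X ^ t :: 'k fps | t. t \<in> T}" using R.genideal_self[OF carr] t(1) by blast
    moreover have "fps_X ^ s * g \<in> carrier R" using self.fps_supp_smult[OF _ g] t(2) by simp
    ultimately have "fps_X ^ t * (fps_X ^ s * g) \<in> Idl\<^bsub>R\<^esub> {fps_X ^ t | t. t \<in> T}"
      using I.I_r_closed by fastforce
    then show "fps_X ^ x * g \<in> Idl\<^bsub>R\<^esub> {fps_X ^ t | t. t \<in> T}" using t(3) by (simp add: power_add mult.assoc)
  qed
qed

lemma D_ideal: "num_ideal S m (D l)"
  by unfold_locales (rule ipow_ideal)

text \<open>Each level D(i + 1) is spanned by monomials t^(a + y) with a in M and y in D(i), and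
  these are products of an element of the maximal ideal with one of the previous power.\<close>

lemma adic_power_eq: "adic_power R J Mo i = (fps_supp (D i) :: 'k::field fps set)"
proof (induction i)
  case 0
  then show ?case by simp
next
  case (Suc i)
  interpret M: Module.module R "Mo :: ('k fps, 'k fps) module" by (rule Mo_module)
  interpret Y: num_ideal S m "D i" by (rule D_ideal)
  interpret Z: num_ideal S m "D (Suc i)" by (rule D_ideal)
  let ?P = "{a \<odot>\<^bsub>Mo\<^esub> x | a x. a \<in> J \<and> x \<in> fps_supp (D i)} :: 'k fps set"
  have sub: "?P \<subseteq> fps_supp (D (Suc i))" using fps_supp_mult by auto
  have "submodule (fps_supp (D (Suc i)) :: 'k fps set) R Mo"
  proof (rule M.submoduleI)
    show c: "fps_supp (D (Suc i)) \<subseteq> carrier (Mo :: ('k fps, 'k fps) module)"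
      using fps_supp_mono[OF ipow_sub_X[of "Suc i"]] by simp
    show "\<ominus>\<^bsub>Mo\<^esub> a \<in> fps_supp (D (Suc i))" if "a \<in> fps_supp (D (Suc i))" for a :: "'k fps"
    proof -
      have ac: "a \<in> carrier Mo" using that c by blast
      have "\<ominus>\<^bsub>Mo\<^esub> a + a = 0" using M.l_neg[OF ac] by simp
      then have "\<ominus>\<^bsub>Mo\<^esub> a = - a" by (simp add: eq_neg_iff_add_eq_0)
      then show ?thesis using that fps_supp_uminus by simp
    qed
  qed (auto simp: fps_supp_add Z.fps_supp_smult simp del: ipow.simps)
  then have "submodule_span R Mo ?P \<subseteq> fps_supp (D (Suc i))"
    using sub unfolding submodule_span_def by blast
  moreover have "fps_supp (D (Suc i)) \<subseteq> submodule_span R Mo ?P"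
    unfolding submodule_span_def
  proof (rule Inter_greatest, elim CollectE conjE)
    fix H assume H: "submodule H R (Mo :: ('k fps, 'k fps) module)" "?P \<subseteq> H"
    interpret H: submodule H R "Mo :: ('k fps, 'k fps) module" by fact
    show "fps_supp (D (Suc i)) \<subseteq> H"
    proof (rule Z.fps_supp_subset)
      show "0 \<in> H" using H.one_closed by simp
      show "f + g \<in> H" if "f \<in> H" "g \<in> H" for f g using H.m_closed[OF that] by simp
      fix x and g :: "'k fps" assume "x \<in> D (Suc i)" "g \<in> fps_supp S"
      then obtain a y where "x = a + y" "a \<in> S" "a \<noteq> 0" "y \<in> D i" by (elim ipow_SucE)
      then have "fps_X ^ x * g = fps_X ^ a \<odot>\<^bsub>Mo\<^esub> (g * fps_X ^ y)" "g * fps_X ^ y \<in> fps_supp (D i)" "fps_X ^ a \<in> (J :: 'k fps set)"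
        using Y.fps_supp_smult[OF \<open>g \<in> _\<close>, of "fps_X ^ y"] by (simp_all add: power_add ac_simps)
      then show "fps_X ^ x * g \<in> H" using H(2) by blast
    qed
  qed
  ultimately show ?case using Suc by (simp add: ideal_smult_def del: ipow.simps)
qed

section \<open>The graded components and their elements\<close>

abbreviation comp :: "nat \<Rightarrow> ('k::field fps, 'k fps set) module" where "comp i \<equiv> gr_component R J Mo i"

lemma comp_eq: "comp i = quot_module (ideal_module R (fps_supp (D i))) (fps_supp (D (Suc i)))"
  by (simp only: gr_component_def adic_power_eq ideal_module_simps)

lemma coset_eq: "fps_supp (D (Suc i)) +>\<^bsub>ideal_module R Y\<^esub> f = ord_coset S X i f"
  unfolding a_r_coset_def' ord_coset_def by auto

lemma comp_carrier: "carrier (comp i) = ord_coset S X i ` (fps_supp (D i) :: 'k::field fps set)"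
proof -
  have "carrier (comp i) = (\<Union>a\<in>fps_supp (D i). {fps_supp (D (Suc i)) +>\<^bsub>ideal_module R (fps_supp (D i))\<^esub> (a :: 'k fps)})"
    unfolding comp_eq quot_module_def by (simp add: A_RCOSETS_def' del: ipow.simps)
  then show ?thesis unfolding coset_eq by auto
qed

lemma comp_zero: "\<zero>\<^bsub>comp i\<^esub> = ord_coset S X i (0 :: 'k::field fps)"
  unfolding comp_eq by (simp add: quot_module_def ord_coset_def)

lemma comp_add: "ord_coset S X i f \<oplus>\<^bsub>comp i\<^esub> ord_coset S X i g = ord_coset S X i (f + g :: 'k::field fps)"
proof -
  have "ord_coset S X i f \<oplus>\<^bsub>comp i\<^esub> ord_coset S X i g = {a + b | a b. a \<in> ord_coset S X i f \<and> b \<in> ord_coset S X i g}"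
    unfolding comp_eq by (auto simp: quot_module_def set_add_def')
  also have "\<dots> = ord_coset S X i (f + g)"
  proof (intro equalityI subsetI)
    fix z assume "z \<in> {a + b | a b. a \<in> ord_coset S X i f \<and> b \<in> ord_coset S X i g}"
    then obtain h h' where h: "z = (h + f) + (h' + g)" "h \<in> fps_supp (D (Suc i))" "h' \<in> fps_supp (D (Suc i))"
      unfolding ord_coset_def by blast
    then have "z = (h + h') + (f + g)" "h + h' \<in> fps_supp (D (Suc i))"
      using fps_supp_add[OF h(2,3)] by (simp_all add: ac_simps)
    then show "z \<in> ord_coset S X i (f + g)" unfolding ord_coset_def by blast
  next
    fix z assume "z \<in> ord_coset S X i (f + g)"
    then obtain h where h: "z = h + (f + g)" "h \<in> fps_supp (D (Suc i))" unfolding ord_coset_def by blast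
    then have "z = (h + f) + (0 + g)" by (simp add: ac_simps)
    then show "z \<in> {a + b | a b. a \<in> ord_coset S X i f \<and> b \<in> ord_coset S X i g}"
      using h(2) fps_supp_zero unfolding ord_coset_def by blast
  qed
  finally show ?thesis .
qed

lemma ord_coset_eq_iff: "ord_coset S X i f = ord_coset S X i g \<longleftrightarrow> f - g \<in> fps_supp (D (Suc i))"
proof
  assume "ord_coset S X i f = ord_coset S X i g"
  moreover have "0 + f \<in> ord_coset S X i f" unfolding ord_coset_def using fps_supp_zero by blast
  ultimately show "f - g \<in> fps_supp (D (Suc i))" unfolding ord_coset_def by auto
next
  have *: "ord_coset S X i f \<subseteq> ord_coset S X i g" if "f - g \<in> fps_supp (D (Suc i))" for f g
  proof
    fix z assume "z \<in> ord_coset S X i f"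
    then obtain h where h: "z = h + f" "h \<in> fps_supp (D (Suc i))" unfolding ord_coset_def by blast
    then have "z = (h + (f - g)) + g" by simp
    then show "z \<in> ord_coset S X i g" unfolding ord_coset_def using fps_supp_add[OF h(2) that] by blast
  qed
  assume d: "f - g \<in> fps_supp (D (Suc i))"
  then have "g - f \<in> fps_supp (D (Suc i))" using fps_supp_uminus[OF d] by simp
  then show "ord_coset S X i f = ord_coset S X i g" using * d by blast
qed

lemma comp_abelian_monoid: "abelian_monoid (comp i :: ('k::field fps, 'k fps set) module)"
  by (rule abelian_monoidI) (auto simp: comp_carrier comp_add comp_zero fps_supp_add ac_simps)

lemma comp_finsum:
  fixes y :: "nat \<Rightarrow> 'k::field fps"
  assumes "finite A" "\<And>i. i \<in> A \<Longrightarrow> y i \<in> fps_supp (D n)"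
  shows "finsum (comp n) (\<lambda>i. ord_coset S X n (y i)) A = ord_coset S X n (\<Sum>i\<in>A. y i)"
proof -
  interpret C: abelian_monoid "comp n :: ('k fps, 'k fps set) module" by (rule comp_abelian_monoid)
  show ?thesis using assms
  proof (induction A)
    case empty
    then show ?case by (simp add: comp_zero)
  next
    case (insert a A)
    have "(\<lambda>i. ord_coset S X n (y i)) \<in> A \<rightarrow> carrier (comp n)"
      using insert.prems by (auto simp: comp_carrier)
    moreover have "ord_coset S X n (y a) \<in> carrier (comp n)" using insert.prems by (auto simp: comp_carrier)
    ultimately show ?case using insert by (simp add: C.finsum_insert comp_add)
  qed
qed

lemma ipow_plus_subset: "ipow S S k + D l \<subseteq> D (k + l)"
  using ipow_plus by (auto elim!: set_plus_elim)

text \<open>Changing a representative of either factor changes the product by a term one level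
  deeper, so all cosets in the union agree.\<close>

lemma gr_hom_smult_coset:
  fixes a b :: "'k::field fps"
  assumes i: "i \<le> n" and a: "a \<in> fps_supp (ipow S S i)" and b: "b \<in> fps_supp (D (n - i))"
  shows "gr_hom_smult R J Mo n (ord_coset S S i a) (ord_coset S X (n - i) b) = ord_coset S X n (a * b)"
proof -
  note plus = ipow_plus_subset
  have eq: "ord_coset S X n (a' * b') = ord_coset S X n (a * b)"
    if a': "a' \<in> ord_coset S S i a" and b': "b' \<in> ord_coset S X (n - i) b" for a' b'
  proof -
    obtain h h' where h: "a' = h + a" "h \<in> fps_supp (ipow S S (Suc i))" "b' = h' + b" "h' \<in> fps_supp (D (Suc (n - i)))"
      using a' b' unfolding ord_coset_def by blast
    have b': "b' \<in> fps_supp (D (n - i))"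
      using h(3,4) b fps_supp_mono[OF ipow_Suc_sub] by (metis fps_supp_add subsetD)
    have "h * b' \<in> fps_supp (D (Suc i + (n - i)))"
      using fps_supp_mult[OF h(2) b'] fps_supp_mono[OF plus] by blast
    moreover have "a * h' \<in> fps_supp (D (i + Suc (n - i)))"
      using fps_supp_mult[OF a h(4)] fps_supp_mono[OF plus] by blast
    ultimately have "h * b' + a * h' \<in> fps_supp (D (Suc n))" using i by (intro fps_supp_add) (simp_all del: ipow.simps)
    moreover have "a' * b' - a * b = h * b' + a * h'" using h by (simp add: algebra_simps)
    ultimately show ?thesis by (simp add: ord_coset_eq_iff del: ipow.simps)
  qed
  have ne: "a \<in> ord_coset S S i a" "b \<in> ord_coset S X (n - i) b"
    unfolding ord_coset_def using fps_supp_zero by force+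
  have "gr_hom_smult R J Mo n (ord_coset S S i a) (ord_coset S X (n - i) b) =
    (\<Union>a'\<in>ord_coset S S i a. \<Union>b'\<in>ord_coset S X (n - i) b. ord_coset S X n (a' * b'))"
    unfolding gr_hom_smult_def adic_power_eq coset_eq by simp
  also have "\<dots> = (\<Union>a'\<in>ord_coset S S i a. \<Union>b'\<in>ord_coset S X (n - i) b. ord_coset S X n (a * b))"
    using eq by (intro SUP_cong refl) auto
  also have "\<dots> = ord_coset S X n (a * b)" using ne by blast
  finally show ?thesis .
qed

abbreviation GM :: "(nat \<Rightarrow> 'k::field fps set, nat \<Rightarrow> 'k fps set) module" where "GM \<equiv> gr_module R J Mo"

lemma ord_part_supp: "ord_part S X i p \<in> fps_supp (D i)"
  by (auto simp: fps_supp_def ord_part_def mem_ipow_iff)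

text \<open>Each graded component is finite-dimensional; together with finitely many nonzero
  components this gives finitely many coefficients, hence a polynomial.\<close>

lemma finite_val: "finite {x \<in> X. v x = i}"
proof (rule finite_subset)
  show "{x \<in> X. v x = i} \<subseteq> - D (Suc i)" by (auto simp: mem_ipow_iff' simp del: ipow.simps)
  show "finite (- D (Suc i))" by (rule num_ideal.cofinite_ideal[OF D_ideal])
qed

lemma GM_carrier: "carrier (GM :: (nat \<Rightarrow> 'k::field fps set, nat \<Rightarrow> 'k fps set) module) =
    {f. (\<forall>i. f i \<in> ord_coset S X i ` fps_supp (D i)) \<and> finite {i. f i \<noteq> ord_coset S X i 0}}"
  by (simp add: gr_module_def comp_carrier comp_zero)

lemma gr_elt_carrier: "gr_elt S X p \<in> carrier GM"
proof -
  have "{i. ord_coset S X i (ord_part S X i p) \<noteq> ord_coset S X i 0} \<subseteq> v ` {..degree p}"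
  proof
    fix i assume "i \<in> {i. ord_coset S X i (ord_part S X i p) \<noteq> ord_coset S X i 0}"
    then have "ord_part S X i p \<noteq> 0" by auto
    then obtain x where "coeff p x \<noteq> 0" "v x = i" 
      unfolding fps_eq_iff by (auto simp: ord_part_def split: if_splits)
    then show "i \<in> v ` {..degree p}" using le_degree[of p x] by auto
  qed
  then have "finite {i. ord_coset S X i (ord_part S X i p) \<noteq> ord_coset S X i 0}"
    by (rule finite_subset) simp
  then show ?thesis unfolding GM_carrier gr_elt_def using ord_part_supp by blast
qed

lemma gr_elt_surj:
  fixes f :: "nat \<Rightarrow> 'k::field fps set"
  assumes "f \<in> carrier GM"
  obtains p where "p \<in> poly_supp X" "f = gr_elt S X p"
proof -
  have "\<forall>i. \<exists>y. y \<in> fps_supp (D i) \<and> f i = ord_coset S X i y" and fin: "finite {i. f i \<noteq> ord_coset S X i 0}"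
    using assms unfolding GM_carrier by auto
  then obtain y where y: "\<And>i. y i \<in> fps_supp (D i)" "\<And>i. f i = ord_coset S X i (y i)" by metis
  \<comment> \<open>The exponent \<open>x\<close> carries information only in degree
    \<open>v x\<close>: in lower degrees t^x is zero modulo the next level, and in higher degrees it
    does not occur.\<close>
  define c where "c x = (if x \<in> X then fps_nth (y (v x)) x else 0)" for x
  have "{x. c x \<noteq> 0} \<subseteq> (\<Union>i\<in>{i. f i \<noteq> ord_coset S X i 0}. {x \<in> X. v x = i})"
  proof
    fix x assume "x \<in> {x. c x \<noteq> 0}"
    then have x: "x \<in> X" "fps_nth (y (v x)) x \<noteq> 0" by (auto simp: c_def split: if_splits)
    have "x \<notin> D (Suc (v x))" using x(1) by (simp add: mem_ipow_iff' del: ipow.simps)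
    then have "y (v x) \<notin> fps_supp (D (Suc (v x)))" using x(2) by (auto simp: fps_supp_def simp del: ipow.simps)
    then have "f (v x) \<noteq> ord_coset S X (v x) 0" by (simp add: y(2) ord_coset_eq_iff del: ipow.simps)
    then show "x \<in> (\<Union>i\<in>{i. f i \<noteq> ord_coset S X i 0}. {x \<in> X. v x = i})" using x(1) by blast
  qed
  then have "finite {x. c x \<noteq> 0}" by (rule finite_subset) (use fin finite_val in auto)
  then have "\<forall>\<^sub>\<infinity>n. c n = 0" by (simp add: eventually_cofinite)
  then have cp: "coeff (Abs_poly c) x = c x" for x by (simp add: Abs_poly_inverse)
  show ?thesis
  proof (rule that)
    show "Abs_poly c \<in> poly_supp X" by (auto simp: poly_supp_def cp c_def split: if_splits)
    show "f = gr_elt S X (Abs_poly c)"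
    proof
      fix i
      have "y i - ord_part S X i (Abs_poly c) \<in> fps_supp (D (Suc i))"
        unfolding fps_supp_def
      proof (intro CollectI allI impI)
        fix x assume nz: "fps_nth (y i - ord_part S X i (Abs_poly c)) x \<noteq> 0"
        show "x \<in> D (Suc i)"
        proof (cases "x \<in> X \<and> v x = i")
          case True
          then show ?thesis using nz by (simp add: ord_part_def cp c_def)
        next
          case False
          then have "fps_nth (y i) x \<noteq> 0" using nz by (auto simp: ord_part_def)
          then have "x \<in> D i" using y(1) by (auto simp: fps_supp_def)
          then show ?thesis using False by (auto simp: mem_ipow_iff' simp del: ipow.simps)
        qed
      qed
      then show "f i = gr_elt S X (Abs_poly c) i" by (simp add: gr_elt_def y(2) ord_coset_eq_iff del: ipow.simps)
    qed
  qed
qed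

lemma gr_elt_inj:
  assumes "p \<in> poly_supp X" "q \<in> poly_supp X" "gr_elt S X p = gr_elt S X q"
  shows "p = q"
proof (rule poly_eqI)
  fix x
  show "coeff p x = coeff q x"
  proof (cases "x \<in> X")
    case True
    have "ord_coset S X (v x) (ord_part S X (v x) p) = ord_coset S X (v x) (ord_part S X (v x) q)"
      using assms(3) unfolding gr_elt_def by metis
    then have "ord_part S X (v x) p - ord_part S X (v x) q \<in> fps_supp (D (Suc (v x)))"
      by (simp only: ord_coset_eq_iff)
    moreover have "x \<notin> D (Suc (v x))" using True by (simp add: mem_ipow_iff' del: ipow.simps)
    ultimately have "fps_nth (ord_part S X (v x) p - ord_part S X (v x) q) x = 0"
      by (auto simp: fps_supp_def simp del: ipow.simps)
    then show ?thesis using True by (simp add: ord_part_def)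
  next
    case False
    then have "coeff p x = 0" "coeff q x = 0" using assms(1,2) unfolding poly_supp_def by blast+
    then show ?thesis by simp
  qed
qed

lemma gr_elt_zero: "\<zero>\<^bsub>GM\<^esub> = gr_elt S X (0 :: 'k::field poly)"
proof -
  have "ord_part S X i 0 = (0 :: 'k fps)" for i by (rule fps_ext) (simp add: ord_part_def)
  then show ?thesis by (simp add: gr_module_def comp_zero gr_elt_def)
qed

lemma gr_elt_add: "gr_elt S X p \<oplus>\<^bsub>GM\<^esub> gr_elt S X q = gr_elt S X (p + q)"
proof -
  have "ord_part S X i (p + q) = ord_part S X i p + ord_part S X i q" for i
    by (rule fps_ext) (simp add: ord_part_def)
  then show ?thesis by (simp add: gr_module_def comp_add gr_elt_def)
qed

end

context num_ideal begin

lemma ord_part_mult_supp: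
  assumes "i \<le> n"
  shows "ord_part S S i a * ord_part S X (n - i) p \<in> fps_supp (D n)"
proof -
  have "ord_part S S i a * ord_part S X (n - i) p \<in> fps_supp (ipow S S i + D (n - i))"
    by (intro fps_supp_mult self.ord_part_supp ord_part_supp)
  then show ?thesis using fps_supp_mono[OF ipow_plus_subset[of i "n - i"]] assms by auto
qed

text \<open>Modulo the next level only exponents \<open>x\<close> with \<open>v x = n\<close> count.
  There the pair t^s, t^(x - s) meets in the single summand \<open>i = u s\<close>, and only if the
  two orders add up to \<open>n\<close>.\<close>

lemma ord_part_convolution:
  fixes a p :: "'k::field poly"
  shows "(\<Sum>i\<le>n. ord_part S S i a * ord_part S X (n - i) p) - ord_part S X n (gr_mult S X a p) \<in> fps_supp (D (Suc n))"
    (is "?L - ?R \<in> _")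
  unfolding fps_supp_def
proof (intro CollectI allI impI)
  fix x assume nz: "fps_nth (?L - ?R) x \<noteq> 0"
  have "?L \<in> fps_supp (D n)" by (intro fps_supp_sum ord_part_mult_supp) simp
  then have "?L - ?R \<in> fps_supp (D n)" using ord_part_supp by (intro fps_supp_diff)
  then have x: "x \<in> X" "n \<le> v x" using nz by (auto simp: fps_supp_def mem_ipow_iff')
  show "x \<in> D (Suc n)"
  proof (cases "v x = n")
    case True
    have "fps_nth ?L x = (\<Sum>i\<le>n. \<Sum>s\<le>x. fps_nth (ord_part S S i a) s * fps_nth (ord_part S X (n - i) p) (x - s))"
      by (simp add: fps_sum_nth fps_mult_nth atLeast0AtMost)
    also have "\<dots> = (\<Sum>s\<le>x. \<Sum>i\<le>n. fps_nth (ord_part S S i a) s * fps_nth (ord_part S X (n - i) p) (x - s))"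
      by (rule sum.swap)
    also have "\<dots> = (\<Sum>s\<le>x. if s \<in> S \<and> x - s \<in> X \<and> u s + v (x - s) = n then coeff a s * coeff p (x - s) else 0)"
    proof (rule sum.cong[OF refl])
      fix s
      have "(\<Sum>i\<le>n. fps_nth (ord_part S S i a) s * fps_nth (ord_part S X (n - i) p) (x - s)) =
        (\<Sum>i\<le>n. if i = u s then (if s \<in> S \<and> x - s \<in> X \<and> u s + v (x - s) = n then coeff a s * coeff p (x - s) else 0) else 0)"
        by (rule sum.cong[OF refl]) (auto simp: ord_part_def)
      then show "(\<Sum>i\<le>n. fps_nth (ord_part S S i a) s * fps_nth (ord_part S X (n - i) p) (x - s)) =
        (if s \<in> S \<and> x - s \<in> X \<and> u s + v (x - s) = n then coeff a s * coeff p (x - s) else 0)"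
        by (auto simp: sum.delta)
    qed
    also have "\<dots> = fps_nth ?R x" using True x(1) by (simp add: ord_part_def coeff_gr_mult)
    finally show ?thesis using nz by simp
  next
    case False
    then show ?thesis using x by (simp add: mem_ipow_iff' del: ipow.simps)
  qed
qed

lemma gr_elt_smult:
  fixes a p :: "'k::field poly"
  shows "gr_elt S S a \<odot>\<^bsub>GM\<^esub> gr_elt S X p = gr_elt S X (gr_mult S X a p)"
proof
  fix n
  note supp = ord_part_mult_supp
  interpret C: abelian_monoid "comp n :: ('k fps, 'k fps set) module" by (rule comp_abelian_monoid)
  have "(gr_elt S S a \<odot>\<^bsub>GM\<^esub> gr_elt S X p) n =
    finsum (comp n) (\<lambda>i. gr_hom_smult R J Mo n (ord_coset S S i (ord_part S S i a)) (ord_coset S X (n - i) (ord_part S X (n - i) p))) {..n}"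
    by (simp add: gr_module_def gr_elt_def)
  also have "\<dots> = finsum (comp n) (\<lambda>i. ord_coset S X n (ord_part S S i a * ord_part S X (n - i) p)) {..n}"
    by (rule C.finsum_cong') (use supp in \<open>auto simp: gr_hom_smult_coset self.ord_part_supp ord_part_supp comp_carrier intro!: imageI\<close>)
  also have "\<dots> = ord_coset S X n (\<Sum>i\<le>n. ord_part S S i a * ord_part S X (n - i) p)"
    by (rule comp_finsum) (use supp in auto)
  also have "\<dots> = ord_coset S X n (ord_part S X n (gr_mult S X a p))"
    unfolding ord_coset_eq_iff by (rule ord_part_convolution)
  finally show "(gr_elt S S a \<odot>\<^bsub>GM\<^esub> gr_elt S X p) n = gr_elt S X (gr_mult S X a p) n"
    by (simp add: gr_elt_def)
qed

end

text \<open>The coefficients along an arithmetic progression. With step \<open>m\<close>, starting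
  at 0 gives \<phi> and starting at \<open>x0\<close> gives \<psi>.\<close>

definition subsample :: "nat \<Rightarrow> nat \<Rightarrow> 'k::zero poly \<Rightarrow> 'k poly" where
  "subsample b d p = Abs_poly (\<lambda>j. coeff p (b + j * d))"

lemma coeff_subsample: "d > 0 \<Longrightarrow> coeff (subsample b d p) j = coeff p (b + j * d)"
proof -
  assume d: "d > 0"
  have "coeff p (b + i * d) = 0" if "i > degree p" for i
  proof -
    have "i \<le> i * d" using d by simp
    then show ?thesis using that by (intro coeff_eq_0) linarith
  qed
  then show ?thesis unfolding subsample_def by (subst coeff_Abs_poly) auto
qed

text \<open>The polynomial p(t^d), which for d = m encodes p(T) in gr(R).\<close>

definition dilate :: "nat \<Rightarrow> 'k::zero poly \<Rightarrow> 'k poly" where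
  "dilate d p = Abs_poly (\<lambda>n. if d dvd n then coeff p (n div d) else 0)"

lemma coeff_dilate: "d > 0 \<Longrightarrow> coeff (dilate d p) n = (if d dvd n then coeff p (n div d) else 0)"
proof -
  assume d: "d > 0"
  have "coeff p (i div d) = 0" if "i > degree p * d" "d dvd i" for i
    using that d by (intro coeff_eq_0) (auto elim!: dvdE)
  then show ?thesis unfolding dilate_def
    by (subst coeff_Abs_poly[of "degree p * d"]) auto
qed

lemma subsample_dilate: "d > 0 \<Longrightarrow> subsample 0 d (dilate d p) = p"
  by (rule poly_eqI) (simp add: coeff_subsample coeff_dilate)

section \<open>Laws of the product on encoded elements\<close>

lemma poly_supp_zero [simp]: "0 \<in> poly_supp X"
  and poly_supp_monom: "x \<in> X \<Longrightarrow> monom c x \<in> poly_supp X"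
  by (auto simp: poly_supp_def)

lemma poly_supp_add: "p \<in> poly_supp X \<Longrightarrow> q \<in> poly_supp X \<Longrightarrow> p + q \<in> poly_supp X"
  unfolding poly_supp_def by (auto simp: coeff_add) (metis add_0)

lemma gr_mult_supp_nz:
  assumes "coeff (gr_mult S X a p) x \<noteq> 0"
  obtains s y where "x = s + y" "s \<in> S" "y \<in> X" "sg_val S S s + sg_val S X y = sg_val S X x"
    "coeff a s \<noteq> 0" "coeff p y \<noteq> 0"
proof -
  obtain s where "s \<in> {..x}" "(if s \<in> S \<and> x - s \<in> X \<and> sg_val S S s + sg_val S X (x - s) = sg_val S X x
     then coeff a s * coeff p (x - s) else 0) \<noteq> 0"
    using assms unfolding coeff_gr_mult by (rule sum.not_neutral_contains_not_neutral)
  then show ?thesis using that[of s "x - s"] by (auto split: if_splits)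
qed

lemma gr_mult_add_left: "gr_mult S X (a + b) p = gr_mult S X a p + gr_mult S X b p"
  by (rule poly_eqI) (auto simp: coeff_gr_mult distrib_right simp flip: sum.distrib intro!: sum.cong)

lemma gr_mult_add_right: "gr_mult S X a (p + q) = gr_mult S X a p + gr_mult S X a q"
  by (rule poly_eqI) (auto simp: coeff_gr_mult distrib_left simp flip: sum.distrib intro!: sum.cong)

lemma gr_mult_comm: "gr_mult S S a b = gr_mult S S b a"
proof (rule poly_eqI)
  fix x
  show "coeff (gr_mult S S a b) x = coeff (gr_mult S S b a) x"
    unfolding coeff_gr_mult
    by (rule sum.reindex_bij_witness[of _ "\<lambda>s. x - s" "\<lambda>s. x - s"]) (auto simp: ac_simps)
qed

context num_ideal begin

lemma gr_mult_supp: "gr_mult S X a p \<in> poly_supp X"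
  unfolding poly_supp_def using X_add by (auto elim!: gr_mult_supp_nz)

lemma gr_mult_one: "p \<in> poly_supp X \<Longrightarrow> gr_mult S X 1 p = p"
proof (rule poly_eqI)
  fix x assume p: "p \<in> poly_supp X"
  have "coeff (gr_mult S X 1 p) x = (\<Sum>s\<le>x. if s = 0 then (if x \<in> X then coeff p x else 0) else 0)"
    unfolding coeff_gr_mult by (rule sum.cong) (auto simp: zero_mem u_zero coeff_1)
  also have "\<dots> = coeff p x" using p by (auto simp: sum.delta poly_supp_def)
  finally show "coeff (gr_mult S X 1 p) x = coeff p x" .
qed

text \<open>Both sides sum over s + t + y = x. By superadditivity the order can only grow at each of
  the two multiplications, so both are without gain iff \<open>u s + u t + v y = v x\<close>, a
  condition that ignores the bracketing.\<close>

lemma gr_mult_assoc: "gr_mult S X a (gr_mult S X b p) = gr_mult S X (gr_mult S S a b) p"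
proof (rule poly_eqI)
  fix x
  define F where "F s t y = (if s \<in> S \<and> t \<in> S \<and> y \<in> X \<and> u s + u t + v y = v x
    then coeff a s * coeff b t * coeff p y else 0)" for s t y
  have "coeff (gr_mult S X a (gr_mult S X b p)) x = (\<Sum>s=0..x. \<Sum>t=0..x - s. F s t (x - s - t))"
    unfolding coeff_gr_mult atMost_atLeast0
  proof (rule sum.cong[OF refl])
    fix s assume "s \<in> {0..x}"
    then have s: "s \<le> x" by simp
    have "(if s \<in> S \<and> x - s \<in> X \<and> u s + v (x - s) = v x
        then coeff a s * (\<Sum>t = 0..x - s. if t \<in> S \<and> x - s - t \<in> X \<and> u t + v (x - s - t) = v (x - s)
          then coeff b t * coeff p (x - s - t) else 0) else 0) =
      (\<Sum>t = 0..x - s. if s \<in> S \<and> x - s \<in> X \<and> u s + v (x - s) = v x \<and> 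
          t \<in> S \<and> x - s - t \<in> X \<and> u t + v (x - s - t) = v (x - s)
        then coeff a s * (coeff b t * coeff p (x - s - t)) else 0)"
      by (auto simp: sum_distrib_left intro!: sum.cong)
    also have "\<dots> = (\<Sum>t = 0..x - s. F s t (x - s - t))"
    proof (rule sum.cong[OF refl])
      fix t assume t: "t \<in> {0..x - s}"
      define y where "y = x - s - t"
      have y: "x - s = t + y" "x = s + (t + y)" using s t unfolding y_def by auto
      then have y': "x - s - t = y" by simp
      have "s \<in> S \<and> x - s \<in> X \<and> u s + v (x - s) = v x \<and> t \<in> S \<and> y \<in> X \<and> u t + v y = v (x - s) \<longleftrightarrow>
        s \<in> S \<and> t \<in> S \<and> y \<in> X \<and> u s + u t + v y = v x"
        unfolding y(1) using v_superadd[of t y] v_superadd[of s "t + y"] X_add[of y t] y(2) by auto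
      then show "(if s \<in> S \<and> x - s \<in> X \<and> u s + v (x - s) = v x \<and> 
          t \<in> S \<and> x - s - t \<in> X \<and> u t + v (x - s - t) = v (x - s)
        then coeff a s * (coeff b t * coeff p (x - s - t)) else 0) = F s t (x - s - t)"
        unfolding F_def y' by (simp add: mult.assoc)
    qed
    finally show "(if s \<in> S \<and> x - s \<in> X \<and> u s + v (x - s) = v x
        then coeff a s * (\<Sum>t = 0..x - s. if t \<in> S \<and> x - s - t \<in> X \<and> u t + v (x - s - t) = v (x - s)
          then coeff b t * coeff p (x - s - t) else 0) else 0) = (\<Sum>t = 0..x - s. F s t (x - s - t))" .
  qed
  also have "\<dots> = (\<Sum>w=0..x. \<Sum>s=0..w. F s (w - s) (x - w))"
    by (rule fps_mult_assoc_lemma[symmetric])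
  also have "\<dots> = coeff (gr_mult S X (gr_mult S S a b) p) x"
    unfolding coeff_gr_mult atMost_atLeast0
  proof (rule sum.cong[OF refl], rule sym)
    fix w assume "w \<in> {0..x}"
    then obtain y where y: "x = w + y" using le_Suc_ex[of w x] by auto
    then have y': "x - w = y" by simp
    have "(if w \<in> S \<and> x - w \<in> X \<and> u w + v (x - w) = v x
        then (\<Sum>s = 0..w. if s \<in> S \<and> w - s \<in> S \<and> u s + u (w - s) = u w
          then coeff a s * coeff b (w - s) else 0) * coeff p (x - w) else 0) =
      (\<Sum>s = 0..w. if w \<in> S \<and> x - w \<in> X \<and> u w + v (x - w) = v x \<and>
          s \<in> S \<and> w - s \<in> S \<and> u s + u (w - s) = u w
        then coeff a s * coeff b (w - s) * coeff p (x - w) else 0)"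
      by (auto simp: sum_distrib_right intro!: sum.cong)
    also have "\<dots> = (\<Sum>s = 0..w. F s (w - s) (x - w))"
    proof (rule sum.cong[OF refl])
      fix s assume "s \<in> {0..w}"
      then obtain t where t: "w = s + t" using le_Suc_ex[of s w] by auto
      then have t': "w - s = t" by simp
      have "w \<in> S \<and> y \<in> X \<and> u w + v y = v x \<and> s \<in> S \<and> t \<in> S \<and> u s + u t = u w \<longleftrightarrow>
        s \<in> S \<and> t \<in> S \<and> y \<in> X \<and> u s + u t + v y = v x"
        using v_superadd[of w y] self.v_superadd[of s t] add_mem[of s t] y t by auto
      then show "(if w \<in> S \<and> x - w \<in> X \<and> u w + v (x - w) = v x \<and>
          s \<in> S \<and> w - s \<in> S \<and> u s + u (w - s) = u w
        then coeff a s * coeff b (w - s) * coeff p (x - w) else 0) = F s (w - s) (x - w)"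
        unfolding F_def y' t' by simp
    qed
    finally show "(if w \<in> S \<and> x - w \<in> X \<and> u w + v (x - w) = v x
        then (\<Sum>s = 0..w. if s \<in> S \<and> w - s \<in> S \<and> u s + u (w - s) = u w
          then coeff a s * coeff b (w - s) else 0) * coeff p (x - w) else 0) =
      (\<Sum>s = 0..w. F s (w - s) (x - w))" .
  qed
  finally show "coeff (gr_mult S X a (gr_mult S X b p)) x = coeff (gr_mult S X (gr_mult S S a b) p) x" .
qed

lemma GM_abelian_group: "abelian_group (GM :: (nat \<Rightarrow> 'k::field fps set, nat \<Rightarrow> 'k fps set) module)"
proof (rule abelian_groupI)
  fix f g h :: "nat \<Rightarrow> 'k fps set"
  assume f: "f \<in> carrier GM"
  obtain p where p: "p \<in> poly_supp X" "f = gr_elt S X p" by (rule gr_elt_surj[OF f])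
  show "\<zero>\<^bsub>GM\<^esub> \<oplus>\<^bsub>GM\<^esub> f = f" by (simp add: p gr_elt_zero gr_elt_add)
  show "\<exists>g\<in>carrier GM. g \<oplus>\<^bsub>GM\<^esub> f = \<zero>\<^bsub>GM\<^esub>"
    by (rule bexI[of _ "gr_elt S X (- p)"]) (simp_all add: p gr_elt_zero gr_elt_add gr_elt_carrier)
  assume g: "g \<in> carrier GM"
  obtain q where q: "g = gr_elt S X q" by (rule gr_elt_surj[OF g])
  show "f \<oplus>\<^bsub>GM\<^esub> g \<in> carrier GM" by (simp add: p q gr_elt_add gr_elt_carrier)
  show "f \<oplus>\<^bsub>GM\<^esub> g = g \<oplus>\<^bsub>GM\<^esub> f" by (simp add: p q gr_elt_add add.commute)
  assume h: "h \<in> carrier GM"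
  obtain r where r: "h = gr_elt S X r" by (rule gr_elt_surj[OF h])
  show "f \<oplus>\<^bsub>GM\<^esub> g \<oplus>\<^bsub>GM\<^esub> h = f \<oplus>\<^bsub>GM\<^esub> (g \<oplus>\<^bsub>GM\<^esub> h)" by (simp add: p q r gr_elt_add add.assoc)
qed (simp add: gr_elt_zero gr_elt_carrier)

definition gr_coeffs :: "(nat \<Rightarrow> 'k::field fps set) \<Rightarrow> 'k poly" where
  "gr_coeffs f = (THE p. p \<in> poly_supp X \<and> gr_elt S X p = f)"

lemma gr_coeffs_elt: "p \<in> poly_supp X \<Longrightarrow> gr_coeffs (gr_elt S X p) = p"
  unfolding gr_coeffs_def by (rule the_equality) (auto intro: gr_elt_inj)

end

section \<open>The associated graded ring and its map onto k[T]\<close>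

context num_semigroup begin

abbreviation G :: "(nat \<Rightarrow> 'k::field fps set) ring" where "G \<equiv> gr_ring R J"

lemma self_module_R: "self_module R = ideal_module R (fps_supp S)"
  by (simp add: self_module_eq)

text \<open>Needed for \<open>s = 0\<close>, which gives the unit of the graded ring, and for
  \<open>s = m\<close>, which gives the initial form in statement (2).\<close>

lemma gr_class_monom:
  assumes "s \<in> S"
  shows "gr_class R J (u s) (fps_X ^ s) = gr_elt S S (monom 1 s :: 'k::field poly)"
proof
  fix j
  have coset: "fps_supp (ipow S S (Suc j)) +>\<^bsub>R\<^esub> f = ord_coset S S j f" for f :: "'k fps"
    unfolding a_r_coset_def' ord_coset_def by auto
  have "ord_part S S j (monom 1 s) = (if j = u s then fps_X ^ s else 0 :: 'k fps)"
    by (rule fps_ext) (use assms in \<open>auto simp: ord_part_def fps_X_power_nth\<close>)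
  moreover have "ord_coset S S j 0 = (fps_supp (ipow S S (Suc j)) :: 'k fps set)" by (simp add: ord_coset_def)
  ultimately show "gr_class R J (u s) (fps_X ^ s) j = gr_elt S S (monom 1 s :: 'k poly) j"
    unfolding gr_class_def gr_elt_def self_module_R self.adic_power_eq using coset[of "fps_X ^ s"] by (auto simp del: ipow.simps)
qed

lemma G_simps:
  "carrier (G :: (nat \<Rightarrow> 'k::field fps set) ring) = carrier self.GM" "\<zero>\<^bsub>G\<^esub> = gr_elt S S (0 :: 'k poly)"
  "\<one>\<^bsub>G\<^esub> = gr_elt S S (1 :: 'k poly)"
  "f \<oplus>\<^bsub>G\<^esub> g = f \<oplus>\<^bsub>self.GM\<^esub> (g :: nat \<Rightarrow> 'k fps set)" "f \<otimes>\<^bsub>G\<^esub> g = f \<odot>\<^bsub>self.GM\<^esub> g"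
  using gr_class_monom[OF zero_mem, where ?'k = 'k]
  by (simp_all add: gr_ring_def self_module_R self.gr_elt_zero u_zero)

lemma G_elt:
  assumes "f \<in> carrier (G :: (nat \<Rightarrow> 'k::field fps set) ring)"
  obtains a where "a \<in> poly_supp S" "f = gr_elt S S a"
  using assms self.gr_elt_surj[of f] unfolding G_simps by blast

lemma G_carrier: "gr_elt S S a \<in> carrier G"
  and G_add: "gr_elt S S a \<oplus>\<^bsub>G\<^esub> gr_elt S S b = gr_elt S S (a + b)"
  and G_mult: "gr_elt S S a \<otimes>\<^bsub>G\<^esub> gr_elt S S b = gr_elt S S (gr_mult S S a b)"
  unfolding G_simps by (rule self.gr_elt_carrier self.gr_elt_add self.gr_elt_smult)+

lemma G_cring: "cring (G :: (nat \<Rightarrow> 'k::field fps set) ring)"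
proof (rule cringI)
  show "abelian_group (G :: (nat \<Rightarrow> 'k fps set) ring)"
    unfolding gr_ring_def self_module_R by (rule abelian_group_ring_of_action[OF self.GM_abelian_group])
  show "Group.comm_monoid (G :: (nat \<Rightarrow> 'k fps set) ring)"
  proof (rule comm_monoidI)
    fix f g h :: "nat \<Rightarrow> 'k fps set"
    assume f: "f \<in> carrier G"
    obtain a where a: "a \<in> poly_supp S" "f = gr_elt S S a" by (rule G_elt[OF f])
    show "\<one>\<^bsub>G\<^esub> \<otimes>\<^bsub>G\<^esub> f = f" by (simp add: a G_simps(3) G_mult self.gr_mult_one)
    assume g: "g \<in> carrier G"
    obtain b where b: "g = gr_elt S S b" by (rule G_elt[OF g])
    show "f \<otimes>\<^bsub>G\<^esub> g \<in> carrier G" by (simp add: a b G_mult G_carrier)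
    show "f \<otimes>\<^bsub>G\<^esub> g = g \<otimes>\<^bsub>G\<^esub> f" by (simp add: a b G_mult gr_mult_comm[of S a])
    assume h: "h \<in> carrier G"
    obtain c where c: "h = gr_elt S S c" by (rule G_elt[OF h])
    show "f \<otimes>\<^bsub>G\<^esub> g \<otimes>\<^bsub>G\<^esub> h = f \<otimes>\<^bsub>G\<^esub> (g \<otimes>\<^bsub>G\<^esub> h)" by (simp add: a b c G_mult self.gr_mult_assoc)
  qed (simp add: G_simps(3) G_carrier)
  fix f g h :: "nat \<Rightarrow> 'k fps set"
  assume f: "f \<in> carrier G" and g: "g \<in> carrier G" and h: "h \<in> carrier G"
  obtain a where a: "a \<in> poly_supp S" "f = gr_elt S S a" by (rule G_elt[OF f])
  obtain b where b: "g = gr_elt S S b" by (rule G_elt[OF g])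
  obtain c where c: "h = gr_elt S S c" by (rule G_elt[OF h])
  show "(f \<oplus>\<^bsub>G\<^esub> g) \<otimes>\<^bsub>G\<^esub> h = f \<otimes>\<^bsub>G\<^esub> h \<oplus>\<^bsub>G\<^esub> g \<otimes>\<^bsub>G\<^esub> h"
    by (simp add: a b c G_mult G_add gr_mult_add_left)
qed

text \<open>A weight that is superadditive along nonzero products accumulates in powers. It is
  applied to the excess \<open>s - m * u s\<close>, to get nilpotency, and to \<open>u\<close>
  itself, to see that powers of the irrelevant ideal reach high orders.\<close>

lemma pow_weight:
  fixes a :: "'k::field poly" and w :: "nat \<Rightarrow> nat"
  assumes w: "\<And>s t. s \<in> S \<Longrightarrow> t \<in> S \<Longrightarrow> u s + u t = u (s + t) \<Longrightarrow> w s + w t \<le> w (s + t)"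
    and a: "\<And>s. coeff a s \<noteq> 0 \<Longrightarrow> 1 \<le> w s"
  shows "\<exists>b\<in>poly_supp S. gr_elt S S a [^]\<^bsub>G\<^esub> (k::nat) = gr_elt S S b \<and> (\<forall>s. coeff b s \<noteq> 0 \<longrightarrow> k \<le> w s)"
proof (induction k)
  interpret G: cring "G :: (nat \<Rightarrow> 'k fps set) ring" by (rule G_cring)
  case 0
  show ?case using poly_supp_monom[OF zero_mem, of "1 :: 'k"]
    by (intro bexI[of _ 1]) (simp_all add: G_simps(3))
next
  interpret G: cring "G :: (nat \<Rightarrow> 'k fps set) ring" by (rule G_cring)
  case (Suc k)
  then obtain b where b: "b \<in> poly_supp S" "gr_elt S S a [^]\<^bsub>G\<^esub> k = gr_elt S S b" "\<And>s. coeff b s \<noteq> 0 \<Longrightarrow> k \<le> w s" by blast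
  have "Suc k \<le> w x" if "coeff (gr_mult S S b a) x \<noteq> 0" for x
    using that
  proof (rule gr_mult_supp_nz)
    fix s t assume st: "x = s + t" "s \<in> S" "t \<in> S" "u s + u t = u x" "coeff b s \<noteq> 0" "coeff a t \<noteq> 0"
    then show "Suc k \<le> w x" using w[of s t] b(3)[of s] a[of t] by simp
  qed
  then show ?case using b by (intro bexI[of _ "gr_mult S S b a"]) (simp_all add: G_mult self.gr_mult_supp)
qed

definition gr_phi :: "(nat \<Rightarrow> 'k::field fps set) \<Rightarrow> 'k poly" where
  "gr_phi f = subsample 0 m (self.gr_coeffs f)"

lemma gr_phi_elt: "a \<in> poly_supp S \<Longrightarrow> gr_phi (gr_elt S S a) = subsample 0 m a"
  by (simp add: gr_phi_def self.gr_coeffs_elt)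

end

context num_ideal begin

lemma GM_module: "Module.module G (GM :: (nat \<Rightarrow> 'k::field fps set, nat \<Rightarrow> 'k fps set) module)"
proof (rule moduleI)
  show "cring (G :: (nat \<Rightarrow> 'k fps set) ring)" by (rule G_cring)
  show "abelian_group (GM :: (nat \<Rightarrow> 'k fps set, nat \<Rightarrow> 'k fps set) module)" by (rule GM_abelian_group)
  fix f g x y :: "nat \<Rightarrow> 'k fps set"
  assume x: "x \<in> carrier GM"
  obtain p where p: "p \<in> poly_supp X" "x = gr_elt S X p" by (rule gr_elt_surj[OF x])
  show "\<one>\<^bsub>G\<^esub> \<odot>\<^bsub>GM\<^esub> x = x" using p by (simp add: G_simps(3) gr_elt_smult gr_mult_one)
  assume f: "f \<in> carrier G"
  obtain a where a: "f = gr_elt S S a" by (rule G_elt[OF f])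
  show "f \<odot>\<^bsub>GM\<^esub> x \<in> carrier GM" by (simp add: a p gr_elt_smult gr_elt_carrier)
  { assume g: "g \<in> carrier G"
    obtain b where b: "g = gr_elt S S b" by (rule G_elt[OF g])
    show "(f \<oplus>\<^bsub>G\<^esub> g) \<odot>\<^bsub>GM\<^esub> x = f \<odot>\<^bsub>GM\<^esub> x \<oplus>\<^bsub>GM\<^esub> g \<odot>\<^bsub>GM\<^esub> x"
      by (simp add: a b p G_add gr_elt_smult gr_elt_add gr_mult_add_left)
    show "(f \<otimes>\<^bsub>G\<^esub> g) \<odot>\<^bsub>GM\<^esub> x = f \<odot>\<^bsub>GM\<^esub> (g \<odot>\<^bsub>GM\<^esub> x)"
      by (simp add: a b p G_mult gr_elt_smult gr_mult_assoc) }
  assume y: "y \<in> carrier GM"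
  obtain q where q: "y = gr_elt S X q" by (rule gr_elt_surj[OF y])
  show "f \<odot>\<^bsub>GM\<^esub> (x \<oplus>\<^bsub>GM\<^esub> y) = f \<odot>\<^bsub>GM\<^esub> x \<oplus>\<^bsub>GM\<^esub> f \<odot>\<^bsub>GM\<^esub> y"
    by (simp add: a p q gr_elt_smult gr_elt_add gr_mult_add_right)
qed

text \<open>Orders add up along \<open>s + y = x0 + j m\<close> only if \<open>s\<close> and \<open>y - x0\<close> are multiples of \<open>m\<close>, since
  \<open>m u(s) \<le> s\<close> and \<open>m v(y) + x0 \<le> y\<close>. This makes \<open>p \<mapsto> \<Sum> p(x0 + j m) T^j\<close> multiplicative.\<close>

lemma subsample_gr_mult:
  fixes a p :: "'k::field poly"
  shows "subsample x0 m (gr_mult S X a p) = subsample 0 m a * subsample x0 m p"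
proof (rule poly_eqI)
  fix j
  let ?c = "\<lambda>s. if s \<in> S \<and> x0 + j * m - s \<in> X \<and> u s + v (x0 + j * m - s) = j
     then coeff a s * coeff p (x0 + j * m - s) else 0"
  have "coeff (subsample x0 m (gr_mult S X a p)) j = (\<Sum>s\<le>x0 + j * m. ?c s)"
    using m_pos by (simp add: coeff_subsample coeff_gr_mult v_x0)
  also have "\<dots> = (\<Sum>s\<in>(\<lambda>i. i * m) ` {..j}. ?c s)"
  proof (rule sum.mono_neutral_right)
    have "i * m \<le> x0 + j * m" if "i \<le> j" for i
      by (rule trans_le_add2, rule mult_le_mono1, rule that)
    then show "(\<lambda>i. i * m) ` {..j} \<subseteq> {..x0 + j * m}" by auto
    show "\<forall>s\<in>{..x0 + j * m} - (\<lambda>i. i * m) ` {..j}. ?c s = 0"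
    proof
      fix s assume s: "s \<in> {..x0 + j * m} - (\<lambda>i. i * m) ` {..j}"
      show "?c s = 0"
      proof (rule ccontr)
        assume "?c s \<noteq> 0"
        then have c: "s \<in> S" "x0 + j * m - s \<in> X" "u s + v (x0 + j * m - s) = j" by (auto split: if_splits)
        have "u s * m \<le> s" using self.v_bound[OF c(1)] by (simp add: self_x0)
        moreover have "v (x0 + j * m - s) * m + x0 \<le> x0 + j * m - s" using v_bound[OF c(2)] .
        moreover have "j * m = u s * m + v (x0 + j * m - s) * m" using c(3) by (metis distrib_right)
        ultimately have "s = u s * m" using s by auto
        moreover have "u s \<le> j" using c(3) by simp
        ultimately show False using s by blast
      qed
    qed
  qed simp
  also have "\<dots> = (\<Sum>i\<le>j. ?c (i * m))"
    by (rule sum.reindex[unfolded o_def]) (use m_pos in \<open>auto simp: inj_on_def\<close>)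
  also have "\<dots> = (\<Sum>i\<le>j. coeff a (0 + i * m) * coeff p (x0 + (j - i) * m))"
  proof (rule sum.cong[OF refl])
    fix i assume "i \<in> {..j}"
    then obtain l where l: "j = i + l" using le_Suc_ex[of i j] by auto
    then have "x0 + j * m - i * m = x0 + l * m" by (simp add: distrib_right)
    then show "?c (i * m) = coeff a (0 + i * m) * coeff p (x0 + (j - i) * m)"
      using l by (simp add: mult_m_mem add_mult_m_mem x0_mem u_mult_m v_x0)
  qed
  also have "\<dots> = coeff (subsample 0 m a * subsample x0 m p) j"
    using m_pos by (simp add: coeff_mult coeff_subsample)
  finally show "coeff (subsample x0 m (gr_mult S X a p)) j = coeff (subsample 0 m a * subsample x0 m p) j" .
qed

end

context num_semigroup begin

text \<open>Along a ray \<alpha> + j m the order grows by at least j, so the excess never exceeds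
  \<alpha>; there are only \<open>m\<close> rays.\<close>

lemma excess_bounded: "\<exists>B. \<forall>s\<in>S. s - m * u s \<le> B"
proof (intro exI ballI)
  fix s assume s: "s \<in> S"
  let ?i = "s mod m"
  obtain j where j: "s = sg_alpha S S ?i + j * m" using self.ex_alpha[OF s, of ?i] by (auto simp: cong_def)
  have "u (sg_alpha S S ?i) + j \<le> u s" using self.v_add_mult_m[OF self.alpha_mem(1), of ?i j] j by simp
  then have "j * m \<le> m * u s" by (simp add: mult.commute)
  then have "s - m * u s \<le> sg_alpha S S ?i" using j by linarith
  also have "\<dots> \<le> Max (sg_alpha S S ` {..<m})" using m_pos by (intro Max_ge) auto
  finally show "s - m * u s \<le> Max (sg_alpha S S ` {..<m})" .
qed

text \<open>The excess \<open>s - m u(s)\<close> is additive along nonzero products, bounded, and zero only at multiples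
  of \<open>m\<close>.\<close>

lemma gr_phi_nilpotent:
  fixes a :: "'k::field poly"
  assumes a: "a \<in> poly_supp S" "subsample 0 m a = 0"
  shows "\<exists>n::nat. gr_elt S S a [^]\<^bsub>G\<^esub> n = \<zero>\<^bsub>G\<^esub>"
proof -
  have le: "m * u s \<le> s" if "s \<in> S" for s using self.v_bound[OF that] by (simp add: self_x0 mult.commute)
  obtain B where B: "\<And>s. s \<in> S \<Longrightarrow> s - m * u s \<le> B" using excess_bounded by blast
  have "1 \<le> s - m * u s" if nz: "coeff a s \<noteq> 0" for s
  proof -
    have s: "s \<in> S" using a(1) nz unfolding poly_supp_def by blast
    have "coeff a (j * m) = 0" for j
      using arg_cong[OF a(2), of "\<lambda>p. coeff p j"] m_pos by (simp add: coeff_subsample)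
    then have "s \<noteq> m * u s" using nz by (metis mult.commute)
    then show ?thesis using le[OF s] by simp
  qed
  \<comment> \<open>The exponent \<open>Suc B\<close> pushes the excess of every surviving monomial
    above the bound \<open>B\<close>, so none survives.\<close>
  then obtain b where b: "b \<in> poly_supp S" "gr_elt S S a [^]\<^bsub>G\<^esub> (Suc B) = gr_elt S S b"
    "\<And>s. coeff b s \<noteq> 0 \<Longrightarrow> Suc B \<le> s - m * u s"
  proof -
    have "s - m * u s + (t - m * u t) \<le> s + t - m * u (s + t)"
      if "s \<in> S" "t \<in> S" "u s + u t = u (s + t)" for s t
      using le[OF that(1)] le[OF that(2)] by (simp add: that(3)[symmetric] distrib_left)
    then show ?thesis using pow_weight[of "\<lambda>s. s - m * u s" a "Suc B"] that
      \<open>\<And>s. coeff a s \<noteq> 0 \<Longrightarrow> 1 \<le> s - m * u s\<close> by blast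
  qed
  have "b = 0"
  proof (rule poly_eqI)
    fix s
    show "coeff b s = coeff 0 s"
    proof (rule ccontr)
      assume "coeff b s \<noteq> coeff 0 s"
      then have nz: "coeff b s \<noteq> 0" by simp
      then have "s \<in> S" using b(1) unfolding poly_supp_def by blast
      then show False using b(3)[OF nz] B[of s] by simp
    qed
  qed
  then show ?thesis using b(2) by (metis G_simps(2))
qed

lemma dilate_supp: "dilate m p \<in> poly_supp S"
  using m_pos mult_m_mem by (auto simp: poly_supp_def coeff_dilate elim!: dvdE split: if_splits) (metis mult.commute)

lemma gr_nil_poly: "nil_poly (G :: (nat \<Rightarrow> 'k::field fps set) ring) gr_phi"
proof (intro nil_poly.intro nil_poly_axioms.intro G_cring)
  fix f g :: "nat \<Rightarrow> 'k fps set"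
  assume f: "f \<in> carrier G"
  obtain a where a: "a \<in> poly_supp S" "f = gr_elt S S a" by (rule G_elt[OF f])
  show "\<exists>n::nat. f [^]\<^bsub>G\<^esub> n = \<zero>\<^bsub>G\<^esub>" if "gr_phi f = 0"
    using that gr_phi_nilpotent[OF a(1)] a by (simp add: gr_phi_elt)
  assume g: "g \<in> carrier G"
  obtain b where b: "b \<in> poly_supp S" "g = gr_elt S S b" by (rule G_elt[OF g])
  show "gr_phi (f \<oplus>\<^bsub>G\<^esub> g) = gr_phi f + gr_phi g"
    using a b m_pos by (simp add: G_add gr_phi_elt poly_supp_add) (rule poly_eqI, simp add: coeff_subsample)
  show "gr_phi (f \<otimes>\<^bsub>G\<^esub> g) = gr_phi f * gr_phi g"
    using a b self.subsample_gr_mult[of a b] by (simp add: G_mult gr_phi_elt self.gr_mult_supp self_x0)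
next
  have "(1 :: 'k poly) \<in> poly_supp S" using poly_supp_monom[OF zero_mem, of "1 :: 'k"] by simp
  then show "gr_phi (\<one>\<^bsub>G\<^esub> :: nat \<Rightarrow> 'k fps set) = 1"
    using m_pos by (simp add: G_simps(3) gr_phi_elt) (rule poly_eqI, simp add: coeff_subsample coeff_1)
next
  fix p :: "'k poly"
  have "gr_elt S S (dilate m p) \<in> carrier G" "gr_phi (gr_elt S S (dilate m p)) = p"
    using dilate_supp[of p] m_pos by (simp_all add: G_carrier gr_phi_elt subsample_dilate)
  then show "\<exists>a\<in>carrier G. gr_phi a = p" by blast
qed

end

section \<open>The semilinear map on the graded module and the equivalences\<close>

context num_ideal begin

definition gr_psi :: "(nat \<Rightarrow> 'k::field fps set) \<Rightarrow> 'k poly" where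
  "gr_psi f = subsample x0 m (gr_coeffs f)"

lemma gr_nil_poly_module:
  "nil_poly_module G (GM :: (nat \<Rightarrow> 'k::field fps set, nat \<Rightarrow> 'k fps set) module) gr_phi gr_psi (gr_elt S X (monom 1 x0))"
proof (intro nil_poly_module.intro nil_poly_module_axioms.intro gr_nil_poly GM_module gr_elt_carrier)
  fix f x :: "nat \<Rightarrow> 'k fps set"
  assume f: "f \<in> carrier G" and x: "x \<in> carrier GM"
  obtain a where a: "a \<in> poly_supp S" "f = gr_elt S S a" by (rule G_elt[OF f])
  obtain p where p: "p \<in> poly_supp X" "x = gr_elt S X p" by (rule gr_elt_surj[OF x])
  show "gr_psi (f \<odot>\<^bsub>GM\<^esub> x) = gr_phi f * gr_psi x"
    using a p by (simp add: gr_elt_smult gr_psi_def gr_phi_elt gr_coeffs_elt gr_mult_supp subsample_gr_mult)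
next
  show "gr_psi (gr_elt S X (monom 1 x0) :: nat \<Rightarrow> 'k fps set) = 1"
    unfolding gr_psi_def gr_coeffs_elt[OF poly_supp_monom[OF x0_mem]]
    using m_pos by (intro poly_eqI) (simp add: coeff_subsample coeff_1)
qed

text \<open>So torsion freeness over \<open>k[T]\<close> is inherited from the domain \<open>k[t]\<close>.\<close>

lemma gr_mult_dilate:
  fixes p :: "'k::field poly"
  assumes *: "\<forall>x\<in>X. v (x + m) = v x + 1" and p: "p \<in> poly_supp X"
  shows "gr_mult S X (dilate m q) p = dilate m q * p"
proof (rule poly_eqI)
  fix x
  have v: "v (y + j * m) = v y + j" if "y \<in> X" for y j
  proof (induction j)
    case (Suc j)
    then show ?case using *[rule_format, OF add_mult_m_mem[OF that, of j]] by (simp add: ac_simps)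
  qed simp
  have "(if s \<in> S \<and> x - s \<in> X \<and> u s + v (x - s) = v x then coeff (dilate m q) s * coeff p (x - s) else 0) =
    coeff (dilate m q) s * coeff p (x - s)" if "s \<le> x" for s
  proof (cases "coeff (dilate m q) s * coeff p (x - s) = 0")
    case False
    then have "coeff (dilate m q) s \<noteq> 0" "coeff p (x - s) \<noteq> 0" by auto
    then have "m dvd s" "x - s \<in> X" using m_pos p by (auto simp: coeff_dilate poly_supp_def split: if_splits)
    then obtain j where j: "s = j * m" by (metis dvd_def mult.commute)
    have "v (x - s + j * m) = v (x - s) + j" using v \<open>x - s \<in> X\<close> by blast
    then show ?thesis using j that \<open>x - s \<in> X\<close> by (simp add: mult_m_mem u_mult_m)
  qed auto
  then show "coeff (gr_mult S X (dilate m q) p) x = coeff (dilate m q * p) x"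
    unfolding coeff_gr_mult coeff_mult by (intro sum.cong) auto
qed

lemma dilate_smult_eq_zero:
  fixes q :: "'k::field poly"
  assumes *: "\<forall>x\<in>X. v (x + m) = v x + 1" and q: "q \<noteq> 0"
    and x: "x \<in> carrier GM" "gr_elt S S (dilate m q) \<odot>\<^bsub>GM\<^esub> x = \<zero>\<^bsub>GM\<^esub>"
  shows "x = \<zero>\<^bsub>GM\<^esub>"
proof -
  obtain p where p: "p \<in> poly_supp X" "x = gr_elt S X p" by (rule gr_elt_surj[OF x(1)])
  have "gr_elt S X (dilate m q * p) = gr_elt S X 0"
    using x(2) unfolding p(2) gr_elt_smult gr_mult_dilate[OF * p(1)] gr_elt_zero .
  moreover have "dilate m q * p \<in> poly_supp X" using gr_mult_supp gr_mult_dilate[OF * p(1)] by metis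
  ultimately have "dilate m q * p = 0" by (intro gr_elt_inj) auto
  moreover have "dilate m q \<noteq> 0" using q subsample_dilate[OF m_pos, of q] m_pos
    by (metis coeff_subsample coeff_0 poly_eqI)
  ultimately show ?thesis by (simp add: p(2) gr_elt_zero)
qed

lemma monom_not_zero: "y \<in> X \<Longrightarrow> gr_elt S X (monom 1 y :: 'k::field poly) \<noteq> \<zero>\<^bsub>GM\<^esub>"
  using gr_elt_inj[OF poly_supp_monom, of y 0 "1 :: 'k"] by (auto simp: gr_elt_zero monom_eq_0_iff)

lemma zero_divisor_iff:
  "zero_divisor_on GM (gr_class R J 1 (fps_X ^ m :: 'k::field fps)) \<longleftrightarrow> \<not> (\<forall>x\<in>X. v (x + m) = v x + 1)"
proof -
  have cls: "gr_class R J 1 (fps_X ^ m :: 'k fps) = gr_elt S S (monom 1 m)"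
    using gr_class_monom[OF m_mem] by (simp add: u_m)
  \<comment> \<open>T is the image of the variable of k[T], so torsion freeness covers it as a
    special case.\<close>
  have T: "monom 1 m = dilate m (monom 1 1 :: 'k poly)"
    using m_pos by (intro poly_eqI) (auto simp: coeff_dilate elim!: dvdE)
  show ?thesis
  proof
    assume "zero_divisor_on GM (gr_class R J 1 (fps_X ^ m :: 'k fps))"
    then obtain x :: "nat \<Rightarrow> 'k fps set" where "x \<in> carrier GM" "x \<noteq> \<zero>\<^bsub>GM\<^esub>" "gr_elt S S (monom 1 m) \<odot>\<^bsub>GM\<^esub> x = \<zero>\<^bsub>GM\<^esub>"
      unfolding zero_divisor_on_def cls by blast
    then show "\<not> (\<forall>x\<in>X. v (x + m) = v x + 1)"
      using dilate_smult_eq_zero[of "monom 1 1 :: 'k poly" x] unfolding T by (auto simp: monom_eq_0_iff)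
  next
    assume "\<not> (\<forall>x\<in>X. v (x + m) = v x + 1)"
    then obtain y where y: "y \<in> X" "v (y + m) \<noteq> v y + 1" by blast
    \<comment> \<open>The only possible term is at \<open>y + m\<close>, and the jump of the order
      there removes it.\<close>
    have "gr_mult S X (monom 1 m) (monom 1 y) = (0 :: 'k poly)"
    proof (rule ccontr)
      assume "gr_mult S X (monom 1 m) (monom 1 y) \<noteq> (0 :: 'k poly)"
      then obtain x where "coeff (gr_mult S X (monom 1 m) (monom 1 y :: 'k poly)) x \<noteq> 0"
        by (metis coeff_0 poly_eqI)
      then show False using y(2)
        by (elim gr_mult_supp_nz) (auto simp: u_m add.commute split: if_splits)
    qed
    then have "gr_elt S S (monom 1 m) \<odot>\<^bsub>GM\<^esub> gr_elt S X (monom 1 y) = \<zero>\<^bsub>GM :: (nat \<Rightarrow> 'k fps set, nat \<Rightarrow> 'k fps set) module\<^esub>"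
      by (simp add: gr_elt_smult gr_elt_zero)
    then show "zero_divisor_on GM (gr_class R J 1 (fps_X ^ m :: 'k fps))"
      unfolding zero_divisor_on_def cls using gr_elt_carrier monom_not_zero[OF y(1)] by blast
  qed
qed

lemma cohen_macaulay_iff:
  "cohen_macaulay G (GM :: (nat \<Rightarrow> 'k::field fps set, nat \<Rightarrow> 'k fps set) module) \<longleftrightarrow> (\<forall>x\<in>X. v (x + m) = v x + 1)"
proof
  interpret N: nil_poly_module G "GM :: (nat \<Rightarrow> 'k fps set, nat \<Rightarrow> 'k fps set) module" gr_phi gr_psi "gr_elt S X (monom 1 x0)"
    by (rule gr_nil_poly_module)
  show "cohen_macaulay G (GM :: (nat \<Rightarrow> 'k fps set, nat \<Rightarrow> 'k fps set) module)"
    if "\<forall>x\<in>X. v (x + m) = v x + 1"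
    by (rule N.cohen_macaulayI[of "\<lambda>p. gr_elt S S (dilate m p)"])
      (use that m_pos in \<open>auto simp: dilate_supp G_carrier gr_phi_elt subsample_dilate intro: dilate_smult_eq_zero\<close>)
  assume CM: "cohen_macaulay G (GM :: (nat \<Rightarrow> 'k fps set, nat \<Rightarrow> 'k fps set) module)"
  show "\<forall>x\<in>X. v (x + m) = v x + 1"
  proof (rule ccontr)
    assume "\<not> ?thesis"
    then obtain y where y: "y \<in> X" "v (y + m) \<noteq> v y + 1" by blast
    obtain L where L: "\<And>s. s \<in> S \<Longrightarrow> L \<le> u s \<Longrightarrow> u s + v y \<noteq> v (s + y)"
      using v_strict_imp_nilpotent[OF y] by blast
    have "\<exists>n::nat. (f [^]\<^bsub>G\<^esub> n) \<odot>\<^bsub>GM\<^esub> gr_elt S X (monom 1 y) = \<zero>\<^bsub>GM\<^esub>"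
      if f: "f \<in> carrier G" "poly (gr_phi f) 0 = 0" for f :: "nat \<Rightarrow> 'k fps set"
    proof -
      obtain a where a: "a \<in> poly_supp S" "f = gr_elt S S a" by (rule G_elt[OF f(1)])
      have "coeff a 0 = 0" using f(2) a m_pos by (simp add: gr_phi_elt poly_0_coeff_0 coeff_subsample)
      \<comment> \<open>Without constant term, all monomials of \<open>a\<close> have order at least
        1, so those of the \<open>L\<close>-th power have order at least \<open>L\<close>, where
        products with t^y vanish.\<close>
      then have "1 \<le> u s" if "coeff a s \<noteq> 0" for s
        using that a(1) u_zero_iff[of s] unfolding poly_supp_def by (cases "s = 0") (auto simp: Suc_le_eq)
      then obtain b where b: "b \<in> poly_supp S" "f [^]\<^bsub>G\<^esub> L = gr_elt S S b" "\<And>s. coeff b s \<noteq> 0 \<Longrightarrow> L \<le> u s"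
        using pow_weight[of u a L] a(2) by auto
      have "gr_mult S X b (monom 1 y) = 0"
      proof (rule ccontr)
        assume "gr_mult S X b (monom 1 y) \<noteq> 0"
        then obtain x where "coeff (gr_mult S X b (monom 1 y)) x \<noteq> 0" by (metis coeff_0 poly_eqI)
        then show False using L b(3) by (elim gr_mult_supp_nz) (auto split: if_splits)
      qed
      then show ?thesis using b(2) by (intro exI[of _ L]) (simp add: gr_elt_smult gr_elt_zero)
    qed
    then show False using N.not_cohen_macaulayI[OF gr_elt_carrier monom_not_zero[OF y(1)]] CM by blast
  qed
qed

lemma gr_dim_eq_1: "module_dim G (GM :: (nat \<Rightarrow> 'k::field fps set, nat \<Rightarrow> 'k fps set) module) = 1"
  by (rule nil_poly_module.dim_eq_1[OF gr_nil_poly_module])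

end

theorem proposition2p6:
  fixes S E :: "nat set" and m r :: nat and e :: "nat \<Rightarrow> nat"
    and R :: "'k::field fps ring" and J I :: "'k fps set"
  assumes "numerical_semigroup S"
    and "m = sg_multiplicity S"
    and "R = semigroup_ring S"
    and "J = Idl\<^bsub>R\<^esub> {fps_X ^ s | s. s \<in> S \<and> s \<noteq> 0}"
    and "E = (\<Union>i\<in>{1..r}. {e i + s | s. s \<in> S})"
    and "sg_ideal S E"
    and "0 \<notin> E"
    and "I = Idl\<^bsub>R\<^esub> {fps_X ^ e i | i. i \<in> {1..r}}"
  defines "G \<equiv> gr_ring R J"
    and "N \<equiv> gr_module R J (ideal_module R I)"
  defines "C1 \<equiv> cohen_macaulay G N \<and> module_dim G N = 1"
    and "C2 \<equiv> \<not> zero_divisor_on N (gr_class R J 1 (fps_X ^ m))"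
    and "C3 \<equiv> \<forall>x\<in>E. sg_ord S E (x + m) = sg_ord S E x + 1"
    and "C4 \<equiv> \<forall>i\<in>{0..m - 1}. sg_a S E i = int (sg_b S E i)"
  shows "(C1 \<longleftrightarrow> C2) \<and> (C2 \<longleftrightarrow> C3) \<and> (C3 \<longleftrightarrow> C4)"
proof -
  interpret E: num_ideal S m E by unfold_locales (use assms in auto)
  \<comment> \<open>M is level 1 of the filtration of \<open>S\<close>, hence an ideal; this makes
    \<open>genideal_monomials\<close> available for the maximal ideal.\<close>
  interpret M: num_ideal S m "ipow S S (Suc 0)" by (rule E.self.D_ideal)
  have "ipow S S (Suc 0) = sg_fold S (Suc 0)" by (rule E.sg_fold_eq[symmetric])
  also have "\<dots> = S - {0}" unfolding sg_fold_def by (auto simp: lessThan_Suc)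
  finally have M_eq: "ipow S S (Suc 0) = S - {0}" .
  have "J = Idl\<^bsub>R\<^esub> {fps_X ^ t | t. t \<in> S - {0}}" using assms(4) by simp
  also have "\<dots> = fps_supp (S - {0})"
    unfolding assms(3) by (rule M.genideal_monomials[unfolded M_eq]) (use E.zero_mem in force)+
  finally have J: "J = fps_supp (S - {0})" .
  have "I = Idl\<^bsub>R\<^esub> {fps_X ^ t | t. t \<in> e ` {1..r}}"
    unfolding assms(8) by (rule arg_cong[of _ _ "genideal R"]) auto
  also have "\<dots> = fps_supp E"
    unfolding assms(3) by (rule E.genideal_monomials) (use assms(5) E.zero_mem in force)+
  finally have I: "I = fps_supp E" .
  have ord: "C3 \<longleftrightarrow> (\<forall>x\<in>E. sg_val S E (x + m) = sg_val S E x + 1)"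
    unfolding C3_def using E.sg_ord_eq E.add_mult_m_mem[of _ 1] by simp
  have "C1 \<longleftrightarrow> C3" unfolding ord C1_def G_def N_def assms(3) J I
    using E.cohen_macaulay_iff E.gr_dim_eq_1 by blast
  moreover have "C2 \<longleftrightarrow> C3" unfolding ord C2_def N_def assms(3) J I
    using E.zero_divisor_iff by blast
  moreover have "C3 \<longleftrightarrow> C4" unfolding ord C4_def using E.a_eq_b_all_iff by blast
  ultimately show ?thesis by blast
qed

end
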